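(* Let $r > s \ge 0$ be fixed integers. Then $$\chi(G(n,r,s)) \le (1+o(1))\, n^{r-s}\, \frac{(r-s-1)!}{(2r-2s-1)!} \qquad \text{as } n \to \infty.$$
   Context: $G(n,r,s)$ is the graph whose vertices are all $r$-element subsets of $[n]=\{1,\dots,n\}$, two vertices being adjacent if they intersect in exactly $s$ elements. $\chi$ denotes the chromatic number. The integers $r,s$ are fixed and $o(1)$ denotes a quantity (depending on $r,s,n$) tending to $0$ as $n\to\infty$. *)

theory Defs
  imports
    Complex_Main
    "HOL-Library.Landau_Symbols"
    "Graph_Theory.Pair_Digraph"
begin

text \<open>
  Simple graphs are represented by \<^locale>\<open>pair_graph\<close>: a finite vertex set \<^const>\<open>pverts\<close> with a
  symmetric loop-free relation \<^const>\<open>parcs\<close>, each edge being present in both directions.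
\<close>

definition proper_colouring :: "'a pair_pre_digraph \<Rightarrow> nat \<Rightarrow> ('a \<Rightarrow> nat) \<Rightarrow> bool" where
  "proper_colouring G k c \<longleftrightarrow>
     (\<forall>v \<in> pverts G. c v < k) \<and> (\<forall>(u, v) \<in> parcs G. c u \<noteq> c v)"

definition chromatic_number :: "'a pair_pre_digraph \<Rightarrow> nat" where
  "chromatic_number G = (LEAST k. \<exists>c. proper_colouring G k c)"

text \<open>
  The \<open>LEAST\<close> above is attained for every \<^locale>\<open>pair_graph\<close>.
\<close>

lemma (in pair_graph) ex_proper_colouring:
  "\<exists>c. proper_colouring G (chromatic_number G) c"
proof -
  obtain c :: "'a \<Rightarrow> nat" where c: "bij_betw c (pverts G) {0..<card (pverts G)}"
    using ex_bij_betw_finite_nat[OF pair_finite_verts] by blast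
  have "proper_colouring G (card (pverts G)) c"
    unfolding proper_colouring_def
  proof (intro conjI ballI)
    fix v assume "v \<in> pverts G"
    with c show "c v < card (pverts G)" by (auto dest: bij_betwE)
  next
    fix e assume e: "e \<in> parcs G"
    have "c (fst e) \<noteq> c (snd e)"
      using c arc_fst_in_verts[OF e] arc_snd_in_verts[OF e] pair_no_loops[OF e]
      unfolding bij_betw_def by (metis inj_onD)
    then show "case e of (u, v) \<Rightarrow> c u \<noteq> c v"
      by (simp add: case_prod_beta)
  qed
  then have "\<exists>k c. proper_colouring G k c"
    by blast
  then show ?thesis
    unfolding chromatic_number_def by (rule LeastI_ex)
qed

definition intersection_graph :: "nat \<Rightarrow> nat \<Rightarrow> nat \<Rightarrow> nat set pair_pre_digraph" where
  "intersection_graph n r s =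
     (let V = {A. A \<subseteq> {1..n} \<and> card A = r}
      in \<lparr> pverts = V, parcs = {(A, B). A \<in> V \<and> B \<in> V \<and> card (A \<inter> B) = s} \<rparr>)"

lemma pair_graph_intersection_graph:
  assumes "s < r"
  shows "pair_graph (intersection_graph n r s)"
proof -
  let ?G = "intersection_graph n r s"
  have V: "pverts ?G \<subseteq> Pow {1..n}"
    and A: "(A, B) \<in> parcs ?G \<longleftrightarrow> A \<in> pverts ?G \<and> B \<in> pverts ?G \<and> card (A \<inter> B) = s" for A B
    by (auto simp: intersection_graph_def Let_def)
  have card: "card A = r" if "A \<in> pverts ?G" for A
    using that by (simp add: intersection_graph_def Let_def)
  have fV: "finite (pverts ?G)"
    using V by (rule finite_subset) simp
  have sub: "parcs ?G \<subseteq> pverts ?G \<times> pverts ?G"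
    using A by (intro subrelI) simp
  show ?thesis
  proof unfold_locales
    show "finite (pverts ?G)" by (rule fV)
    show "finite (parcs ?G)"
      using sub by (rule finite_subset) (use fV in simp)
    show "symmetric ?G"
      unfolding symmetric_def by (intro symI) (simp add: A Int_commute)
    show "fst e \<in> pverts ?G" "snd e \<in> pverts ?G" if "e \<in> parcs ?G" for e
      using that by (cases e; simp add: A)+
    show "fst e \<noteq> snd e" if "e \<in> parcs ?G" for e
    proof -
      obtain A B where e: "e = (A, B)" by (cases e)
      with that have "A \<in> pverts ?G" "card (A \<inter> B) = s" by (simp_all add: A)
      with assms card[of A] show ?thesis by (auto simp: e)
    qed
  qed
qed

end

theory Submission
  imports
    Defs
    "HOL-Library.Disjoint_Sets"
    "HOL-Library.Ramsey"
    "HOL-Library.FuncSet"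
    "HOL-Combinatorics.Permutations"
    "HOL-Computational_Algebra.Polynomial"
    "HOL-Number_Theory.Cong"
    "HOL-Real_Asymp.Real_Asymp"
begin

text \<open>
  Put \<open>k = r - s\<close> and \<open>m = 2 * r - s - 1\<close>.  Two \<open>r\<close>-subsets of one \<open>m\<close>-set share at least
  \<open>2 * r - m = s + 1\<close> elements.  Call a family of \<open>m\<close>-sets a packing if any two of them share fewer
  than \<open>s\<close> elements.  No two \<open>r\<close>-sets that lie inside members of a packing meet in exactly \<open>s\<close>
  elements, and so all of them may receive the same colour.  An \<open>s\<close>-set lies in about
  \<open>n ^ k / fact k\<close> many \<open>r\<close>-sets, and a packing takes care of at most \<open>(m - s) choose (r - s)\<close> of
  these.  The quotient is \<open>c0 * n ^ k\<close> with \<open>c0 = fact (k - 1) / fact (2 * k - 1)\<close>.  So the bound of the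
  theorem results if the \<open>r\<close>-sets are split into packings that are almost as efficient as possible
  at every single \<open>s\<close>-set.  Such a splitting is reached in four steps.

  On a fixed set of \<open>Q\<close> labels, \<open>near_decomposition_into_packings\<close> gives about \<open>c0 * Q ^ k\<close>
  packings that cover all but a small proportion of the \<open>r\<close>-sets.  This is the near-perfect matching
  theorem for uniform hypergraphs with small codegrees (\<open>near_perfect_matching\<close>), applied to the
  hypergraph whose vertices are the \<open>r\<close>-sets and the pairs of an \<open>s\<close>-set and a colour, and whose
  edges are the pairs of an \<open>m\<close>-set and a colour.  It says nothing about any particular \<open>s\<close>-set.

  The packings are then lifted to \<open>n \<le> Q * p\<close> points, each of which has a label and a value
  modulo \<open>p\<close>.  An \<open>r\<close>-set with distinct labels extends to a unique polynomial of degree less than \<open>r\<close>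
  over the integers modulo \<open>p\<close>, whose \<open>k\<close> top coefficients serve as \<open>p ^ k\<close> additional colours.  Two
  polynomials with equal top coefficients that agree at \<open>s\<close> labels coincide, and therefore packings
  lift to packings.  All of this works for every \<open>p\<close> prime to the positive numbers below \<open>Q\<close>, and
  these are dense enough to take \<open>p\<close> close to \<open>n / Q\<close>.  Each vector of top coefficients comes with a permutation
  of the labels.  Averaging over all permutations turns the statement about almost all \<open>r\<close>-sets into
  one about almost all \<open>r\<close>-sets that contain a given \<open>s\<close>-set with distinct labels
  (\<open>transversal_code.uncoloured\<close>).

  The \<open>s\<close>-sets with a repeated label are still out of reach, and they must be served by the same
  colours.  So there is one labelling for every \<open>s\<close>-set, and the colourings are merged one after
  another (\<open>merge_partial_colourings\<close>).  In one step, the \<open>r\<close>-sets that the new labelling separates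
  take the new colouring, and the others keep the old one.  At an \<open>s\<close>-set that the new labelling
  separates, only a proportion of order \<open>1 / Q\<close> of the \<open>r\<close>-sets is of the second kind.  If the new
  colours are permuted at random, then with positive probability only a proportion of order \<open>1 / Q\<close>
  of the first kind conflicts with the second kind, at all \<open>s\<close>-sets simultaneously.  The \<open>r\<close>-sets in
  conflict lose their colour.  What is lost at an \<open>s\<close>-set depends only on the last labelling that
  separates it, and hence the losses do not add up.

  In the end every \<open>r\<close>-set meets few uncoloured ones in exactly \<open>s\<close> elements, and a greedy
  colouring of these costs a small multiple of \<open>n ^ k\<close> colours.  Letting \<open>Q\<close> grow gives the theorem.
\<close>

section \<open>Averages over random subsets of a finite set\<close>

text \<open>
  The expectation of \<open>f A\<close> when each element of \<open>I\<close> is put into \<open>A\<close> independently with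
  probability \<open>q\<close>.  The algebraic identities hold for all real \<open>q\<close>.
\<close>
definition subset_avg :: "real \<Rightarrow> 'i set \<Rightarrow> ('i set \<Rightarrow> real) \<Rightarrow> real" where
  "subset_avg q I f = (\<Sum>A\<in>Pow I. q ^ card A * (1 - q) ^ card (I - A) * f A)"

lemma subset_avg_add:
  "subset_avg q I (\<lambda>A. f A + h A) = subset_avg q I f + subset_avg q I h"
  by (simp add: subset_avg_def sum.distrib algebra_simps)

lemma subset_avg_diff:
  "subset_avg q I (\<lambda>A. f A - h A) = subset_avg q I f - subset_avg q I h"
  by (simp add: subset_avg_def sum_subtractf algebra_simps)

lemma subset_avg_cmult: "subset_avg q I (\<lambda>A. c * f A) = c * subset_avg q I f"
  by (simp add: subset_avg_def sum_distrib_left mult_ac)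

lemma subset_avg_sum:
  "subset_avg q I (\<lambda>A. \<Sum>j\<in>J. f j A) = (\<Sum>j\<in>J. subset_avg q I (f j))"
  unfolding subset_avg_def by (subst sum.swap) (simp add: sum_distrib_left)

lemma subset_avg_mono:
  assumes "0 \<le> q" "q \<le> 1" "\<And>A. A \<subseteq> I \<Longrightarrow> f A \<le> h A"
  shows "subset_avg q I f \<le> subset_avg q I h"
  unfolding subset_avg_def
  by (intro sum_mono mult_left_mono) (use assms in \<open>auto intro!: mult_nonneg_nonneg\<close>)

text \<open>
  The product over \<open>I\<close> of the binomials \<open>q + (1 - q)\<close>, with the summand \<open>q\<close> dropped at the
  elements of \<open>N\<close>, expands into the average.
\<close>
lemma subset_avg_avoid:
  assumes "finite I" "N \<subseteq> I"
  shows "subset_avg q I (\<lambda>A. of_bool (A \<inter> N = {})) = (1 - q) ^ card N"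
proof -
  let ?a = "\<lambda>i. if i \<in> N then 0 else q"
  have eq: "(\<Prod>i\<in>A. ?a i) = of_bool (A \<inter> N = {}) * q ^ card A" if "A \<subseteq> I" for A
  proof (cases "A \<inter> N = {}")
    case True
    then have "(\<Prod>i\<in>A. ?a i) = (\<Prod>i\<in>A. q)" by (intro prod.cong) auto
    then show ?thesis using True by simp
  next
    case False
    have "finite A" using that assms(1) finite_subset by blast
    then have "(\<Prod>i\<in>A. ?a i) = 0" using False by (auto intro: prod_zero)
    then show ?thesis using False by simp
  qed
  have "subset_avg q I (\<lambda>A. of_bool (A \<inter> N = {}))
      = (\<Sum>A\<in>Pow I. (\<Prod>i\<in>A. ?a i) * (\<Prod>i\<in>I - A. 1 - q))"
    unfolding subset_avg_def by (intro sum.cong) (auto simp: eq)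
  also have "\<dots> = (\<Prod>i\<in>I. ?a i + (1 - q))"
    by (rule prod_add[OF assms(1), symmetric])
  also have "\<dots> = (\<Prod>i\<in>I. if i \<in> N then 1 - q else 1)"
    by (intro prod.cong) auto
  also have "\<dots> = (1 - q) ^ card N"
    using assms by (simp add: prod.If_cases Int_absorb1)
  finally show ?thesis .
qed

text \<open>
  As before, but at \<open>e\<close> the summand \<open>1 - q\<close> is dropped instead.
\<close>
lemma subset_avg_hit:
  assumes "finite I" "N \<subseteq> I" "e \<in> N"
  shows "subset_avg q I (\<lambda>A. of_bool (A \<inter> N = {e})) = q * (1 - q) ^ (card N - 1)"
proof -
  let ?a = "\<lambda>i. if i \<in> N - {e} then 0 else q"
  let ?b = "\<lambda>i. if i = e then 0 else 1 - q"
  have eq: "(\<Prod>i\<in>A. ?a i) * (\<Prod>i\<in>I - A. ?b i)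
      = of_bool (A \<inter> N = {e}) * (q ^ card A * (1 - q) ^ card (I - A))" if "A \<subseteq> I" for A
  proof (cases "A \<inter> N = {e}")
    case True
    then have "(\<Prod>i\<in>A. ?a i) = (\<Prod>i\<in>A. q)" by (intro prod.cong) auto
    moreover have "(\<Prod>i\<in>I - A. ?b i) = (\<Prod>i\<in>I - A. 1 - q)"
      using True by (intro prod.cong) auto
    ultimately show ?thesis using True by simp
  next
    case False
    have fin: "finite A" "finite (I - A)" using that assms(1) finite_subset by blast+
    from False consider i where "i \<in> A" "i \<in> N - {e}" | "e \<in> I - A"
      using assms by blast
    then have "(\<Prod>i\<in>A. ?a i) = 0 \<or> (\<Prod>i\<in>I - A. ?b i) = 0"
      by cases (use fin in \<open>auto intro: prod_zero\<close>)
    then show ?thesis using False by auto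
  qed
  have "subset_avg q I (\<lambda>A. of_bool (A \<inter> N = {e}))
      = (\<Sum>A\<in>Pow I. (\<Prod>i\<in>A. ?a i) * (\<Prod>i\<in>I - A. ?b i))"
    unfolding subset_avg_def by (intro sum.cong refl) (subst eq, auto)
  also have "\<dots> = (\<Prod>i\<in>I. ?a i + ?b i)"
    by (rule prod_add[OF assms(1), symmetric])
  also have "\<dots> = (\<Prod>i\<in>N. ?a i + ?b i)"
    by (rule prod.mono_neutral_right) (use assms in auto)
  also have "\<dots> = q * (\<Prod>i\<in>N - {e}. ?a i + ?b i)"
    using assms finite_subset by (subst prod.remove[of N e]) auto
  also have "(\<Prod>i\<in>N - {e}. ?a i + ?b i) = (\<Prod>i\<in>N - {e}. 1 - q)"
    by (intro prod.cong) auto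
  also have "\<dots> = (1 - q) ^ (card N - 1)"
    using assms by simp
  finally show ?thesis .
qed

lemma subset_avg_const: "finite I \<Longrightarrow> subset_avg q I (\<lambda>A. c) = c"
  using subset_avg_avoid[of I "{}" q] subset_avg_cmult[of q I c "\<lambda>A. 1"] by simp

lemma subset_avg_attained:
  assumes "finite I" "0 \<le> q" "q \<le> 1" "c \<le> subset_avg q I f"
  shows "\<exists>A\<subseteq>I. c \<le> f A"
proof (rule ccontr)
  assume "\<not> (\<exists>A\<subseteq>I. c \<le> f A)"
  then have lt: "f A < c" if "A \<subseteq> I" for A using that not_le by blast
  define m where "m = Max (f ` Pow I)"
  have fin: "finite (f ` Pow I)" using assms(1) by simp
  have "m \<in> f ` Pow I" unfolding m_def by (rule Max_in[OF fin]) auto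
  then have "m < c" using lt by auto
  have "subset_avg q I f \<le> subset_avg q I (\<lambda>A. m)"
    by (rule subset_avg_mono) (use assms fin in \<open>auto simp: m_def\<close>)
  also have "\<dots> = m" by (rule subset_avg_const[OF assms(1)])
  finally show False using \<open>m < c\<close> assms(4) by simp
qed

text \<open>
  Bonferroni's inequality: the union misses at most one pairwise intersection for each pair.
\<close>
lemma card_UN_ge_of_small_intersections:
  fixes N :: "'a \<Rightarrow> 'b set" and c :: real
  assumes "finite X" "0 \<le> c"
    and "\<And>u. u \<in> X \<Longrightarrow> finite (N u) \<and> card (N u) = D"
    and "\<And>u v. u \<in> X \<Longrightarrow> v \<in> X \<Longrightarrow> u \<noteq> v \<Longrightarrow> real (card (N u \<inter> N v)) \<le> c"
  shows "real (card X) * real D - (real (card X))\<^sup>2 * c \<le> real (card (\<Union>u\<in>X. N u))"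
  using assms
proof (induction X rule: finite_induct)
  case (insert x X)
  let ?U = "\<Union>u\<in>X. N u"
  have fin: "finite (N x)" "finite ?U" using insert by auto
  have "real (card (N x \<inter> ?U)) \<le> real (\<Sum>u\<in>X. card (N x \<inter> N u))"
    using card_UN_le[OF insert(1), of "\<lambda>u. N x \<inter> N u"]
    by (simp del: of_nat_sum)
  also have "\<dots> \<le> (\<Sum>u\<in>X. c)"
    unfolding of_nat_sum by (intro sum_mono insert(6)) (use insert(2) in auto)
  finally have inter: "real (card (N x \<inter> ?U)) \<le> card X * c" by simp
  have "card (N x \<union> ?U) + card (N x \<inter> ?U) = D + card ?U"
    using card_Un_Int[OF fin] insert(5)[of x] by simp
  then have "real (card (N x \<union> ?U)) = real D + real (card ?U) - real (card (N x \<inter> ?U))"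
    by linarith
  then have "real (card (N x \<union> ?U)) \<ge> D + card ?U - card X * c" using inter by linarith
  moreover have "real (card X) * D - (real (card X))\<^sup>2 * c \<le> card ?U"
    by (rule insert.IH) (use insert in auto)
  moreover have "real (card X) * c + (real (card X))\<^sup>2 * c \<le> (1 + real (card X))\<^sup>2 * c"
    using insert(4) by (simp add: power2_eq_square algebra_simps)
  ultimately show ?case using insert(1,2) by (simp add: algebra_simps)
qed simp

text \<open>
  Lowering an exponent by \<open>x\<close> raises the power by at most \<open>q * x\<close>.  This additive form lets all
  errors below be added up.
\<close>
lemma one_minus_power_le_shift:
  fixes q x :: real
  assumes "0 \<le> q" "q \<le> 1" "0 \<le> x" "real c - x \<le> real b"
  shows "(1 - q) ^ b \<le> (1 - q) ^ c + q * x"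
proof (cases "c \<le> b")
  case True
  then have "(1 - q) ^ b \<le> (1 - q) ^ c" using assms by (intro power_decreasing) auto
  then show ?thesis using assms by (simp add: add_increasing2)
next
  case False
  define j where "j = c - b"
  have c: "c = b + j" using False by (simp add: j_def)
  have "1 - q * real j \<le> (1 - q) ^ j"
    using Bernoulli_inequality[of "-q" j] assms by (simp add: mult.commute)
  then have "(1 - q) ^ b * (1 - (1 - q) ^ j) \<le> 1 * (q * real j)"
    using assms by (intro mult_mono power_le_one) (auto simp: power_le_one)
  also have "\<dots> \<le> q * x" using assms c by (simp add: mult_left_mono)
  finally show ?thesis by (simp add: c power_add algebra_simps)
qed

section \<open>One step of the nibble\<close>

text \<open>
  A hypergraph is given by an index set \<open>E\<close> and the vertex set \<open>g e\<close> of each edge \<open>e\<close>.  One bite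
  of the nibble picks each edge with probability \<open>q = \<epsilon> / D\<close>.  Picked edges that meet no other
  picked edge go into the matching, and the vertices of picked edges are discarded.
\<close>
locale bite =
  fixes E :: "'e set" and g :: "'e \<Rightarrow> 'a set" and K D :: nat and \<gamma> \<epsilon> :: real
  assumes finite_E: "finite E"
    and K: "2 \<le> K"
    and card_g: "e \<in> E \<Longrightarrow> card (g e) = K"
    and degree: "card {e \<in> E. v \<in> g e} \<le> D"
    and codegree: "u \<noteq> v \<Longrightarrow> real (card {e \<in> E. u \<in> g e \<and> v \<in> g e}) \<le> \<gamma> * real D"
    and D_pos: "0 < D" and gamma: "0 \<le> \<gamma>" and eps: "0 < \<epsilon>" "\<epsilon> \<le> 1"
begin

definition "deg v = card {e \<in> E. v \<in> g e}"
definition "V = (\<Union>e\<in>E. g e)"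
definition "q = \<epsilon> / real D"
definition "\<kappa> = (1 - q) ^ D"

text \<open>
  Vertices whose degree is below \<open>D\<close> receive dummy edges \<open>Inr (v, j)\<close>, so that exactly \<open>D\<close> indices
  can discard a given vertex \<open>v\<close>, namely those in \<open>N v\<close>.  Then every vertex survives with
  the same probability \<open>\<kappa>\<close>, and only an upper bound on the degrees has to be maintained from one
  bite to the next.
\<close>
definition I :: "('e + 'a \<times> nat) set" where
  "I = Inl ` E \<union> Inr ` (V \<times> {..<D})"
definition N :: "'a \<Rightarrow> ('e + 'a \<times> nat) set" where
  "N v = Inl ` {e \<in> E. v \<in> g e} \<union> Inr ` ({v} \<times> {..<D - deg v})"
definition NN :: "'a set \<Rightarrow> ('e + 'a \<times> nat) set" where
  "NN X = (\<Union>u\<in>X. N u)"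

lemma finite_g: "e \<in> E \<Longrightarrow> finite (g e)"
  using card_g[of e] K by (intro card_ge_0_finite) auto

lemma finite_V: "finite V"
  unfolding V_def using finite_E finite_g by auto

lemma finite_I: "finite I"
  unfolding I_def using finite_E finite_V by auto

lemma g_subset_V: "e \<in> E \<Longrightarrow> g e \<subseteq> V"
  by (auto simp: V_def)

lemma N_subset_I: "v \<in> V \<Longrightarrow> N v \<subseteq> I"
  by (auto simp: N_def I_def)

lemma NN_subset_I: "X \<subseteq> V \<Longrightarrow> NN X \<subseteq> I"
  using N_subset_I by (auto simp: NN_def)

lemma finite_N: "finite (N v)"
  unfolding N_def using finite_E by auto

lemma deg_le: "deg v \<le> D"
  unfolding deg_def by (rule degree)

lemma card_N: "card (N v) = D"
proof -
  have "card (N v) = card (Inl ` {e \<in> E. v \<in> g e} :: ('e + 'a \<times> nat) set)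
      + card (Inr ` ({v} \<times> {..<D - deg v}) :: ('e + 'a \<times> nat) set)"
    unfolding N_def using finite_E by (intro card_Un_disjoint) auto
  also have "\<dots> = deg v + (D - deg v)"
    by (simp add: card_image deg_def card_cartesian_product)
  finally show ?thesis using deg_le[of v] by simp
qed

lemma card_N_Int:
  assumes "u \<noteq> v"
  shows "real (card (N u \<inter> N v)) \<le> \<gamma> * D"
proof -
  have "N u \<inter> N v = Inl ` {e \<in> E. u \<in> g e \<and> v \<in> g e}"
    using assms by (auto simp: N_def)
  then show ?thesis using codegree[OF assms] by (simp add: card_image)
qed

lemma q: "0 < q" "q \<le> 1"
  using eps D_pos by (auto simp: q_def field_simps)

lemma q_D: "q * D = \<epsilon>"
  using D_pos by (simp add: q_def)

lemma kappa_ge: "1 - \<epsilon> \<le> \<kappa>"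
  using Bernoulli_inequality[of "-q" D] q q_D by (simp add: \<kappa>_def mult.commute)

lemma kappa: "0 \<le> \<kappa>" "\<kappa> \<le> 1"
  using q by (auto simp: \<kappa>_def intro!: power_le_one)

lemma card_NN_le: "finite X \<Longrightarrow> card (NN X) \<le> card X * D"
  using card_UN_le[of X N] by (simp add: NN_def card_N)

lemma avg_avoid_ge:
  assumes "X \<subseteq> V"
  shows "\<kappa> ^ card X \<le> subset_avg q I (\<lambda>A. of_bool (A \<inter> NN X = {}))"
proof -
  have "finite X" using assms finite_V finite_subset by blast
  have "\<kappa> ^ card X = (1 - q) ^ (card X * D)"
    by (simp add: \<kappa>_def mult.commute flip: power_mult)
  also have "\<dots> \<le> (1 - q) ^ card (NN X)"
    using card_NN_le[OF \<open>finite X\<close>] q by (intro power_decreasing) auto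
  finally show ?thesis
    by (simp add: subset_avg_avoid[OF finite_I NN_subset_I[OF assms]])
qed

text \<open>
  By the bound on codegrees the sets \<open>N u\<close> are nearly disjoint, and so the vertices of \<open>X\<close> survive
  almost independently.
\<close>
lemma avg_avoid_le:
  assumes "X \<subseteq> V"
  shows "subset_avg q I (\<lambda>A. of_bool (A \<inter> NN X = {})) \<le> \<kappa> ^ card X + \<epsilon> * (real (card X))\<^sup>2 * \<gamma>"
proof -
  have "finite X" using assms finite_V finite_subset by blast
  have "(1 - q) ^ card (NN X) \<le> (1 - q) ^ (card X * D) + q * ((real (card X))\<^sup>2 * (\<gamma> * D))"
  proof (rule one_minus_power_le_shift)
    show "real (card X * D) - (real (card X))\<^sup>2 * (\<gamma> * D) \<le> real (card (NN X))"
      unfolding NN_def of_nat_mult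
      by (rule card_UN_ge_of_small_intersections[OF \<open>finite X\<close>])
         (use gamma in \<open>auto simp: finite_N card_N intro: card_N_Int\<close>)
  qed (use q gamma in auto)
  also have "q * ((real (card X))\<^sup>2 * (\<gamma> * D)) = (q * D) * (real (card X))\<^sup>2 * \<gamma>"
    by (simp add: mult_ac)
  also have "(1 - q) ^ (card X * D) = \<kappa> ^ card X"
    by (simp add: \<kappa>_def mult.commute flip: power_mult)
  finally show ?thesis
    by (simp add: subset_avg_avoid[OF finite_I NN_subset_I[OF assms]] q_D)
qed

text \<open>
  \<open>live A\<close> consists of the edges all of whose vertices survive, and \<open>Y v A\<close> is the degree of \<open>v\<close> in
  \<open>live A\<close>.  It vanishes if \<open>v\<close> is discarded.
\<close>
definition "live A = {e \<in> E. A \<inter> NN (g e) = {}}"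
definition "isolated A = {e \<in> E. A \<inter> NN (g e) = {Inl e}}"
definition "Y v A = real (card {e \<in> live A. v \<in> g e})"

lemma live_subset: "live A \<subseteq> E"
  by (auto simp: live_def)

lemma Y_le: "Y v A \<le> deg v"
  unfolding Y_def deg_def of_nat_le_iff
  by (rule card_mono) (use finite_E in \<open>auto simp: live_def\<close>)

lemma Y_sum: "Y v A = (\<Sum>e\<in>{e \<in> E. v \<in> g e}. of_bool (A \<inter> NN (g e) = {}))"
proof -
  have "{e \<in> live A. v \<in> g e} = {e \<in> E. v \<in> g e} \<inter> {e. A \<inter> NN (g e) = {}}"
    by (auto simp: live_def)
  then show ?thesis using finite_E by (simp add: Y_def)
qed

lemma avg_Y_ge: "deg v * \<kappa> ^ K \<le> subset_avg q I (Y v)"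
proof -
  have "deg v * \<kappa> ^ K = (\<Sum>e\<in>{e \<in> E. v \<in> g e}. \<kappa> ^ card (g e))"
    by (simp add: deg_def card_g)
  also have "\<dots> \<le> (\<Sum>e\<in>{e \<in> E. v \<in> g e}. subset_avg q I (\<lambda>A. of_bool (A \<inter> NN (g e) = {})))"
    by (intro sum_mono avg_avoid_ge) (use g_subset_V in auto)
  also have "\<dots> = subset_avg q I (Y v)"
    by (simp add: Y_sum[abs_def] subset_avg_sum)
  finally show ?thesis .
qed

text \<open>
  The second moment is a sum over pairs of edges at \<open>v\<close>.  A pair that meets only in \<open>v\<close> spans
  \<open>2 * K - 1\<close> vertices, which survive almost independently.  The other pairs are few, again by
  the bound on codegrees.
\<close>
lemma avg_Y_sq_le:
  "subset_avg q I (\<lambda>A. (Y v A)\<^sup>2)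
     \<le> (real (deg v))\<^sup>2 * (\<kappa> ^ (2 * K - 1) + 4 * \<epsilon> * (real K)\<^sup>2 * \<gamma>) + deg v * (K * \<gamma> * D)"
proof -
  let ?Ev = "{e \<in> E. v \<in> g e}"
  define p where "p e f = subset_avg q I (\<lambda>A. of_bool (A \<inter> NN (g e \<union> g f) = {}))" for e f
  let ?b = "\<kappa> ^ (2 * K - 1) + 4 * \<epsilon> * (real K)\<^sup>2 * \<gamma>"
  have b0: "0 \<le> ?b" using kappa gamma eps by simp
  have sq: "(Y v A)\<^sup>2 = (\<Sum>e\<in>?Ev. \<Sum>f\<in>?Ev. of_bool (A \<inter> NN (g e \<union> g f) = {}))" for A
  proof -
    have "NN (g e \<union> g f) = NN (g e) \<union> NN (g f)" for e f by (auto simp: NN_def)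
    then have "of_bool (A \<inter> NN (g e) = {}) * of_bool (A \<inter> NN (g f) = {})
        = (of_bool (A \<inter> NN (g e \<union> g f) = {}) :: real)" for e f
      by (simp add: Int_Un_distrib)
    then show ?thesis
      by (simp add: Y_sum power2_eq_square sum_product)
  qed
  have p1: "p e f \<le> 1" if "e \<in> ?Ev" "f \<in> ?Ev" for e f
  proof -
    have "p e f \<le> subset_avg q I (\<lambda>A. 1)"
      unfolding p_def by (rule subset_avg_mono) (use q in auto)
    then show ?thesis by (simp add: subset_avg_const finite_I)
  qed
  have generic: "p e f \<le> ?b" if e: "e \<in> ?Ev" and f: "f \<in> ?Ev" and ef: "g e \<inter> g f = {v}" for e f
  proof -
    have "card (g e \<union> g f) + card (g e \<inter> g f) = K + K"
      using card_Un_Int[of "g e" "g f"] e f card_g finite_g by simp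
    then have c: "card (g e \<union> g f) = 2 * K - 1" using ef by simp
    have "p e f \<le> \<kappa> ^ (2 * K - 1) + \<epsilon> * (real (2 * K - 1))\<^sup>2 * \<gamma>"
      unfolding p_def using avg_avoid_le[of "g e \<union> g f"] e f g_subset_V c by auto
    also have "(real (2 * K - 1))\<^sup>2 \<le> (2 * real K)\<^sup>2"
      by (intro power_mono) auto
    then have "\<epsilon> * (real (2 * K - 1))\<^sup>2 * \<gamma> \<le> \<epsilon> * (2 * real K)\<^sup>2 * \<gamma>"
      using eps gamma by (intro mult_right_mono mult_left_mono) auto
    finally show ?thesis by (simp add: power2_eq_square mult_ac)
  qed
  have row: "(\<Sum>f\<in>?Ev. p e f) \<le> deg v * ?b + K * \<gamma> * D" if e: "e \<in> ?Ev" for e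
  proof -
    define S where "S = (\<Union>u\<in>g e - {v}. {f \<in> E. u \<in> g f \<and> v \<in> g f})"
    have "(\<Sum>f\<in>?Ev. p e f) \<le> (\<Sum>f\<in>?Ev. ?b + of_bool (f \<in> S))"
    proof (rule sum_mono)
      fix f assume f: "f \<in> ?Ev"
      show "p e f \<le> ?b + of_bool (f \<in> S)"
      proof (cases "f \<in> S")
        case True then show ?thesis using p1[OF e f] b0 by simp
      next
        case False
        then have "g e \<inter> g f = {v}" using e f by (auto simp: S_def)
        then show ?thesis using generic[OF e f] False by simp
      qed
    qed
    also have "\<dots> = deg v * ?b + card (?Ev \<inter> S)"
      using finite_E by (simp add: sum.distrib deg_def)
    also have "real (card (?Ev \<inter> S)) \<le> K * \<gamma> * D"
    proof -
      have fin: "finite (g e - {v})" using e finite_g by auto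
      have "card (?Ev \<inter> S) \<le> card S"
        unfolding S_def by (rule card_mono) (use fin finite_E in auto)
      also have "\<dots> \<le> (\<Sum>u\<in>g e - {v}. card {f \<in> E. u \<in> g f \<and> v \<in> g f})"
        unfolding S_def by (rule card_UN_le[OF fin])
      finally have "real (card (?Ev \<inter> S)) \<le> (\<Sum>u\<in>g e - {v}. real (card {f \<in> E. u \<in> g f \<and> v \<in> g f}))"
        unfolding of_nat_sum[symmetric] of_nat_le_iff .
      also have "\<dots> \<le> (\<Sum>u\<in>g e - {v}. \<gamma> * D)"
        by (intro sum_mono codegree) auto
      also have "\<dots> = real (card (g e - {v})) * (\<gamma> * D)" by simp
      also have "\<dots> \<le> real K * (\<gamma> * D)"
        using e card_g[of e] gamma by (intro mult_right_mono) auto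
      finally show ?thesis by (simp add: mult_ac)
    qed
    finally show ?thesis by simp
  qed
  have "subset_avg q I (\<lambda>A. (Y v A)\<^sup>2) = (\<Sum>e\<in>?Ev. \<Sum>f\<in>?Ev. p e f)"
    by (simp add: sq subset_avg_sum p_def)
  also have "\<dots> \<le> (\<Sum>e\<in>?Ev. deg v * ?b + K * \<gamma> * D)"
    by (intro sum_mono row)
  also have "\<dots> = deg v * (deg v * ?b + K * \<gamma> * D)"
    by (simp add: deg_def)
  finally show ?thesis by (simp add: power2_eq_square algebra_simps)
qed

text \<open>
  The variance of the degree of a surviving vertex around its mean.  The main terms, all of them
  multiples of \<open>\<kappa> ^ (2 * K - 1)\<close>, cancel.  The bound is proportional to \<open>deg v\<close>, and therefore its
  sum over all vertices is proportional to the number of edges.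
\<close>
lemma avg_deviation_le:
  assumes "v \<in> V"
  shows "subset_avg q I (\<lambda>A. (Y v A - of_bool (A \<inter> N v = {}) * (deg v * \<kappa> ^ (K - 1)))\<^sup>2)
    \<le> 5 * (real K)\<^sup>2 * \<gamma> * deg v * D"
proof -
  let ?d = "real (deg v)" and ?c = "deg v * \<kappa> ^ (K - 1)"
  have surv: "Y v A * of_bool (A \<inter> N v = {}) = Y v A" for A
  proof (cases "A \<inter> N v = {}")
    case False
    then have "{e \<in> live A. v \<in> g e} = {}" by (auto simp: live_def NN_def)
    then have "Y v A = 0" unfolding Y_def by (simp only: card.empty of_nat_0)
    then show ?thesis by simp
  qed simp
  have sq: "(Y v A - of_bool (A \<inter> N v = {}) * ?c)\<^sup>2
      = (Y v A)\<^sup>2 - 2 * ?c * Y v A + ?c\<^sup>2 * of_bool (A \<inter> N v = {})" for A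
    using surv[of A] by (auto simp: power2_eq_square algebra_simps)
  have "subset_avg q I (\<lambda>A. (Y v A - of_bool (A \<inter> N v = {}) * ?c)\<^sup>2)
      = subset_avg q I (\<lambda>A. (Y v A)\<^sup>2) - 2 * ?c * subset_avg q I (Y v) + ?c\<^sup>2 * \<kappa>"
    unfolding sq
    by (simp add: subset_avg_add subset_avg_diff subset_avg_cmult
        subset_avg_avoid[OF finite_I N_subset_I[OF assms]] card_N flip: \<kappa>_def)
  also have "\<dots> \<le> ?d\<^sup>2 * (\<kappa> ^ (2 * K - 1) + 4 * \<epsilon> * (real K)\<^sup>2 * \<gamma>) + ?d * (K * \<gamma> * D)
      - 2 * ?c * (?d * \<kappa> ^ K) + ?c\<^sup>2 * \<kappa>"
    using avg_Y_sq_le[of v] avg_Y_ge[of v] kappa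
    by (intro add_right_mono diff_mono mult_left_mono) auto
  also have "2 * ?c * (?d * \<kappa> ^ K) = 2 * (?d\<^sup>2 * \<kappa> ^ (2 * K - 1))"
  proof -
    have "2 * K - 1 = (K - 1) + K" using K by simp
    then show ?thesis by (simp add: power_add power2_eq_square)
  qed
  also have "?c\<^sup>2 * \<kappa> = ?d\<^sup>2 * \<kappa> ^ (2 * K - 1)"
  proof -
    have "2 * K - 1 = (K - 1) + (K - 1) + 1" using K by simp
    then show ?thesis by (simp only: power_add power2_eq_square power_one_right) (simp add: mult_ac)
  qed
  also have "?d\<^sup>2 * (\<kappa> ^ (2 * K - 1) + 4 * \<epsilon> * (real K)\<^sup>2 * \<gamma>) + ?d * (K * \<gamma> * D)
      - 2 * (?d\<^sup>2 * \<kappa> ^ (2 * K - 1)) + ?d\<^sup>2 * \<kappa> ^ (2 * K - 1)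
      = (4 * (real K)\<^sup>2 * \<gamma> * ?d) * (\<epsilon> * ?d) + (K * \<gamma> * ?d * D) * 1"
    by (simp add: algebra_simps power2_eq_square)
  also have "\<dots> \<le> (4 * (real K)\<^sup>2 * \<gamma> * ?d) * (1 * D) + (K * \<gamma> * ?d * D) * K"
  proof -
    have "\<epsilon> * ?d \<le> 1 * real D" using eps deg_le[of v] by (intro mult_mono) auto
    then show ?thesis using gamma K by (intro add_mono mult_left_mono) auto
  qed
  finally show ?thesis by (simp add: algebra_simps power2_eq_square)
qed

lemma sum_deg: "(\<Sum>v\<in>V. deg v) = K * card E"
proof -
  have "{v \<in> V. v \<in> g e} = g e" if "e \<in> E" for e using g_subset_V[OF that] by auto
  then show ?thesis
    unfolding deg_def by (intro sum_multicount finite_V finite_E) (simp add: card_g)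
qed

text \<open>
  Edges at a vertex of too large a remaining degree are dropped, which restores a strict upper bound
  on the degrees.
\<close>
definition "trimmed \<eta> A = {e \<in> live A. \<forall>u\<in>g e. Y u A \<le> (\<kappa> ^ (K - 1) + \<eta>) * D}"

text \<open>
  By Chebyshev's inequality vertices of too large a remaining degree are rare, and each
  of them costs at most \<open>D\<close> edges.
\<close>
lemma avg_card_trimmed_ge:
  assumes "0 < \<eta>"
  shows "card E * (\<kappa> ^ K - 5 * real K ^ 3 * \<gamma> / \<eta>\<^sup>2) \<le> subset_avg q I (\<lambda>A. real (card (trimmed \<eta> A)))"
proof -
  define Z where "Z v A = (Y v A - of_bool (A \<inter> N v = {}) * (deg v * \<kappa> ^ (K - 1)))\<^sup>2" for v A
  define w where "w = real D / (\<eta> * D)\<^sup>2"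
  have w0: "0 \<le> w" by (simp add: w_def)
  have ge: "real (card (live A)) - (\<Sum>v\<in>V. w * Z v A) \<le> real (card (trimmed \<eta> A))" for A
  proof -
    let ?X = "{v \<in> V. Y v A > (\<kappa> ^ (K - 1) + \<eta>) * D}"
    have fin: "finite (live A)" using finite_E live_subset finite_subset by blast
    have "live A - trimmed \<eta> A \<subseteq> (\<Union>v\<in>?X. {e \<in> live A. v \<in> g e})"
    proof
      fix e assume "e \<in> live A - trimmed \<eta> A"
      then obtain u where "e \<in> live A" "u \<in> g e" "Y u A > (\<kappa> ^ (K - 1) + \<eta>) * D"
        by (force simp: trimmed_def)
      then show "e \<in> (\<Union>v\<in>?X. {e \<in> live A. v \<in> g e})"
        using live_subset g_subset_V by blast
    qed
    moreover have "finite (\<Union>v\<in>?X. {e \<in> live A. v \<in> g e})"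
      by (rule finite_subset[OF _ fin]) auto
    ultimately have "card (live A - trimmed \<eta> A) \<le> card (\<Union>v\<in>?X. {e \<in> live A. v \<in> g e})"
      by (intro card_mono)
    also have "\<dots> \<le> (\<Sum>v\<in>?X. card {e \<in> live A. v \<in> g e})"
      by (rule card_UN_le) (use finite_V in auto)
    finally have "real (card (live A - trimmed \<eta> A)) \<le> (\<Sum>v\<in>?X. Y v A)"
      unfolding Y_def of_nat_sum[symmetric] of_nat_le_iff .
    also have "\<dots> \<le> (\<Sum>v\<in>?X. w * Z v A)"
    proof (rule sum_mono)
      fix v assume v: "v \<in> ?X"
      have pos: "0 \<le> \<kappa> ^ (K - 1)" using kappa by simp
      have "0 \<le> (\<kappa> ^ (K - 1) + \<eta>) * D" using pos assms by simp
      then have "Y v A > 0" using v by simp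
      then have "{e \<in> live A. v \<in> g e} \<noteq> {}" by (auto simp: Y_def card_gt_0_iff)
      then have "A \<inter> N v = {}" by (auto simp: live_def NN_def)
      moreover have "real (deg v) * \<kappa> ^ (K - 1) \<le> D * \<kappa> ^ (K - 1)"
        using deg_le[of v] pos by (intro mult_right_mono) auto
      ultimately have "\<eta> * D \<le> Y v A - of_bool (A \<inter> N v = {}) * (deg v * \<kappa> ^ (K - 1))"
        using v by (simp add: algebra_simps)
      then have "(\<eta> * D)\<^sup>2 \<le> Z v A" unfolding Z_def using assms by (intro power_mono) auto
      then have "1 \<le> Z v A / (\<eta> * D)\<^sup>2" using assms D_pos by simp
      then have "real D * 1 \<le> D * (Z v A / (\<eta> * D)\<^sup>2)" by (intro mult_left_mono) auto
      moreover have "Y v A \<le> D" using Y_le[of v A] deg_le[of v] by simp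
      ultimately show "Y v A \<le> w * Z v A" by (simp add: w_def)
    qed
    also have "\<dots> \<le> (\<Sum>v\<in>V. w * Z v A)"
      using finite_V w0 by (intro sum_mono2) (auto simp: Z_def)
    finally have "real (card (live A - trimmed \<eta> A)) \<le> (\<Sum>v\<in>V. w * Z v A)" .
    moreover have "card (live A - trimmed \<eta> A) = card (live A) - card (trimmed \<eta> A)"
      using fin by (intro card_Diff_subset) (auto simp: trimmed_def intro: finite_subset)
    moreover have "card (trimmed \<eta> A) \<le> card (live A)"
      using fin by (intro card_mono) (auto simp: trimmed_def)
    ultimately show ?thesis by (simp add: of_nat_diff)
  qed
  have live: "card E * \<kappa> ^ K \<le> subset_avg q I (\<lambda>A. real (card (live A)))"
  proof -
    have "real (card (live A)) = (\<Sum>e\<in>E. of_bool (A \<inter> NN (g e) = {}))" for A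
      using finite_E by (simp add: live_def Int_def)
    then have eq: "subset_avg q I (\<lambda>A. real (card (live A)))
        = (\<Sum>e\<in>E. subset_avg q I (\<lambda>A. of_bool (A \<inter> NN (g e) = {})))"
      by (simp add: subset_avg_sum)
    moreover have "(\<Sum>e\<in>E. \<kappa> ^ card (g e)) \<le> (\<Sum>e\<in>E. subset_avg q I (\<lambda>A. of_bool (A \<inter> NN (g e) = {})))"
      by (intro sum_mono avg_avoid_ge g_subset_V)
    ultimately show ?thesis by (simp add: card_g)
  qed
  have "(\<Sum>v\<in>V. w * subset_avg q I (Z v)) \<le> (\<Sum>v\<in>V. w * (5 * (real K)\<^sup>2 * \<gamma> * deg v * D))"
    unfolding Z_def using w0 avg_deviation_le by (intro sum_mono mult_left_mono) auto
  also have "\<dots> = w * (5 * (real K)\<^sup>2 * \<gamma> * D) * (\<Sum>v\<in>V. real (deg v))"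
    by (simp add: sum_distrib_left mult_ac)
  also have "(\<Sum>v\<in>V. real (deg v)) = K * card E"
    using sum_deg by (simp flip: of_nat_sum)
  also have "w * (5 * (real K)\<^sup>2 * \<gamma> * D) * real (K * card E) = card E * (5 * real K ^ 3 * \<gamma> / \<eta>\<^sup>2)"
    using D_pos assms by (simp add: w_def field_simps power2_eq_square power3_eq_cube)
  finally have dev: "(\<Sum>v\<in>V. w * subset_avg q I (Z v)) \<le> card E * (5 * real K ^ 3 * \<gamma> / \<eta>\<^sup>2)" .
  have "subset_avg q I (\<lambda>A. real (card (live A)) - (\<Sum>v\<in>V. w * Z v A))
      \<le> subset_avg q I (\<lambda>A. real (card (trimmed \<eta> A)))"
    by (rule subset_avg_mono) (use q ge in auto)
  then show ?thesis
    using live dev by (simp add: subset_avg_diff subset_avg_sum subset_avg_cmult algebra_simps)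
qed

lemma avg_card_isolated_ge:
  "card E * (q * \<kappa> ^ K) \<le> subset_avg q I (\<lambda>A. real (card (isolated A)))"
proof -
  have "real (card (isolated A)) = (\<Sum>e\<in>E. of_bool (A \<inter> NN (g e) = {Inl e}))" for A
    using finite_E by (simp add: isolated_def Int_def)
  then have "subset_avg q I (\<lambda>A. real (card (isolated A)))
      = (\<Sum>e\<in>E. subset_avg q I (\<lambda>A. of_bool (A \<inter> NN (g e) = {Inl e})))"
    by (simp add: subset_avg_sum)
  moreover have "q * \<kappa> ^ K \<le> subset_avg q I (\<lambda>A. of_bool (A \<inter> NN (g e) = {Inl e}))" if e: "e \<in> E" for e
  proof -
    have "g e \<noteq> {}" using card_g[OF e] K by auto
    then have "Inl e \<in> NN (g e)" using e by (auto simp: NN_def N_def)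
    then have "subset_avg q I (\<lambda>A. of_bool (A \<inter> NN (g e) = {Inl e})) = q * (1 - q) ^ (card (NN (g e)) - 1)"
      by (rule subset_avg_hit[OF finite_I NN_subset_I[OF g_subset_V[OF e]]])
    moreover have "\<kappa> ^ K = (1 - q) ^ (K * D)" by (simp add: \<kappa>_def mult.commute flip: power_mult)
    moreover have "(1 - q) ^ (K * D) \<le> (1 - q) ^ (card (NN (g e)) - 1)"
      using card_NN_le[OF finite_g[OF e]] card_g[OF e] q by (intro power_decreasing) auto
    ultimately show ?thesis using q by simp
  qed
  ultimately show ?thesis using sum_bounded_below[of E "q * \<kappa> ^ K"] by (simp add: mult.commute)
qed

end

section \<open>Near-perfect matchings in hypergraphs with small codegrees\<close>

text \<open>
  The size of a matching is going to be measured against \<open>card E / D\<close>, the size of a perfect matching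
  in the regular case.  With this measure, upper bounds on degrees and codegrees are the only data that have
  to be passed from one bite to the next.
\<close>
definition sparse_uniform :: "'e set \<Rightarrow> ('e \<Rightarrow> 'a set) \<Rightarrow> nat \<Rightarrow> nat \<Rightarrow> real \<Rightarrow> bool" where
  "sparse_uniform E g K D \<gamma> \<longleftrightarrow> finite E \<and> (\<forall>e\<in>E. card (g e) = K) \<and>
     (\<forall>v. card {e \<in> E. v \<in> g e} \<le> D) \<and>
     (\<forall>u v. u \<noteq> v \<longrightarrow> real (card {e \<in> E. u \<in> g e \<and> v \<in> g e}) \<le> \<gamma> * real D)"

context bite begin

text \<open>
  The isolated picked edges are disjoint from each other and from every surviving edge.  Hence a
  matching of the trimmed hypergraph extends by them, and some outcome does as well as the average.
\<close>
lemma extend_matching: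
  fixes \<eta> \<theta> \<gamma>' :: real
  assumes eta: "0 < \<eta>" and theta: "0 \<le> \<theta>"
    and codeg: "\<gamma> * D \<le> \<gamma>' * real (nat \<lfloor>(\<kappa> ^ (K - 1) + \<eta>) * D\<rfloor>)"
    and IH: "\<And>E' D'. sparse_uniform E' g K D' \<gamma>' \<Longrightarrow>
      \<exists>F\<subseteq>E'. disjoint_family_on g F \<and> \<theta> * card E' \<le> real D' * card F"
  shows "\<exists>F\<subseteq>E. disjoint_family_on g F \<and>
    card E * (\<epsilon> * \<kappa> ^ K + \<theta> * ((\<kappa> ^ K - 5 * real K ^ 3 * \<gamma> / \<eta>\<^sup>2) / (\<kappa> ^ (K - 1) + \<eta>))) \<le> real D * card F"
proof -
  let ?b = "\<kappa> ^ (K - 1) + \<eta>"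
  let ?x = "\<kappa> ^ K - 5 * real K ^ 3 * \<gamma> / \<eta>\<^sup>2"
  have b: "0 < ?b" using eta kappa by (simp add: add_nonneg_pos)
  define f where "f A = D * real (card (isolated A)) + \<theta> / ?b * real (card (trimmed \<eta> A))" for A
  have "card E * (\<epsilon> * \<kappa> ^ K + \<theta> * (?x / ?b)) = D * (card E * (q * \<kappa> ^ K)) + \<theta> / ?b * (card E * ?x)"
  proof -
    have dist: "c * (u + \<theta> * (x / b)) = c * u + \<theta> / b * (c * x)" for c u x b :: real
      by (simp add: distrib_left)
    have "D * (card E * (q * \<kappa> ^ K)) = card E * ((q * D) * \<kappa> ^ K)" by simp
    then have "D * (card E * (q * \<kappa> ^ K)) = card E * (\<epsilon> * \<kappa> ^ K)" unfolding q_D .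
    then show ?thesis unfolding dist by (rule arg_cong2[OF sym refl])
  qed
  also have "\<dots> \<le> subset_avg q I f"
    unfolding f_def subset_avg_add subset_avg_cmult
    using avg_card_isolated_ge avg_card_trimmed_ge[OF eta] theta b
    by (intro add_mono mult_left_mono) auto
  finally obtain A where A: "card E * (\<epsilon> * \<kappa> ^ K + \<theta> * (?x / ?b)) \<le> f A"
    using subset_avg_attained[OF finite_I less_imp_le[OF q(1)] q(2)] by blast
  define E' where "E' = trimmed \<eta> A"
  define D' where "D' = nat \<lfloor>?b * D\<rfloor>"
  have E': "E' \<subseteq> E" "E' \<subseteq> live A" by (auto simp: E'_def trimmed_def live_def)
  have finE': "finite E'" using E'(1) finite_E finite_subset by blast
  have D'_le: "real D' \<le> ?b * D" unfolding D'_def using b by (intro of_nat_floor) simp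
  have "sparse_uniform E' g K D' \<gamma>'"
    unfolding sparse_uniform_def
  proof (intro conjI ballI allI impI)
    show "finite E'" by (rule finE')
    show "card (g e) = K" if "e \<in> E'" for e using that E' card_g by blast
    show "card {e \<in> E'. v \<in> g e} \<le> D'" for v
    proof (cases "\<exists>e\<in>E'. v \<in> g e")
      case True
      then have "Y v A \<le> ?b * D" by (auto simp: E'_def trimmed_def)
      moreover have "card {e \<in> E'. v \<in> g e} \<le> card {e \<in> live A. v \<in> g e}"
        by (rule card_mono) (use E' finite_subset[OF live_subset finite_E] in auto)
      ultimately have "real (card {e \<in> E'. v \<in> g e}) \<le> ?b * D" by (simp add: Y_def)
      then show ?thesis unfolding D'_def by (simp add: le_nat_floor)
    next
      case False
      then have "{e \<in> E'. v \<in> g e} = {}" by blast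
      then show ?thesis by (simp only: card.empty)
    qed
    show "real (card {e \<in> E'. u \<in> g e \<and> v \<in> g e}) \<le> \<gamma>' * D'" if "u \<noteq> v" for u v
    proof -
      have "card {e \<in> E'. u \<in> g e \<and> v \<in> g e} \<le> card {e \<in> E. u \<in> g e \<and> v \<in> g e}"
        by (rule card_mono) (use E' finite_E in auto)
      then show ?thesis using codegree[OF that] codeg unfolding D'_def by linarith
    qed
  qed
  then obtain F where F: "F \<subseteq> E'" "disjoint_family_on g F" "\<theta> * card E' \<le> real D' * card F"
    using IH by blast
  have "\<theta> * card E' \<le> ?b * D * card F"
    using F(3) D'_le by (meson mult_right_mono of_nat_0_le_iff order_trans)
  then have F3: "\<theta> / ?b * card E' \<le> D * card F"
    using b by (simp add: field_simps)
  have nonempty: "g e \<noteq> {}" if "e \<in> E" for e using card_g[OF that] K by auto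
  have disj: "isolated A \<inter> F = {}"
    using F(1) E'(2) by (auto simp: isolated_def live_def)
  have hit: "Inl e \<in> A" "A \<inter> NN (g e) = {Inl e}" "e \<in> E" if "e \<in> isolated A" for e
    using that by (auto simp: isolated_def)
  have inN: "Inl e \<in> NN (g f)" if "e \<in> E" "u \<in> g e" "u \<in> g f" for e f u
    using that by (auto simp: NN_def N_def)
  have one: "g e \<inter> g f = {}" if "e \<in> isolated A" "f \<in> isolated A \<union> F" "e \<noteq> f" for e f
  proof (rule ccontr)
    assume "g e \<inter> g f \<noteq> {}"
    then have "Inl e \<in> A \<inter> NN (g f)" using inN hit(1,3)[OF that(1)] by blast
    then show False
      using that F(1) E'(2) by (auto simp: isolated_def live_def)
  qed
  have "disjoint_family_on g (isolated A \<union> F)"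
    unfolding disjoint_family_on_def
  proof (intro ballI impI)
    fix e f assume "e \<in> isolated A \<union> F" "f \<in> isolated A \<union> F" "e \<noteq> f"
    then show "g e \<inter> g f = {}"
      using one[of e f] one[of f e] F(2) by (auto simp: disjoint_family_on_def)
  qed
  moreover have "isolated A \<union> F \<subseteq> E" using F(1) E' by (auto simp: isolated_def)
  moreover have "real (card (isolated A \<union> F)) = card (isolated A) + card F"
    using disj finE' F(1) finite_E
    by (subst card_Un_disjoint) (auto simp: isolated_def intro: finite_subset)
  then have "f A \<le> real D * card (isolated A \<union> F)"
    using F3 by (simp add: f_def E'_def algebra_simps)
  ultimately show ?thesis using A by (meson order_trans)
qed

end

definition matchable :: "('e \<Rightarrow> 'a) itself \<Rightarrow> nat \<Rightarrow> real \<Rightarrow> real \<Rightarrow> bool" where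
  "matchable _ K \<theta> \<gamma> \<longleftrightarrow> (\<forall>(E :: 'e set) (g :: 'e \<Rightarrow> 'a set) D. sparse_uniform E g K D \<gamma> \<longrightarrow>
     (\<exists>F\<subseteq>E. disjoint_family_on g F \<and> \<theta> * card E \<le> real D * card F))"

text \<open>
  One bite secures a proportion of about \<open>\<epsilon>\<close> of the optimum outright and leaves a hypergraph in which
  a proportion \<open>1 - \<epsilon>\<close> of the optimum is still available, a fraction \<open>\<theta>\<close> of which is secured by
  hypothesis.  The loss is of order \<open>\<epsilon>\<^sup>2\<close>.
\<close>
lemma matchable_improve:
  fixes K :: nat and \<epsilon> \<theta> \<gamma>' :: real
  assumes K: "2 \<le> K" and eps0: "0 < \<epsilon>" "K * \<epsilon> \<le> 1 / 2"
    and theta: "0 \<le> \<theta>" "\<theta> \<le> 1" and gamma': "0 < \<gamma>'"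
    and IH: "matchable TYPE('e \<Rightarrow> 'a) K \<theta> \<gamma>'"
  shows "\<exists>\<gamma>>0. matchable TYPE('e \<Rightarrow> 'a) K (\<theta> + \<epsilon> * (1 - \<theta>) - (K + 3) * \<epsilon>\<^sup>2) \<gamma>"
proof -
  \<comment> \<open>The slack \<open>\<eta>\<close> in the degrees costs a relative loss of order \<open>\<epsilon>\<^sup>2\<close>.  The three bounds on \<open>\<gamma>\<close> pass the codegree
    condition on to \<open>\<gamma>'\<close>, make \<open>D\<close> large, and keep the variance below \<open>\<epsilon>\<^sup>2\<close>.\<close>
  define \<eta> where "\<eta> = \<epsilon>\<^sup>2"
  define \<gamma> where "\<gamma> = min (\<gamma>' * \<eta> / 2) (min (\<eta> / 2) (\<eta>\<^sup>2 * \<epsilon>\<^sup>2 / (10 * real K ^ 3)))"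
  have eta: "0 < \<eta>" using eps0 by (simp add: \<eta>_def)
  have gam: "0 < \<gamma>" "\<gamma> \<le> \<gamma>' * \<eta> / 2" "\<gamma> \<le> \<eta> / 2" "\<gamma> \<le> \<eta>\<^sup>2 * \<epsilon>\<^sup>2 / (10 * real K ^ 3)"
    using eta gamma' eps0 K by (auto simp: \<gamma>_def)
  have "2 * \<epsilon> \<le> K * \<epsilon>" using K eps0 by simp
  then have eps1: "\<epsilon> \<le> 1" using eps0 by linarith
  let ?t = "\<theta> + \<epsilon> * (1 - \<theta>) - (K + 3) * \<epsilon>\<^sup>2"
  have "\<exists>F\<subseteq>E. disjoint_family_on g F \<and> ?t * card E \<le> real D * card F"
    if H: "sparse_uniform E g K D \<gamma>" for E :: "'e set" and g :: "'e \<Rightarrow> 'a set" and D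
  proof (cases "E = {}")
    case True
    then show ?thesis by (intro exI[of _ "{}"]) (auto simp: disjoint_family_on_def)
  next
    case False
    then obtain e where e: "e \<in> E" by blast
    then have "2 \<le> card (g e)" using H K by (simp add: sparse_uniform_def)
    then have "finite (g e)" "\<not> card (g e) \<le> Suc 0" by (auto intro: card_ge_0_finite)
    then obtain u v where uv: "u \<in> g e" "v \<in> g e" "u \<noteq> v"
      using card_le_Suc0_iff_eq by blast
    have "card {e \<in> E. u \<in> g e \<and> v \<in> g e} \<noteq> 0"
      using H e uv by (auto simp: sparse_uniform_def)
    then have "1 \<le> real (card {e \<in> E. u \<in> g e \<and> v \<in> g e})" by linarith
    also have "\<dots> \<le> \<gamma> * D" using H uv by (auto simp: sparse_uniform_def)
    finally have gD: "1 \<le> \<gamma> * D" .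
    then have D: "0 < D" by (cases D) auto
    interpret bite E g K D \<gamma> \<epsilon>
      by unfold_locales (use H K D gam eps0 eps1 in \<open>auto simp: sparse_uniform_def\<close>)
    let ?a = "\<kappa> ^ (K - 1)"
    have "1 - K * \<epsilon> \<le> (1 - \<epsilon>) ^ K" using Bernoulli_inequality[of "-\<epsilon>" K] eps1 by simp
    also have "\<dots> \<le> \<kappa> ^ K" using kappa_ge eps1 by (intro power_mono) auto
    finally have kK: "1 - K * \<epsilon> \<le> \<kappa> ^ K" .
    have kK': "\<kappa> ^ K = \<kappa> * ?a" using K by (cases K) auto
    have "\<kappa> * ?a \<le> 1 * ?a" using kappa by (intro mult_right_mono) auto
    then have a: "1 / 2 \<le> ?a" using kK eps0 kK' by linarith
    have codeg: "\<gamma> * D \<le> \<gamma>' * real (nat \<lfloor>(?a + \<eta>) * D\<rfloor>)"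
    proof -
      have "\<gamma> * D \<le> \<eta> / 2 * D" using gam(3) by (intro mult_right_mono) auto
      then have "1 \<le> \<eta> * D / 2" using gD by simp
      moreover have "\<eta> * D \<le> (?a + \<eta>) * D" using a by (intro mult_right_mono) auto
      moreover have "(?a + \<eta>) * D - 1 \<le> real (nat \<lfloor>(?a + \<eta>) * D\<rfloor>)" by linarith
      ultimately have "\<eta> * D / 2 \<le> real (nat \<lfloor>(?a + \<eta>) * D\<rfloor>)" by linarith
      then have "\<gamma>' * (\<eta> * D / 2) \<le> \<gamma>' * real (nat \<lfloor>(?a + \<eta>) * D\<rfloor>)"
        using gamma' by (intro mult_left_mono) auto
      moreover have "\<gamma> * D \<le> \<gamma>' * \<eta> / 2 * D" using gam(2) by (intro mult_right_mono) auto
      ultimately show ?thesis by (simp add: mult.assoc)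
    qed
    let ?x = "5 * real K ^ 3 * \<gamma> / \<eta>\<^sup>2"
    have IH': "\<exists>F\<subseteq>E'. disjoint_family_on g F \<and> \<theta> * card E' \<le> real D' * card F"
      if "sparse_uniform E' g K D' \<gamma>'" for E' D' using IH that unfolding matchable_def by blast
    have x: "?x \<le> \<epsilon>\<^sup>2 / 2"
    proof -
      have "\<gamma> * (10 * real K ^ 3) \<le> \<eta>\<^sup>2 * \<epsilon>\<^sup>2"
        using gam(4) K by (simp add: pos_le_divide_eq)
      then show ?thesis using eta by (simp add: divide_simps mult_ac)
    qed
    have step: "1 - \<epsilon> - 3 * \<epsilon>\<^sup>2 \<le> (\<kappa> ^ K - ?x) / (?a + \<eta>)"
    proof -
      have "(1 - \<epsilon> - 3 * \<epsilon>\<^sup>2) * (?a + \<eta>) = (1 - \<epsilon>) * ?a - 3 * \<epsilon>\<^sup>2 * ?a + (1 - (\<epsilon> + 3 * \<epsilon>\<^sup>2)) * \<epsilon>\<^sup>2"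
        by (simp add: \<eta>_def algebra_simps)
      moreover have "3 * \<epsilon>\<^sup>2 * (1 / 2) \<le> 3 * \<epsilon>\<^sup>2 * ?a" using a by (intro mult_left_mono) auto
      moreover have "(1 - (\<epsilon> + 3 * \<epsilon>\<^sup>2)) * \<epsilon>\<^sup>2 \<le> 1 * \<epsilon>\<^sup>2"
        using eps0 zero_le_power2[of \<epsilon>] by (intro mult_right_mono) linarith+
      moreover have "(1 - \<epsilon>) * ?a \<le> \<kappa> * ?a" using kappa_ge a by (intro mult_right_mono) auto
      ultimately have "(1 - \<epsilon> - 3 * \<epsilon>\<^sup>2) * (?a + \<eta>) \<le> \<kappa> ^ K - ?x"
        using x kK' by linarith
      then show ?thesis using a eta by (simp add: pos_le_divide_eq)
    qed
    have "?t \<le> \<epsilon> * \<kappa> ^ K + \<theta> * ((\<kappa> ^ K - ?x) / (?a + \<eta>))"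
    proof -
      have "\<epsilon> * (1 - K * \<epsilon>) \<le> \<epsilon> * \<kappa> ^ K" using kK eps0 by (intro mult_left_mono) auto
      moreover have "\<theta> * (1 - \<epsilon> - 3 * \<epsilon>\<^sup>2) \<le> \<theta> * ((\<kappa> ^ K - ?x) / (?a + \<eta>))"
        using step theta by (intro mult_left_mono) auto
      moreover have "\<theta> * \<epsilon>\<^sup>2 \<le> 1 * \<epsilon>\<^sup>2" using theta by (intro mult_right_mono) auto
      ultimately show ?thesis by (simp add: algebra_simps power2_eq_square)
    qed
    then have "card E * ?t \<le> card E * (\<epsilon> * \<kappa> ^ K + \<theta> * ((\<kappa> ^ K - ?x) / (?a + \<eta>)))"
      by (intro mult_left_mono) auto
    moreover obtain F where "F \<subseteq> E" "disjoint_family_on g F"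
        "card E * (\<epsilon> * \<kappa> ^ K + \<theta> * ((\<kappa> ^ K - ?x) / (?a + \<eta>))) \<le> real D * card F"
      using extend_matching[OF eta theta(1) codeg IH'] by blast
    ultimately show ?thesis by (auto simp: mult.commute[of _ "real (card E)"])
  qed
  then show ?thesis using gam(1) unfolding matchable_def by blast
qed

text \<open>
  The ratios that can be guaranteed for some positive codegree bound have a supremum.  Were it
  less than 1, a bite with a small \<open>\<epsilon>\<close> would improve on a ratio close to it.  This
  replaces an iteration of bites with explicit parameters.
\<close>
theorem near_perfect_matching:
  fixes K :: nat and \<delta> :: real
  assumes "2 \<le> K" "0 < \<delta>"
  shows "\<exists>\<gamma>>0. \<forall>(E :: 'e set) (g :: 'e \<Rightarrow> 'a set) D. sparse_uniform E g K D \<gamma> \<longrightarrow>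
     (\<exists>F\<subseteq>E. disjoint_family_on g F \<and> (1 - \<delta>) * card E \<le> real D * card F)"
proof -
  define S where "S = {\<theta>. 0 \<le> \<theta> \<and> \<theta> \<le> 1 \<and> (\<exists>\<gamma>>0. matchable TYPE('e \<Rightarrow> 'a) K \<theta> \<gamma>)}"
  have S0: "0 \<in> S"
    unfolding S_def matchable_def
    by (auto intro!: exI[of _ 1] exI[of _ "{}"] simp: disjoint_family_on_def)
  have bdd: "bdd_above S" by (rule bdd_aboveI[of _ 1]) (auto simp: S_def)
  define t where "t = Sup S"
  have t0: "0 \<le> t" unfolding t_def using S0 bdd by (rule cSup_upper)
  have "1 \<le> t"
  proof (rule ccontr)
    assume "\<not> 1 \<le> t"
    then have t: "t < 1" by simp
    define \<epsilon> where "\<epsilon> = min (1 / (2 * real K)) ((1 - t) / (2 * (real K + 3)))"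
    have eps: "0 < \<epsilon>" using t assms by (auto simp: \<epsilon>_def)
    have "\<epsilon> \<le> 1 / (2 * real K)" by (simp add: \<epsilon>_def)
    then have epsK: "K * \<epsilon> \<le> 1 / 2" using assms by (simp add: field_simps)
    have "\<epsilon> \<le> (1 - t) / (2 * (real K + 3))" by (simp add: \<epsilon>_def)
    then have "(K + 3) * \<epsilon> \<le> (1 - t) / 2" by (simp add: field_simps)
    then have "\<epsilon> * ((K + 3) * \<epsilon>) \<le> \<epsilon> * ((1 - t) / 2)" using eps by (intro mult_left_mono) auto
    then have small: "(K + 3) * \<epsilon>\<^sup>2 \<le> \<epsilon> * (1 - t) / 2" by (simp add: power2_eq_square mult_ac)
    have "t - \<epsilon> * (1 - t) / 2 < Sup S" unfolding t_def[symmetric] using eps t by simp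
    then obtain \<theta> where th: "\<theta> \<in> S" "t - \<epsilon> * (1 - t) / 2 < \<theta>"
      using less_cSup_iff[OF _ bdd] S0 by blast
    have "\<theta> \<le> t" unfolding t_def using th(1) bdd by (rule cSup_upper)
    let ?n = "\<theta> + \<epsilon> * (1 - \<theta>) - (K + 3) * \<epsilon>\<^sup>2"
    have "\<epsilon> * (1 - t) \<le> \<epsilon> * (1 - \<theta>)" using eps \<open>\<theta> \<le> t\<close> by (intro mult_left_mono) auto
    then have gt: "t < ?n" using th(2) small by linarith
    have "K * \<epsilon> \<ge> 1 * \<epsilon>" using assms eps by (intro mult_right_mono) auto
    then have "\<epsilon> * (1 - \<theta>) \<le> 1 * (1 - \<theta>)" using epsK th(1) by (intro mult_right_mono) (auto simp: S_def)
    then have "?n \<le> 1" by (smt (verit) zero_le_power2 mult_nonneg_nonneg of_nat_0_le_iff)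
    moreover have "\<exists>\<gamma>>0. matchable TYPE('e \<Rightarrow> 'a) K ?n \<gamma>"
      using th(1) matchable_improve[OF assms(1) eps epsK] by (auto simp: S_def)
    ultimately have "?n \<in> S" using gt t0 by (simp add: S_def)
    then have "?n \<le> t" unfolding t_def using bdd by (rule cSup_upper)
    then show False using gt by simp
  qed
  then have "1 - \<delta> < Sup S" using assms by (simp add: t_def)
  then obtain \<theta> \<gamma> where th: "1 - \<delta> < \<theta>" "0 < \<gamma>" "matchable TYPE('e \<Rightarrow> 'a) K \<theta> \<gamma>"
    using less_cSup_iff[of S "1 - \<delta>"] bdd S0 unfolding S_def by blast
  have "\<exists>F\<subseteq>E. disjoint_family_on g F \<and> (1 - \<delta>) * card E \<le> real D * card F"
    if "sparse_uniform E g K D \<gamma>" for E :: "'e set" and g :: "'e \<Rightarrow> 'a set" and D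
  proof -
    obtain F where F: "F \<subseteq> E" "disjoint_family_on g F" "\<theta> * card E \<le> real D * card F"
      using th(3) \<open>sparse_uniform E g K D \<gamma>\<close> unfolding matchable_def by blast
    moreover have "(1 - \<delta>) * card E \<le> \<theta> * card E" using th(1) by (intro mult_right_mono) auto
    ultimately show ?thesis by (meson order_trans)
  qed
  then show ?thesis using th(2) by blast
qed

section \<open>Near-decompositions of complete uniform hypergraphs into packings\<close>

lemma card_nsets_superset_le:
  assumes "finite X" "finite T" "card T \<le> j"
  shows "card {M \<in> nsets X j. T \<subseteq> M} \<le> (card X - card T) choose (j - card T)"
proof (cases "T \<subseteq> X")
  case True
  have "card {M \<in> nsets X j. T \<subseteq> M} \<le> card (nsets (X - T) (j - card T))"
  proof (rule card_inj_on_le[where f = "\<lambda>M. M - T"])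
    show "inj_on (\<lambda>M. M - T) {M \<in> nsets X j. T \<subseteq> M}" by (rule inj_onI) blast
    show "(\<lambda>M. M - T) ` {M \<in> nsets X j. T \<subseteq> M} \<subseteq> nsets (X - T) (j - card T)"
      using assms by (auto simp: nsets_def card_Diff_subset)
    show "finite (nsets (X - T) (j - card T))"
      using assms by (intro finite_imp_finite_nsets) auto
  qed
  also have "\<dots> = (card X - card T) choose (j - card T)"
    using assms True by (simp add: card_nsets card_Diff_subset)
  finally show ?thesis .
next
  case False
  then have "{M \<in> nsets X j. T \<subseteq> M} = {}" by (auto simp: nsets_def)
  then show ?thesis by (simp only: card.empty)
qed

text \<open>
  Enlarging the prescribed subset by one point divides the number of supersets by a factor linear in
  \<open>card X\<close>; this is what makes codegrees small compared with degrees.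
\<close>
lemma card_nsets_superset_Suc_le:
  assumes "finite X" "finite T" "card T = Suc t" "t \<le> j" "t < card X"
  shows "card {M \<in> nsets X j. T \<subseteq> M} * (card X - t) \<le> (j - t) * ((card X - t) choose (j - t))"
proof (cases "t = j")
  case True
  have "M \<notin> nsets X j" if "T \<subseteq> M" for M
  proof
    assume "M \<in> nsets X j"
    then have "card T \<le> card M" "card M = j" using that by (auto simp: nsets_def intro: card_mono)
    then show False using True assms by simp
  qed
  then have "{M \<in> nsets X j. T \<subseteq> M} = {}" by blast
  then show ?thesis by (simp only: card.empty)
next
  case False
  define a b where "a = card X - Suc t" and "b = j - Suc t"
  have ab: "card X - t = Suc a" "j - t = Suc b" using False assms by (auto simp: a_def b_def)
  have "card {M \<in> nsets X j. T \<subseteq> M} \<le> a choose b"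
    using card_nsets_superset_le[of X T j] assms False by (simp add: a_def b_def)
  then have "card {M \<in> nsets X j. T \<subseteq> M} * Suc a \<le> Suc a * (a choose b)"
    by (metis mult.commute mult_le_mono1)
  also have "\<dots> = Suc b * (Suc a choose Suc b)"
    by (simp only: Suc_times_binomial_eq mult.commute)
  finally show ?thesis unfolding ab .
qed

lemma fact_quotient_bounds:
  assumes "s < r" "r \<le> Q"
  shows "real (Q - r) \<le> fact (Q - s) / fact (Q - r)"
    and "fact (Q - s) / fact (Q - r) \<le> real Q ^ (r - s)"
proof -
  have "fact (Q - r) * real (Q - r) \<le> fact (Suc (Q - r))"
    by (simp add: algebra_simps)
  also have "\<dots> \<le> fact (Q - s)" using assms by (intro fact_mono) auto
  finally show "real (Q - r) \<le> fact (Q - s) / fact (Q - r)"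
    by (simp add: pos_le_divide_eq mult.commute)
  have d: "Q - r = (Q - s) - (r - s)" using assms by simp
  have "fact (Q - s) / fact (Q - r) = real (fact (Q - s) div fact (Q - r))"
  proof -
    have "fact (Q - r) dvd (fact (Q - s) :: nat)" using assms by (intro fact_dvd) auto
    then show ?thesis by (simp add: real_of_nat_div)
  qed
  also have "fact (Q - s) div fact (Q - r) \<le> (Q - s) ^ (r - s)"
    unfolding d by (rule fact_div_fact_le_pow) (use assms in simp)
  also have "(Q - s) ^ (r - s) \<le> Q ^ (r - s)" by (rule power_mono) auto
  finally show "fact (Q - s) / fact (Q - r) \<le> real Q ^ (r - s)" by simp
qed

text \<open>
  The edges \<open>(M, c)\<close> of a matching have no \<open>r\<close>-subset in common, and those of one colour \<open>c\<close> have no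
  \<open>s\<close>-subset in common.  An \<open>r\<close>-set lies in \<open>N\<close> times \<open>(Q - r) choose (m - r)\<close> edges, and a pair of an
  \<open>s\<close>-set and a colour lies in \<open>(Q - s) choose (m - s)\<close> of them.  The number \<open>N\<close> of colours is
  the least one for which the first number is at least the second, and then a near-perfect matching covers
  almost all \<open>r\<close>-sets.
\<close>
theorem near_decomposition_into_packings:
  fixes r s :: nat and \<delta> :: real
  assumes sr: "s < r" and delta: "0 < \<delta>"
  defines "m \<equiv> 2 * r - s - 1"
    and "c0 \<equiv> fact (r - s - 1) / fact (2 * r - 2 * s - 1) :: real"
  shows "\<exists>Q0. \<forall>Q\<ge>Q0. \<exists>(F :: (nat set \<times> nat) set) N.
    F \<subseteq> nsets {..<Q} m \<times> {..<N} \<and>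
    real N \<le> c0 * real Q ^ (r - s) + 1 \<and>
    (\<forall>M M' c. (M, c) \<in> F \<longrightarrow> (M', c) \<in> F \<longrightarrow> s \<le> card (M \<inter> M') \<longrightarrow> M = M') \<and>
    real (card {R \<in> nsets {..<Q} r. \<not> (\<exists>(M, c)\<in>F. R \<subseteq> M)}) \<le> \<delta> * real (Q choose r)"
proof -
  have m: "s < m" "r \<le> m" "m - r = r - s - 1" "m - s = 2 * r - 2 * s - 1"
    using sr by (auto simp: m_def)
  have c0: "0 < c0" by (simp add: c0_def)
  define K where "K = (m choose r) + (m choose s)"
  have "1 \<le> m choose r" "1 \<le> m choose s"
    using m by (simp_all add: Suc_le_eq zero_less_binomial)
  then have K: "2 \<le> K" by (simp add: K_def)
  obtain \<gamma> where gamma: "0 < \<gamma>" and match: "\<And>(E :: (nat set \<times> nat) set)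
      (g :: nat set \<times> nat \<Rightarrow> (nat set + nat set \<times> nat) set) D. sparse_uniform E g K D \<gamma> \<Longrightarrow>
     \<exists>F\<subseteq>E. disjoint_family_on g F \<and> (1 - \<delta>) * card E \<le> real D * card F"
    using near_perfect_matching[OF K delta] by blast
  \<comment> \<open>The summands make codegrees within the \<open>r\<close>-sets and within the \<open>s\<close>-sets small, and \<open>N\<close> at least \<open>1 / \<gamma>\<close>,
    which bounds the codegree of an \<open>r\<close>-set and a pair \<open>(S, c)\<close>.\<close>
  define Q0 where "Q0 = m + 1 + nat \<lceil>real m / \<gamma>\<rceil> + nat \<lceil>1 / (\<gamma> * c0)\<rceil>"
  show ?thesis
  proof (intro exI[of _ Q0] allI impI)
    fix Q assume Q: "Q0 \<le> Q"
    have Qm: "m < Q" using Q by (simp add: Q0_def)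
    have big: "real m \<le> \<gamma> * real (Q - m)" "1 \<le> \<gamma> * c0 * real (Q - m)"
    proof -
      have scale: "x / y \<le> z \<Longrightarrow> 0 < y \<Longrightarrow> x \<le> y * z" for x y z :: real
        by (simp add: field_simps)
      have "real m / \<gamma> \<le> real (nat \<lceil>real m / \<gamma>\<rceil>)" by linarith
      also have "\<dots> \<le> real (Q - m)" using Q by (simp add: Q0_def)
      finally show "real m \<le> \<gamma> * real (Q - m)" using gamma by (rule scale)
      have "1 / (\<gamma> * c0) \<le> real (nat \<lceil>1 / (\<gamma> * c0)\<rceil>)" by linarith
      also have "\<dots> \<le> real (Q - m)" using Q by (simp add: Q0_def)
      finally show "1 \<le> \<gamma> * c0 * real (Q - m)"
        by (rule scale) (use gamma c0 in simp)
    qed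
    define X where "X = (fact (Q - s) / fact (Q - r) :: real)"
    define N where "N = nat \<lceil>c0 * X\<rceil>"
    define D where "D = ((Q - r) choose (m - r)) * N"
    define E where "E = nsets {..<Q} m \<times> {..<N}"
    define g :: "nat set \<times> nat \<Rightarrow> (nat set + nat set \<times> nat) set" where
      "g e = Inl ` nsets (fst e) r \<union> Inr ` (nsets (fst e) s \<times> {snd e})" for e
    have X: "real (Q - r) \<le> X" "X \<le> real Q ^ (r - s)"
      unfolding X_def using fact_quotient_bounds[OF sr, of Q] m Qm by auto
    have X0: "0 \<le> X" by (simp add: X_def)
    have N_ge: "c0 * X \<le> N" unfolding N_def by linarith
    have N_le: "real N \<le> c0 * real Q ^ (r - s) + 1"
    proof -
      have "c0 * X \<le> c0 * real Q ^ (r - s)" using X c0 by (intro mult_left_mono) auto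
      moreover have "0 \<le> c0 * X" using X0 c0 by simp
      then have "real N \<le> c0 * X + 1" unfolding N_def by linarith
      ultimately show ?thesis by linarith
    qed
    have gN: "1 \<le> \<gamma> * N"
    proof -
      have "1 \<le> \<gamma> * c0 * real (Q - m)" by (rule big)
      also have "\<dots> \<le> \<gamma> * c0 * X" using X(1) m gamma c0 by (intro mult_left_mono) auto
      also have "\<dots> = \<gamma> * (c0 * X)" by simp
      also have "\<dots> \<le> \<gamma> * N" using N_ge gamma by (intro mult_left_mono) auto
      finally show ?thesis .
    qed
    then have N0: "0 < N" by (cases N) auto
    have degS: "(Q - s) choose (m - s) \<le> D"
    proof -
      have Qd: "Q - s - (m - s) = Q - m" "Q - r - (m - r) = Q - m" "m - s \<le> Q - s" "m - r \<le> Q - r"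
        using m(1,2) Qm by auto
      have "real ((Q - s) choose (m - s)) = fact (Q - s) / (fact (m - s) * fact (Q - m))"
        using binomial_fact[OF Qd(3), where 'a = real] unfolding Qd(1) .
      also have "\<dots> = fact (Q - r) / (fact (m - r) * fact (Q - m)) * (c0 * X)"
        by (simp add: X_def c0_def m)
      also have "fact (Q - r) / (fact (m - r) * fact (Q - m)) = real ((Q - r) choose (m - r))"
        using binomial_fact[OF Qd(4), where 'a = real] unfolding Qd(2) by simp
      also have "\<dots> * (c0 * X) \<le> real ((Q - r) choose (m - r)) * N"
        using N_ge by (intro mult_left_mono) auto
      finally show ?thesis unfolding D_def by (simp flip: of_nat_mult)
    qed
    have finE: "finite E" by (simp add: E_def finite_imp_finite_nsets)
    let ?W = "\<lambda>T. {M \<in> nsets {..<Q} m. T \<subseteq> M}"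
    have finW: "finite {M \<in> nsets {..<Q} m. P M}" for P by (simp add: finite_imp_finite_nsets)
    have inR: "Inl R \<in> g e \<longleftrightarrow> R \<subseteq> fst e \<and> finite R \<and> card R = r" for R e
      by (auto simp: g_def nsets_def)
    have inS: "Inr (S, c) \<in> g e \<longleftrightarrow> S \<subseteq> fst e \<and> finite S \<and> card S = s \<and> c = snd e" for S c e
      by (auto simp: g_def nsets_def)
    have WR: "card (?W R) \<le> (Q - r) choose (m - r)" if "finite R" "card R = r" for R
      using card_nsets_superset_le[of "{..<Q}" R m] that m by simp
    have WS: "card (?W S) \<le> (Q - s) choose (m - s)" if "finite S" "card S = s" for S
      using card_nsets_superset_le[of "{..<Q}" S m] that m by simp
    have WT: "real (card (?W T)) \<le> \<gamma> * real ((Q - t) choose (m - t))"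
      if T: "finite T" "Suc t \<le> card T" "t \<le> m" for T t
    proof -
      obtain T' where T': "T' \<subseteq> T" "card T' = Suc t" "finite T'"
        using obtain_subset_with_card_n[OF T(2)] by blast
      have "card (?W T) \<le> card (?W T')" using T'(1) finW by (intro card_mono) auto
      moreover have "card (?W T') * (Q - t) \<le> (m - t) * ((Q - t) choose (m - t))"
        using card_nsets_superset_Suc_le[of "{..<Q}" T' t m] T' T Qm by simp
      ultimately have "card (?W T) * (Q - t) \<le> (m - t) * ((Q - t) choose (m - t))"
        by (meson le_trans mult_le_mono1)
      then have "real (card (?W T)) * real (Q - t) \<le> real (m - t) * real ((Q - t) choose (m - t))"
        by (simp only: of_nat_le_iff flip: of_nat_mult)
      also have "real (m - t) \<le> \<gamma> * real (Q - t)"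
      proof -
        have "real (m - t) \<le> real m" by simp
        also have "\<dots> \<le> \<gamma> * real (Q - m)" by (rule big)
        also have "\<dots> \<le> \<gamma> * real (Q - t)" using gamma T(3) by (intro mult_left_mono) auto
        finally show ?thesis .
      qed
      then have "real (m - t) * real ((Q - t) choose (m - t)) \<le> \<gamma> * real (Q - t) * real ((Q - t) choose (m - t))"
        by (intro mult_right_mono) auto
      finally have "real (Q - t) * real (card (?W T)) \<le> real (Q - t) * (\<gamma> * real ((Q - t) choose (m - t)))"
        by (simp add: mult_ac)
      then show ?thesis using T(3) Qm by (subst (asm) mult_le_cancel_left_pos) auto
    qed
    have Suc_card_Un: "Suc (card A) \<le> card (A \<union> B)"
      if "finite A" "finite B" "card A = card B" "A \<noteq> B" for A B :: "nat set"
    proof -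
      have "A \<subset> A \<union> B" using that by (metis Un_upper1 card_subset_eq psubsetI sup.absorb_iff1 sup.commute)
      then have "card A < card (A \<union> B)" using that(1,2) by (intro psubset_card_mono) auto
      then show ?thesis by simp
    qed
    have sparse: "sparse_uniform E g K D \<gamma>"
      unfolding sparse_uniform_def
    proof (intro conjI ballI allI impI)
      show "finite E" by (rule finE)
    next
      fix e assume e: "e \<in> E"
      then have M: "finite (fst e)" "card (fst e) = m" by (auto simp: E_def nsets_def)
      have "card (g e) = card (Inl ` nsets (fst e) r :: (nat set + nat set \<times> nat) set)
          + card (Inr ` (nsets (fst e) s \<times> {snd e}) :: (nat set + nat set \<times> nat) set)"
        unfolding g_def using M by (intro card_Un_disjoint) (auto intro: finite_imp_finite_nsets)
      then show "card (g e) = K"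
        using M by (simp add: card_image card_nsets card_cartesian_product K_def)
    next
      fix v
      show "card {e \<in> E. v \<in> g e} \<le> D"
      proof (cases v)
        case (Inl R)
        show ?thesis
        proof (cases "finite R \<and> card R = r")
          case True
          have "card {e \<in> E. v \<in> g e} \<le> card (?W R \<times> {..<N})"
            using finW by (intro card_mono) (auto simp: Inl inR E_def)
          also have "\<dots> \<le> D"
            using WR True by (simp add: card_cartesian_product D_def)
          finally show ?thesis .
        next
          case False
          then have "{e \<in> E. v \<in> g e} = {}" by (auto simp: Inl inR)
          then show ?thesis by (simp only: card.empty)
        qed
      next
        case (Inr p)
        obtain S c where p: "p = (S, c)" by (cases p)
        show ?thesis
        proof (cases "finite S \<and> card S = s")
          case True
          have "card {e \<in> E. v \<in> g e} \<le> card (?W S \<times> {c})"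
            using finW by (intro card_mono) (auto simp: Inr p inS E_def)
          also have "\<dots> \<le> D"
            using le_trans[OF WS[of S] degS] True by (simp add: card_cartesian_product)
          finally show ?thesis .
        next
          case False
          then have "{e \<in> E. v \<in> g e} = {}" by (auto simp: Inr p inS)
          then show ?thesis by (simp only: card.empty)
        qed
      qed
    next
      have D_eq: "real D = real ((Q - r) choose (m - r)) * N" by (simp add: D_def)
      have mixed: "real (card {e \<in> E. Inl R \<in> g e \<and> Inr p \<in> g e}) \<le> \<gamma> * D" for R p
      proof (cases "finite R \<and> card R = r")
        case True
        have "card {e \<in> E. Inl R \<in> g e \<and> Inr p \<in> g e} \<le> card (?W R \<times> {snd p})"
          using finW by (intro card_mono) (cases p; auto simp: inR inS E_def)+
        also have "\<dots> \<le> (Q - r) choose (m - r)"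
          using WR True by (simp add: card_cartesian_product)
        finally have "real (card {e \<in> E. Inl R \<in> g e \<and> Inr p \<in> g e}) \<le> real ((Q - r) choose (m - r)) * 1"
          by simp
        also have "\<dots> \<le> real ((Q - r) choose (m - r)) * (\<gamma> * N)"
          using gN by (intro mult_left_mono) auto
        finally show ?thesis by (simp add: D_eq mult_ac)
      next
        case False
        then have "{e \<in> E. Inl R \<in> g e \<and> Inr p \<in> g e} = {}" by (auto simp: inR)
        then show ?thesis using gamma by (simp only: card.empty) simp
      qed
      fix u v :: "nat set + nat set \<times> nat" assume uv: "u \<noteq> v"
      consider (RR) R R' where "u = Inl R" "v = Inl R'" | (RS) R p where "u = Inl R" "v = Inr p"
        | (SR) R p where "u = Inr p" "v = Inl R" | (SS) p p' where "u = Inr p" "v = Inr p'"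
        by (cases u; cases v) auto
      then show "real (card {e \<in> E. u \<in> g e \<and> v \<in> g e}) \<le> \<gamma> * D"
      proof cases
        case RR
        show ?thesis
        proof (cases "finite R \<and> card R = r \<and> finite R' \<and> card R' = r")
          case True
          have "card {e \<in> E. u \<in> g e \<and> v \<in> g e} \<le> card (?W (R \<union> R') \<times> {..<N})"
            using finW by (intro card_mono) (auto simp: RR inR E_def)
          then have "real (card {e \<in> E. u \<in> g e \<and> v \<in> g e}) \<le> real (card (?W (R \<union> R'))) * N"
            by (simp add: card_cartesian_product flip: of_nat_mult)
          also have "\<dots> \<le> \<gamma> * real ((Q - r) choose (m - r)) * N"
            using True Suc_card_Un[of R R'] RR uv m by (intro mult_right_mono WT) auto
          finally show ?thesis by (simp add: D_eq mult_ac)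
        next
          case False
          then have "{e \<in> E. u \<in> g e \<and> v \<in> g e} = {}" by (auto simp: RR inR)
          then show ?thesis using gamma by (simp only: card.empty) simp
        qed
      next
        case RS then show ?thesis using mixed[of R p] by simp
      next
        case SR then show ?thesis using mixed[of R p]
          by (simp add: conj_commute)
      next
        case SS
        obtain S c S' c' where p: "p = (S, c)" "p' = (S', c')" by (cases p; cases p')
        show ?thesis
        proof (cases "finite S \<and> card S = s \<and> finite S' \<and> card S' = s \<and> c = c'")
          case True
          have "card {e \<in> E. u \<in> g e \<and> v \<in> g e} \<le> card (?W (S \<union> S') \<times> {c})"
            using finW by (intro card_mono) (auto simp: SS p inS E_def)
          then have "real (card {e \<in> E. u \<in> g e \<and> v \<in> g e}) \<le> real (card (?W (S \<union> S')))"
            by (simp add: card_cartesian_product)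
          also have "\<dots> \<le> \<gamma> * real ((Q - s) choose (m - s))"
            using True Suc_card_Un[of S S'] SS p uv m by (intro WT) auto
          also have "\<dots> \<le> \<gamma> * D" using degS gamma by (intro mult_left_mono) auto
          finally show ?thesis .
        next
          case False
          then have "{e \<in> E. u \<in> g e \<and> v \<in> g e} = {}" by (auto simp: SS p inS)
          then show ?thesis using gamma by (simp only: card.empty) simp
        qed
      qed
    qed
    obtain F where F: "F \<subseteq> E" "disjoint_family_on g F" "(1 - \<delta>) * card E \<le> real D * card F"
      using match[OF sparse] by blast
    have finF: "finite F" using F(1) finE finite_subset by blast
    have packing: "M = M'" if h: "(M, c) \<in> F" "(M', c) \<in> F" "s \<le> card (M \<inter> M')" for M M' c
    proof (rule ccontr)
      assume "M \<noteq> M'"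
      obtain S where "S \<subseteq> M \<inter> M'" "card S = s" "finite S"
        using obtain_subset_with_card_n[OF h(3)] by blast
      then have "Inr (S, c) \<in> g (M, c) \<inter> g (M', c)" by (auto simp: inS)
      moreover have "g (M, c) \<inter> g (M', c) = {}"
        using disjoint_family_onD[OF F(2) h(1,2)] \<open>M \<noteq> M'\<close> by simp
      ultimately show False by simp
    qed
    let ?cov = "\<Union>e\<in>F. nsets (fst e) r"
    have cov: "card ?cov = card F * (m choose r)"
    proof -
      have "card ?cov = (\<Sum>e\<in>F. card (nsets (fst e) r))"
      proof (rule card_UN_disjoint[OF finF])
        show "\<forall>e\<in>F. finite (nsets (fst e) r)"
          using F(1) by (auto simp: E_def nsets_def intro!: finite_imp_finite_nsets[unfolded nsets_def])
        show "\<forall>e\<in>F. \<forall>f\<in>F. e \<noteq> f \<longrightarrow> nsets (fst e) r \<inter> nsets (fst f) r = {}"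
        proof (intro ballI impI)
          fix e f assume "e \<in> F" "f \<in> F" "e \<noteq> f"
          then have "g e \<inter> g f = {}" using F(2) by (auto simp: disjoint_family_on_def)
          then show "nsets (fst e) r \<inter> nsets (fst f) r = {}" by (auto simp: g_def)
        qed
      qed
      also have "\<dots> = (\<Sum>e\<in>F. m choose r)"
        using F(1) by (intro sum.cong) (auto simp: E_def card_nsets nsets_def[of "{..<Q}"])
      finally show ?thesis by simp
    qed
    have "(1 - \<delta>) * real (Q choose r) \<le> card ?cov"
    proof -
      let ?b = "real ((Q - r) choose (m - r))"
      have b0: "0 < ?b" using m Qm by simp
      have "real (Q choose m) * real (m choose r) = real (Q choose r) * ?b"
        using choose_mult[of r m Q] m Qm by (simp flip: of_nat_mult)
      then have "(1 - \<delta>) * real (Q choose r) * ?b * N = (1 - \<delta>) * card E * real (m choose r)"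
        by (simp add: E_def card_cartesian_product card_nsets mult_ac)
      also have "\<dots> \<le> real D * card F * real (m choose r)"
        using F(3) by (intro mult_right_mono) auto
      also have "\<dots> = real (card ?cov) * ?b * N"
        unfolding cov by (simp add: D_def mult_ac)
      finally have "(?b * N) * ((1 - \<delta>) * real (Q choose r)) \<le> (?b * N) * card ?cov"
        by (simp only: mult_ac)
      then show ?thesis using b0 N0 by (subst (asm) mult_le_cancel_left_pos) auto
    qed
    moreover have "{R \<in> nsets {..<Q} r. \<not> (\<exists>(M, c)\<in>F. R \<subseteq> M)} = nsets {..<Q} r - ?cov"
      by (fastforce simp: nsets_def)
    moreover have "?cov \<subseteq> nsets {..<Q} r"
    proof -
      have "fst e \<subseteq> {..<Q}" if "e \<in> F" for e
        using subsetD[OF F(1) that] by (auto simp: E_def nsets_def)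
      then show ?thesis unfolding nsets_def by blast
    qed
    moreover from this have "finite ?cov"
      by (rule finite_subset) (simp add: finite_imp_finite_nsets)
    with calculation have "card (nsets {..<Q} r - ?cov) = card (nsets {..<Q} r) - card ?cov"
      by (intro card_Diff_subset)
    moreover from calculation have "card ?cov \<le> card (nsets {..<Q} r)"
      by (intro card_mono) (auto simp: finite_imp_finite_nsets)
    ultimately have "real (card {R \<in> nsets {..<Q} r. \<not> (\<exists>(M, c)\<in>F. R \<subseteq> M)}) \<le> \<delta> * real (Q choose r)"
      by (simp add: algebra_simps card_nsets of_nat_diff)
    then show "\<exists>(F :: (nat set \<times> nat) set) N.
      F \<subseteq> nsets {..<Q} m \<times> {..<N} \<and> real N \<le> c0 * real Q ^ (r - s) + 1 \<and>
      (\<forall>M M' c. (M, c) \<in> F \<longrightarrow> (M', c) \<in> F \<longrightarrow> s \<le> card (M \<inter> M') \<longrightarrow> M = M') \<and>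
      real (card {R \<in> nsets {..<Q} r. \<not> (\<exists>(M, c)\<in>F. R \<subseteq> M)}) \<le> \<delta> * real (Q choose r)"
    proof (intro exI[of _ F] exI[of _ N] conjI allI impI)
      show "F \<subseteq> nsets {..<Q} m \<times> {..<N}" using F(1) by (simp only: E_def)
      show "real N \<le> c0 * real Q ^ (r - s) + 1" by (rule N_le)
      show "M = M'" if "(M, c) \<in> F" "(M', c) \<in> F" "s \<le> card (M \<inter> M')" for M M' c
        by (rule packing[OF that])
    qed
  qed
qed

section \<open>Interpolation modulo an integer without small factors\<close>

lemma poly_map_mod_cong:
  fixes P :: "int poly"
  shows "[poly (map_poly (\<lambda>c. c mod p) P) x = poly P x] (mod p)"
  by (induction P) (auto simp: map_poly_pCons intro!: cong_add cong_mult)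

text \<open>
  Newton interpolation: a new node is accommodated by a multiple of the product of the linear
  factors at the old nodes, whose value at the new node is a unit modulo \<open>p\<close>.
\<close>
lemma interpolation_mod:
  fixes X :: "int set" and p :: int
  assumes "finite X" "0 < p" "\<And>x y. x \<in> X \<Longrightarrow> y \<in> X \<Longrightarrow> x \<noteq> y \<Longrightarrow> coprime (x - y) p"
  shows "\<exists>P. (\<forall>i\<ge>card X. coeff P i = 0) \<and> (\<forall>i. coeff P i \<in> {0..<p}) \<and>
    (\<forall>x\<in>X. [poly P x = y x] (mod p))"
proof -
  have "\<exists>P. (\<forall>i\<ge>card X. coeff P i = 0) \<and> (\<forall>x\<in>X. [poly P x = y x] (mod p))"
    using assms(1,3)
  proof (induction X rule: finite_induct)
    case empty
    show ?case by (rule exI[of _ 0]) simp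
  next
    case (insert x0 X)
    obtain P where P: "\<forall>i\<ge>card X. coeff P i = 0" "\<forall>x\<in>X. [poly P x = y x] (mod p)"
      using insert.IH insert.prems by auto
    define L where "L = (\<Prod>x\<in>X. [:- x, 1:])"
    have L: "poly L z = (\<Prod>x\<in>X. z - x)" for z by (simp add: L_def poly_prod)
    have "coprime (poly L x0) p"
      unfolding L using insert by (intro prod_coprime_left) auto
    then obtain u where u: "[poly L x0 * u = 1] (mod p)"
      using cong_solve_coprime_int by blast
    define c where "c = (y x0 - poly P x0) * u"
    have "degree L \<le> (\<Sum>x\<in>X. 1)"
      unfolding L_def by (rule order_trans[OF degree_prod_sum_le]) (use insert in auto)
    then have "coeff (P + smult c L) i = 0" if "card (insert x0 X) \<le> i" for i
      using that P(1) insert by (simp add: coeff_eq_0)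
    moreover have "[poly (P + smult c L) x = y x] (mod p)" if "x \<in> insert x0 X" for x
    proof (cases "x = x0")
      case True
      have "[poly P x0 + (y x0 - poly P x0) * (poly L x0 * u)
          = poly P x0 + (y x0 - poly P x0) * 1] (mod p)"
        by (intro cong_add cong_mult u) auto
      then show ?thesis using True by (simp add: c_def mult_ac)
    next
      case False
      then have "x \<in> X" using that by simp
      then have "poly L x = 0" unfolding L using insert(1) by (auto intro: prod_zero)
      then show ?thesis using P(2) \<open>x \<in> X\<close> by simp
    qed
    ultimately show ?case by blast
  qed
  then obtain P where P: "\<forall>i\<ge>card X. coeff P i = 0" "\<forall>x\<in>X. [poly P x = y x] (mod p)"
    by blast
  show ?thesis
    by (rule exI[of _ "map_poly (\<lambda>c. c mod p) P"])
       (use P assms(2) in \<open>auto simp: coeff_map_poly intro: cong_trans[OF poly_map_mod_cong]\<close>)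
qed

text \<open>
  Split off the linear factor of one root.  The differences of roots are units modulo \<open>p\<close>, so that the
  cofactor vanishes at the remaining roots, although \<open>p\<close> may be composite.
\<close>
lemma poly_cong_0_of_roots:
  fixes X :: "int set" and p :: int and P :: "int poly"
  assumes "finite X" "\<And>x y. x \<in> X \<Longrightarrow> y \<in> X \<Longrightarrow> x \<noteq> y \<Longrightarrow> coprime (x - y) p"
    and "\<And>i. card X \<le> i \<Longrightarrow> coeff P i = 0"
    and "\<And>x. x \<in> X \<Longrightarrow> [poly P x = 0] (mod p)"
  shows "[poly P z = 0] (mod p)"
  using assms
proof (induction X arbitrary: P z rule: finite_induct)
  case empty
  then have "P = 0" by (intro poly_eqI) simp
  then show ?case by simp
next
  case (insert x0 X)
  define G where "G = synthetic_div P x0"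
  have P: "poly P x = (x - x0) * poly G x + poly P x0" for x
    using arg_cong[OF synthetic_div_correct'[of x0 P], of "\<lambda>q. poly q x"]
    by (simp add: G_def algebra_simps)
  have degP: "degree P \<le> card X"
    by (rule degree_le) (use insert.prems(2) insert.hyps in auto)
  have "[poly G x = 0] (mod p)" for x
  proof (rule insert.IH)
    show "coprime (x - y) p" if "x \<in> X" "y \<in> X" "x \<noteq> y" for x y using that insert.prems(1) by simp
    show "coeff G i = 0" if "card X \<le> i" for i
    proof (cases "degree P = 0")
      case True
      then have "G = 0" unfolding G_def using synthetic_div_eq_0_iff by blast
      then show ?thesis by simp
    next
      case False
      then have "degree G < i" using that degP by (simp add: G_def degree_synthetic_div)
      then show ?thesis by (rule coeff_eq_0)
    qed
    show "[poly G x = 0] (mod p)" if "x \<in> X" for x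
    proof -
      have "[poly P x - poly P x0 = 0 - 0] (mod p)"
        using insert.prems(3) that by (intro cong_diff) auto
      then have "p dvd (x - x0) * poly G x" using P[of x] by (simp add: cong_0_iff)
      moreover have "coprime p (x - x0)"
        using insert.prems(1)[of x x0] insert.hyps that by (auto simp: coprime_commute)
      ultimately show ?thesis by (simp add: coprime_dvd_mult_right_iff cong_0_iff)
    qed
  qed
  moreover have "[poly P x0 = 0] (mod p)" by (rule insert.prems(3)) simp
  ultimately show ?case by (subst P) (simp add: cong_0_iff)
qed

lemma poly_cong_of_agreement:
  fixes X :: "int set" and p :: int and P P' :: "int poly"
  assumes "finite X" "\<And>x y. x \<in> X \<Longrightarrow> y \<in> X \<Longrightarrow> x \<noteq> y \<Longrightarrow> coprime (x - y) p"
    and "\<And>i. card X \<le> i \<Longrightarrow> coeff P i = coeff P' i"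
    and "\<And>x. x \<in> X \<Longrightarrow> [poly P x = poly P' x] (mod p)"
  shows "[poly P z = poly P' z] (mod p)"
proof -
  have "[poly (P - P') z = 0] (mod p)"
    by (rule poly_cong_0_of_roots[OF assms(1,2)])
       (use assms(3,4) in \<open>auto simp: cong_iff_dvd_diff\<close>)
  then show ?thesis by (simp add: cong_iff_dvd_diff)
qed

section \<open>Averaging over permutations\<close>

lemma ex_equidistributed_map:
  assumes "finite A" "finite B" "B \<noteq> {}"
  shows "\<exists>f. f \<in> A \<rightarrow> B \<and> (\<forall>b\<in>B. card {a \<in> A. f a = b} * card B \<le> card A + card B)"
proof -
  obtain e where e: "bij_betw e A {0..<card A}" using ex_bij_betw_finite_nat[OF assms(1)] by blast
  obtain h where h: "bij_betw h {0..<card B} B" using ex_bij_betw_nat_finite[OF assms(2)] by blast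
  define z where "z = card B"
  have z: "0 < z" using assms by (simp add: z_def card_gt_0_iff)
  define f where "f a = h (e a mod z)" for a
  have "card {a \<in> A. f a = b} * z \<le> card A + z" if "b \<in> B" for b
  proof -
    have "inj_on (\<lambda>a. e a div z) {a \<in> A. f a = b}"
    proof (rule inj_onI)
      fix a a' assume a: "a \<in> {a \<in> A. f a = b}" "a' \<in> {a \<in> A. f a = b}" and d: "e a div z = e a' div z"
      have "h (e a mod z) = h (e a' mod z)" using a by (simp add: f_def)
      then have "e a mod z = e a' mod z"
        using z by (intro inj_onD[OF bij_betw_imp_inj_on[OF h]]) (auto simp: z_def)
      then have "e a = e a'" using d by (metis div_mult_mod_eq)
      then show "a = a'" using a by (intro inj_onD[OF bij_betw_imp_inj_on[OF e]]) auto
    qed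
    moreover have "(\<lambda>a. e a div z) ` {a \<in> A. f a = b} \<subseteq> {..card A div z}"
    proof (rule image_subsetI)
      fix a assume "a \<in> {a \<in> A. f a = b}"
      then have "e a < card A" using bij_betwE[OF e] by auto
      then show "e a div z \<in> {..card A div z}" by (simp add: div_le_mono)
    qed
    ultimately have "card {a \<in> A. f a = b} \<le> card {..card A div z}"
      by (intro card_inj_on_le) auto
    then have "card {a \<in> A. f a = b} * z \<le> (card A div z + 1) * z" by (intro mult_le_mono1) simp
    also have "\<dots> \<le> card A + z" by (simp add: algebra_simps)
    finally show ?thesis .
  qed
  moreover have "f \<in> A \<rightarrow> B"
    unfolding f_def using z bij_betwE[OF h] by (auto simp: z_def)
  ultimately show ?thesis unfolding z_def by blast
qed

lemma ex_permutes_image: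
  assumes "finite X" "R \<subseteq> X" "R' \<subseteq> X" "card R = card R'"
  shows "\<exists>\<tau>. \<tau> permutes X \<and> \<tau> ` R = R'"
proof -
  have fin: "finite R" "finite R'" using assms finite_subset by auto
  obtain f where f: "bij_betw f R R'"
    using finite_same_card_bij[OF fin assms(4)] by blast
  have "card (X - R) = card (X - R')" using assms fin by (simp add: card_Diff_subset)
  then obtain h where h: "bij_betw h (X - R) (X - R')"
    using finite_same_card_bij[of "X - R" "X - R'"] assms(1) by blast
  define \<tau> where "\<tau> x = (if x \<in> R then f x else if x \<in> X then h x else x)" for x
  have 1: "bij_betw \<tau> R R'" using f by (rule bij_betw_cong[THEN iffD1, rotated]) (simp add: \<tau>_def)
  have 2: "bij_betw \<tau> (X - R) (X - R')"
    using h by (rule bij_betw_cong[THEN iffD1, rotated]) (simp add: \<tau>_def)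
  have "bij_betw \<tau> (R \<union> (X - R)) (R' \<union> (X - R'))"
    by (rule bij_betw_combine[OF 1 2]) auto
  moreover have "R \<union> (X - R) = X" "R' \<union> (X - R') = X" using assms by auto
  ultimately have "\<tau> permutes X" using assms(2) by (intro bij_imp_permutes) (auto simp: \<tau>_def)
  then show ?thesis using bij_betw_imp_surj_on[OF 1] by blast
qed

text \<open>
  Double counting: the number of permutations that move \<open>R\<close> into \<open>U\<close> is the same for all \<open>r\<close>-sets \<open>R\<close>, since
  permutations act transitively on them.
\<close>
lemma card_permutations_into_family:
  assumes "finite X" "U \<subseteq> nsets X r" "R \<in> nsets X r"
  shows "card {\<pi>. \<pi> permutes X \<and> \<pi> ` R \<in> U} * (card X choose r) \<le> fact (card X) * card U"
proof -
  let ?P = "{\<pi>. \<pi> permutes X}"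
  let ?u = "\<lambda>R. card {\<pi> \<in> ?P. \<pi> ` R \<in> U}"
  have finP: "finite ?P" by (rule finite_permutations[OF assms(1)])
  have finN: "finite (nsets X r)" by (rule finite_imp_finite_nsets[OF assms(1)])
  have le: "?u R \<le> ?u R'" if R': "R' \<in> nsets X r" for R'
  proof -
    obtain \<tau> where \<tau>: "\<tau> permutes X" "\<tau> ` R' = R"
      using ex_permutes_image[OF assms(1), of R' R] R' assms(3) by (auto simp: nsets_def)
    show ?thesis
    proof (rule card_inj_on_le[where f = "\<lambda>\<pi>. \<pi> \<circ> \<tau>"])
      show "inj_on (\<lambda>\<pi>. \<pi> \<circ> \<tau>) {\<pi> \<in> ?P. \<pi> ` R \<in> U}"
      proof (rule inj_onI)
        fix \<pi> \<pi>' :: "'a \<Rightarrow> 'a" assume "\<pi> \<circ> \<tau> = \<pi>' \<circ> \<tau>"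
        then have "\<pi> (\<tau> (inv \<tau> x)) = \<pi>' (\<tau> (inv \<tau> x))" for x by (metis comp_apply)
        then show "\<pi> = \<pi>'" using permutes_inverses(1)[OF \<tau>(1)] by auto
      qed
      show "(\<lambda>\<pi>. \<pi> \<circ> \<tau>) ` {\<pi> \<in> ?P. \<pi> ` R \<in> U} \<subseteq> {\<pi> \<in> ?P. \<pi> ` R' \<in> U}"
        using \<tau> by (auto simp: image_comp intro: permutes_compose)
      show "finite {\<pi> \<in> ?P. \<pi> ` R' \<in> U}" using finP by simp
    qed
  qed
  have "?u R * card (nsets X r) = (\<Sum>R'\<in>nsets X r. ?u R)" by simp
  also have "\<dots> \<le> (\<Sum>R'\<in>nsets X r. ?u R')" by (intro sum_mono le)
  also have "\<dots> = (\<Sum>\<pi>\<in>?P. card {R' \<in> nsets X r. \<pi> ` R' \<in> U})"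
    by (rule sum_multicount_gen[OF finN finP]) simp
  also have "\<dots> \<le> (\<Sum>\<pi>\<in>?P. card U)"
  proof (rule sum_mono)
    fix \<pi> assume "\<pi> \<in> ?P"
    then have "inj \<pi>" by (auto dest: permutes_inj)
    then have "inj_on (\<lambda>R'. \<pi> ` R') {R' \<in> nsets X r. \<pi> ` R' \<in> U}"
      by (auto simp: inj_on_def inj_image_eq_iff)
    then show "card {R' \<in> nsets X r. \<pi> ` R' \<in> U} \<le> card U"
      by (rule card_inj_on_le) (use assms(2) finN finite_subset in auto)
  qed
  also have "\<dots> = fact (card X) * card U"
    using card_permutations[OF refl assms(1)] by simp
  finally show ?thesis using assms(1) by (simp add: card_nsets)
qed

section \<open>Lifting packings by polynomial codes\<close>

text \<open>
  Each point \<open>x\<close> has a label \<open>lam x\<close> and a value \<open>v x\<close>.  The family \<open>F\<close> of coloured blocks lives on the labels.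
  A vector \<open>a\<close> of top coefficients selects a permutation \<open>\<sigma> a\<close> of the labels, and every permutation is
  selected about equally often.
\<close>
locale transversal_code =
  fixes V :: "'v set" and lam v :: "'v \<Rightarrow> nat" and r s m Q p N :: nat
    and F :: "(nat set \<times> nat) set" and \<delta> :: real and \<sigma> :: "(nat \<Rightarrow> int) \<Rightarrow> nat \<Rightarrow> nat"
  assumes finite_V: "finite V"
    and lam: "x \<in> V \<Longrightarrow> lam x < Q" and v: "x \<in> V \<Longrightarrow> v x < p"
    and inj_lam_v: "x \<in> V \<Longrightarrow> y \<in> V \<Longrightarrow> lam x = lam y \<Longrightarrow> v x = v y \<Longrightarrow> x = y"
    and sr: "s < r" and m: "m = 2 * r - s - 1"
    and coprime_p: "0 < d \<Longrightarrow> d < Q \<Longrightarrow> coprime d p" and p: "0 < p"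
    and F: "F \<subseteq> nsets {..<Q} m \<times> {..<N}"
    and packing: "(M, c) \<in> F \<Longrightarrow> (M', c) \<in> F \<Longrightarrow> s \<le> card (M \<inter> M') \<Longrightarrow> M = M'"
    and uncovered: "real (card {R \<in> nsets {..<Q} r. \<not> (\<exists>(M, c)\<in>F. R \<subseteq> M)}) \<le> \<delta> * real (Q choose r)"
    and rQ: "r \<le> Q"
    and perm: "a \<in> ({s..<r} \<rightarrow>\<^sub>E {0..<int p}) \<Longrightarrow> \<sigma> a permutes {..<Q}"
    and equidistributed: "\<pi> permutes {..<Q} \<Longrightarrow>
      card {a \<in> {s..<r} \<rightarrow>\<^sub>E {0..<int p}. \<sigma> a = \<pi>} * fact Q \<le> p ^ (r - s) + fact Q"
begin

text \<open>
  \<open>coset R\<close> is an index for the coset of \<open>word R\<close> modulo the code of polynomials of degree less than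
  \<open>s\<close>.  Since the coefficients of \<open>word R\<close> are reduced to \<open>{0..<p}\<close>, congruent top coefficients are
  equal.
\<close>
definition "A = ({s..<r} \<rightarrow>\<^sub>E {0..<int p})"
definition "T = {R \<in> nsets V r. inj_on lam R}"

definition interpolates :: "'v set \<Rightarrow> int poly \<Rightarrow> bool" where
  "interpolates R P \<longleftrightarrow> (\<forall>i\<ge>r. coeff P i = 0) \<and> (\<forall>i. coeff P i \<in> {0..<int p}) \<and>
     (\<forall>x\<in>R. [poly P (int (lam x)) = int (v x)] (mod int p))"

definition "word R = (SOME P. interpolates R P)"
definition "coset R = restrict (coeff (word R)) {s..<r}"
definition "block R = (SOME e. e \<in> F \<and> \<sigma> (coset R) ` lam ` R \<subseteq> fst e)"
definition "C = {R \<in> T. \<exists>(M, c)\<in>F. \<sigma> (coset R) ` lam ` R \<subseteq> M}"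
definition "col R = (snd (block R), coset R)"

lemma coprime_labels:
  assumes "S \<subseteq> V" "x \<in> (\<lambda>x. int (lam x)) ` S" "y \<in> (\<lambda>x. int (lam x)) ` S" "x \<noteq> y"
  shows "coprime (x - y) (int p)"
proof -
  obtain a b where ab: "a \<in> V" "b \<in> V" "x = int (lam a)" "y = int (lam b)" using assms by auto
  have *: "coprime (int i - int j) (int p)" if "i < j" "j < Q" for i j
  proof -
    have "coprime (int (j - i)) (int p)"
      using coprime_p[of "j - i"] that unfolding coprime_int_iff by simp
    moreover have "int i - int j = - int (j - i)" using that by simp
    ultimately show ?thesis by (simp only: coprime_minus_left_iff)
  qed
  have "coprime (int i - int j) (int p) \<longleftrightarrow> coprime (int j - int i) (int p)" for i j
    by (metis coprime_minus_left_iff minus_diff_eq)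
  then show ?thesis
    using *[of "lam a" "lam b"] *[of "lam b" "lam a"] ab lam assms(4) by (metis linorder_neqE_nat)
qed

lemma T_D: assumes "R \<in> T" shows "R \<subseteq> V" "finite R" "card R = r" "inj_on lam R"
  using assms by (auto simp: T_def nsets_def)

lemma word: assumes "R \<in> T" shows "interpolates R (word R)"
proof -
  let ?l = "\<lambda>x. int (lam x)"
  have inj: "inj_on ?l R" using T_D(4)[OF assms] by (auto simp: inj_on_def)
  define y where "y z = int (v (the_inv_into R ?l z))" for z
  have "\<exists>P. (\<forall>i\<ge>card (?l ` R). coeff P i = 0) \<and> (\<forall>i. coeff P i \<in> {0..<int p}) \<and>
      (\<forall>x\<in>?l ` R. [poly P x = y x] (mod int p))"
    by (rule interpolation_mod) (use T_D[OF assms] p coprime_labels[of R] in auto)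
  moreover have "y (?l x) = int (v x)" if "x \<in> R" for x
    unfolding y_def by (simp only: the_inv_into_f_f[OF inj that])
  moreover have "card (?l ` R) = r" using inj T_D(3)[OF assms] by (simp add: card_image)
  ultimately have "\<exists>P. interpolates R P" by (simp add: interpolates_def)
  then show ?thesis unfolding word_def by (rule someI_ex)
qed

lemma coset_in_A: "R \<in> T \<Longrightarrow> coset R \<in> A"
  using word[of R] by (auto simp: coset_def A_def interpolates_def)

lemma finite_A: "finite A"
  by (auto simp: A_def intro: finite_PiE)

text \<open>
  The difference of the polynomials has degree less than \<open>s\<close> and vanishes at the \<open>s\<close> labels of \<open>S\<close>.
\<close>
lemma words_agree:
  assumes "R \<in> T" "R' \<in> T" "S \<subseteq> R" "S \<subseteq> R'" "card S = s" "coset R = coset R'"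
  shows "[poly (word R) z = poly (word R') z] (mod int p)"
proof (rule poly_cong_of_agreement)
  let ?X = "(\<lambda>x. int (lam x)) ` S"
  have SV: "S \<subseteq> V" "inj_on lam S"
    using assms T_D(1,4)[OF assms(1)] by (auto intro: inj_on_subset)
  have card: "card ?X = s"
    using SV(2) assms(5) by (subst card_image) (auto simp: inj_on_def)
  show "finite ?X" using SV finite_V finite_subset by blast
  show "coprime (x - y) (int p)" if "x \<in> ?X" "y \<in> ?X" "x \<noteq> y" for x y
    using coprime_labels[OF SV(1) that] .
  show "coeff (word R) i = coeff (word R') i" if "card ?X \<le> i" for i
  proof (cases "i < r")
    case True
    then have "i \<in> {s..<r}" using that card by simp
    then show ?thesis using fun_cong[OF assms(6), of i] by (simp add: coset_def)
  next
    case False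
    then show ?thesis using word[OF assms(1)] word[OF assms(2)] by (simp add: interpolates_def)
  qed
  show "[poly (word R) x = poly (word R') x] (mod int p)" if xX: "x \<in> ?X" for x
  proof -
    obtain a where a: "a \<in> S" "x = int (lam a)" using xX by blast
    have "[poly (word R) x = int (v a)] (mod int p)" "[poly (word R') x = int (v a)] (mod int p)"
      using a word[OF assms(1)] word[OF assms(2)] assms(3,4) by (auto simp: interpolates_def)
    then show ?thesis using cong_sym cong_trans by blast
  qed
qed

lemma determined:
  assumes "x \<in> V" "y \<in> V" "lam x = lam y" "[z = int (v x)] (mod int p)" "[z = int (v y)] (mod int p)"
  shows "x = y"
proof -
  have "[int (v x) = int (v y)] (mod int p)" using assms(4,5) cong_sym cong_trans by blast
  then have "[v x = v y] (mod p)" by (simp add: cong_int_iff)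
  then have "v x = v y" using v assms(1,2) by (intro cong_less_modulus_unique_nat)
  then show ?thesis using inj_lam_v assms by blast
qed

lemma C_subset: "C \<subseteq> T" by (auto simp: C_def)

lemma block: assumes "R \<in> C" shows "block R \<in> F" "\<sigma> (coset R) ` lam ` R \<subseteq> fst (block R)"
proof -
  have "\<exists>e. e \<in> F \<and> \<sigma> (coset R) ` lam ` R \<subseteq> fst e" using assms by (force simp: C_def)
  from someI_ex[OF this] show "block R \<in> F" "\<sigma> (coset R) ` lam ` R \<subseteq> fst (block R)"
    by (simp_all add: block_def)
qed

lemma col_range: "col \<in> C \<rightarrow> {..<N} \<times> A"
  using block(1) F coset_in_A C_subset by (fastforce simp: col_def)

text \<open>
  The points that lie on the polynomial of \<open>R\<close> over the block of \<open>R\<close>: the \<open>m\<close>-set that contains \<open>R\<close> in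
  the lifted packing, some of whose elements may be missing from \<open>V\<close>.
\<close>
definition "points R = {x \<in> V. \<sigma> (coset R) (lam x) \<in> fst (block R) \<and>
   [poly (word R) (int (lam x)) = int (v x)] (mod int p)}"

lemma card_points: assumes "R \<in> C" shows "finite (points R)" "card (points R) \<le> m"
proof -
  have M: "finite (fst (block R))" "card (fst (block R)) = m"
    using subsetD[OF F block(1)[OF assms]] by (auto simp: nsets_def)
  have inj: "inj (\<sigma> (coset R))"
    using perm[of "coset R"] coset_in_A C_subset assms by (auto simp: A_def dest: permutes_inj)
  show "finite (points R)" using finite_V by (simp add: points_def)
  have "inj_on (\<lambda>x. \<sigma> (coset R) (lam x)) (points R)"
    by (rule inj_onI) (auto simp: points_def dest!: injD[OF inj] intro: determined)
  then have "card (points R) \<le> card (fst (block R))"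
    by (rule card_inj_on_le) (auto simp: points_def M)
  then show "card (points R) \<le> m" using M by simp
qed

text \<open>
  Equal colours at a common \<open>s\<close>-set force first the same block, by the packing property of \<open>F\<close>, and
  then the same polynomial.  So the lifted blocks form packings.
\<close>
lemma same_colour:
  assumes R: "R \<in> C" "R' \<in> C" and S: "S \<subseteq> R" "S \<subseteq> R'" "card S = s" and col: "col R = col R'"
  shows "R' \<subseteq> points R"
proof
  fix x assume x: "x \<in> R'"
  have T: "R \<in> T" "R' \<in> T" using R C_subset by auto
  have coset: "coset R = coset R'" and c: "snd (block R) = snd (block R')" using col by (auto simp: col_def)
  let ?S = "\<sigma> (coset R) ` lam ` S"
  have "inj_on lam S" using T_D(4)[OF T(1)] S(1) by (rule inj_on_subset)
  moreover have "inj (\<sigma> (coset R))"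
    using perm[of "coset R"] coset_in_A[OF T(1)] by (auto simp: A_def dest: permutes_inj)
  ultimately have "card ?S = s" using S(3) by (simp add: card_image inj_on_subset)
  moreover have "?S \<subseteq> fst (block R) \<inter> fst (block R')"
    using block(2)[OF R(1)] block(2)[OF R(2)] S coset by (auto simp: image_subset_iff)
  moreover have "finite (fst (block R))"
    using subsetD[OF F block(1)[OF R(1)]] by (auto simp: nsets_def)
  ultimately have "s \<le> card (fst (block R) \<inter> fst (block R'))" by (metis card_mono finite_Int)
  then have "fst (block R) = fst (block R')"
    using packing[of "fst (block R)" "snd (block R)" "fst (block R')"] block(1) R c
    by (metis prod.collapse)
  moreover have "\<sigma> (coset R') (lam x) \<in> fst (block R')" using block(2)[OF R(2)] x by auto
  moreover have "[poly (word R) (int (lam x)) = int (v x)] (mod int p)"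
    using words_agree[OF T S coset, of "int (lam x)"] word[OF T(2)] x
    by (auto simp: interpolates_def intro: cong_trans)
  ultimately show "x \<in> points R" using T_D(1)[OF T(2)] x coset by (auto simp: points_def)
qed

text \<open>
  The union lies in at most \<open>m = 2 * r - s - 1\<close> points, so the intersection has more than \<open>s\<close> of them.
\<close>
lemma proper:
  assumes R: "R \<in> C" "R' \<in> C" "col R = col R'"
  shows "card (R \<inter> R') \<noteq> s"
proof
  assume s: "card (R \<inter> R') = s"
  have T: "R \<in> T" "R' \<in> T" using R C_subset by auto
  have "R \<subseteq> points R" "R' \<subseteq> points R"
    using same_colour[OF R(1,1), of "R \<inter> R'"] same_colour[OF R(1,2), of "R \<inter> R'"] R(3) s by auto
  then have "card (R \<union> R') \<le> m"
    using card_points[OF R(1)] by (meson Un_least card_mono le_trans)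
  moreover have "card (R \<union> R') + card (R \<inter> R') = r + r"
    using card_Un_Int[of R R'] T_D[OF T(1)] T_D[OF T(2)] by simp
  ultimately show False using s m sr by simp
qed

text \<open>
  All \<open>r\<close>-sets in question lie in one lifted block, which has at most \<open>2 ^ m\<close> subsets.
\<close>
lemma multiplicity:
  assumes "card S = s"
  shows "card {R \<in> C. S \<subseteq> R \<and> col R = x} \<le> 2 ^ m"
proof (cases "{R \<in> C. S \<subseteq> R \<and> col R = x} = {}")
  case False
  then obtain R0 where R0: "R0 \<in> C" "S \<subseteq> R0" "col R0 = x" by blast
  have "{R \<in> C. S \<subseteq> R \<and> col R = x} \<subseteq> Pow (points R0)"
  proof
    fix R assume "R \<in> {R \<in> C. S \<subseteq> R \<and> col R = x}"
    then show "R \<in> Pow (points R0)" using same_colour[OF R0(1) _ R0(2) _ assms, of R] R0(3) by simp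
  qed
  then have "card {R \<in> C. S \<subseteq> R \<and> col R = x} \<le> card (Pow (points R0))"
    using card_points(1)[OF R0(1)] by (intro card_mono) auto
  also have "\<dots> \<le> 2 ^ m" using card_points[OF R0(1)] by (simp add: card_Pow)
  finally show ?thesis .
qed (simp only: card.empty)

text \<open>
  For fixed \<open>S\<close> a transversal \<open>r\<close>-set is determined by its labels \<open>R'\<close> and its top coefficients \<open>a\<close>.  It is
  uncoloured only if \<open>\<sigma> a\<close> moves \<open>R'\<close> to an uncovered set of labels.  As \<open>a\<close> varies, \<open>\<sigma> a\<close> runs almost uniformly through
  all permutations, and so this happens for at most about a proportion \<open>\<delta>\<close> of all \<open>a\<close>, whatever \<open>R'\<close> is.
\<close>
lemma uncoloured:
  assumes S: "S \<subseteq> V" "card S = s"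
  shows "real (card {R \<in> T. S \<subseteq> R \<and> R \<notin> C}) \<le> \<delta> * real Q ^ (r - s) * (real p ^ (r - s) + fact Q)"
proof -
  define U where "U = {R \<in> nsets {..<Q} r. \<not> (\<exists>(M, c)\<in>F. R \<subseteq> M)}"
  let ?B = "{R' \<in> nsets {..<Q} r. lam ` S \<subseteq> R'}"
  let ?L = "{R \<in> T. S \<subseteq> R \<and> R \<notin> C}"
  have finS: "finite S" using S finite_V finite_subset by blast
  have finB: "finite ?B" by (simp add: finite_imp_finite_nsets)
  have image: "lam ` R \<in> nsets {..<Q} r" if "R \<in> T" for R
    using T_D[OF that] lam by (auto simp: nsets_def card_image)
  show ?thesis
  proof (cases "?L = {}")
    case True
    have "0 \<le> \<delta> * real (Q choose r)" using uncovered of_nat_0_le_iff order_trans by blast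
    moreover have "0 < real (Q choose r)" using rQ by simp
    ultimately have "0 \<le> \<delta>" by (simp add: zero_le_mult_iff)
    then show ?thesis by (simp only: True card.empty) simp
  next
    case False
    then obtain R1 where "R1 \<in> T" "S \<subseteq> R1" by blast
    then have injS: "inj_on lam S" using T_D(4) inj_on_subset by blast
    have "card ?L \<le> card (SIGMA R' : ?B. {a \<in> A. \<sigma> a ` R' \<in> U})"
    proof (rule card_inj_on_le[where f = "\<lambda>R. (lam ` R, coset R)"])
      show "inj_on (\<lambda>R. (lam ` R, coset R)) ?L"
      proof (rule inj_onI)
        have sub: "R' \<subseteq> R" if "R \<in> ?L" "R' \<in> ?L" "lam ` R = lam ` R'" "coset R = coset R'" for R R'
        proof
          fix x assume x: "x \<in> R'"
          have T: "R \<in> T" "R' \<in> T" using that by auto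
          have "lam x \<in> lam ` R" using x that(3) by simp
          then obtain y where y: "y \<in> R" "lam y = lam x" by (metis imageE)
          have "[poly (word R) (int (lam x)) = int (v x)] (mod int p)"
            using words_agree[OF T, of S "int (lam x)"] that S(2) word[OF T(2)] x
            by (auto simp: interpolates_def intro: cong_trans)
          moreover have "[poly (word R) (int (lam x)) = int (v y)] (mod int p)"
            using word[OF T(1)] y by (auto simp: interpolates_def)
          ultimately have "x = y"
            using determined y T_D(1)[OF T(1)] T_D(1)[OF T(2)] x by (metis subsetD)
          then show "x \<in> R" using y by simp
        qed
        fix R R' assume "R \<in> ?L" "R' \<in> ?L" "(lam ` R, coset R) = (lam ` R', coset R')"
        then show "R = R'" using sub[of R R'] sub[of R' R] by auto
      qed
      show "(\<lambda>R. (lam ` R, coset R)) ` ?L \<subseteq> (SIGMA R' : ?B. {a \<in> A. \<sigma> a ` R' \<in> U})"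
      proof (rule image_subsetI)
        fix R assume R: "R \<in> ?L"
        then have T: "R \<in> T" by simp
        have pi: "\<sigma> (coset R) permutes {..<Q}" using perm coset_in_A[OF T] by (simp add: A_def)
        have "\<sigma> (coset R) ` lam ` R \<in> nsets {..<Q} r"
          using image[OF T] permutes_image[OF pi] permutes_inj[OF pi]
          by (auto simp: nsets_def card_image inj_on_subset)
        then show "(lam ` R, coset R) \<in> (SIGMA R' : ?B. {a \<in> A. \<sigma> a ` R' \<in> U})"
          using R image[OF T] coset_in_A[OF T] by (auto simp: C_def U_def)
      qed
      show "finite (SIGMA R' : ?B. {a \<in> A. \<sigma> a ` R' \<in> U})" using finB finite_A by auto
    qed
    also have "\<dots> = (\<Sum>R'\<in>?B. card {a \<in> A. \<sigma> a ` R' \<in> U})"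
      using finB finite_A by (simp add: card_SigmaI)
    finally have "real (card ?L) \<le> (\<Sum>R'\<in>?B. real (card {a \<in> A. \<sigma> a ` R' \<in> U}))"
      unfolding of_nat_sum[symmetric] of_nat_le_iff .
    also have "\<dots> \<le> (\<Sum>R'\<in>?B. \<delta> * (real p ^ (r - s) + fact Q))"
    proof (rule sum_mono)
      fix R' assume R': "R' \<in> ?B"
      let ?P = "{\<pi>. \<pi> permutes {..<Q} \<and> \<pi> ` R' \<in> U}"
      have finP: "finite ?P" using finite_permutations[of "{..<Q}"] by simp
      have "card {a \<in> A. \<sigma> a ` R' \<in> U} \<le> card (\<Union>\<pi>\<in>?P. {a \<in> A. \<sigma> a = \<pi>})"
        using finP finite_A perm by (intro card_mono) (auto simp: A_def)
      also have "\<dots> \<le> (\<Sum>\<pi>\<in>?P. card {a \<in> A. \<sigma> a = \<pi>})" by (rule card_UN_le[OF finP])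
      finally have "card {a \<in> A. \<sigma> a ` R' \<in> U} * fact Q \<le> (\<Sum>\<pi>\<in>?P. card {a \<in> A. \<sigma> a = \<pi>}) * fact Q"
        by (rule mult_le_mono1)
      also have "\<dots> = (\<Sum>\<pi>\<in>?P. card {a \<in> A. \<sigma> a = \<pi>} * fact Q)" by (rule sum_distrib_right)
      also have "\<dots> \<le> (\<Sum>\<pi>\<in>?P. p ^ (r - s) + fact Q)"
        using equidistributed by (intro sum_mono) (auto simp: A_def)
      also have "\<dots> = card ?P * (p ^ (r - s) + fact Q)" by simp
      finally have 1: "card {a \<in> A. \<sigma> a ` R' \<in> U} * fact Q \<le> card ?P * (p ^ (r - s) + fact Q)" .
      have "real (card ?P) * real (Q choose r) \<le> fact Q * real (card U)"
      proof -
        have "card ?P * (card {..<Q} choose r) \<le> fact (card {..<Q}) * card U"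
          by (rule card_permutations_into_family) (use R' in \<open>auto simp: U_def\<close>)
        from of_nat_mono[OF this, where 'a = real] show ?thesis
          by (simp only: of_nat_mult of_nat_fact card_lessThan)
      qed
      also have "\<dots> \<le> fact Q * (\<delta> * real (Q choose r))" using uncovered unfolding U_def by (intro mult_left_mono) auto
      finally have "real (card ?P) * real (Q choose r) \<le> (fact Q * \<delta>) * real (Q choose r)"
        by (simp only: mult.assoc)
      then have 2: "real (card ?P) \<le> fact Q * \<delta>"
        by (rule mult_right_le_imp_le) (use rQ in simp)
      have "real (card {a \<in> A. \<sigma> a ` R' \<in> U}) * fact Q \<le> real (card ?P) * (real p ^ (r - s) + fact Q)"
        using of_nat_mono[OF 1, where 'a = real]
        by (simp only: of_nat_mult of_nat_fact of_nat_add of_nat_power)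
      also have "\<dots> \<le> fact Q * \<delta> * (real p ^ (r - s) + fact Q)"
        using 2 by (intro mult_right_mono) auto
      finally have "real (card {a \<in> A. \<sigma> a ` R' \<in> U}) * fact Q \<le> (\<delta> * (real p ^ (r - s) + fact Q)) * fact Q"
        by (simp only: mult_ac)
      then show "real (card {a \<in> A. \<sigma> a ` R' \<in> U}) \<le> \<delta> * (real p ^ (r - s) + fact Q)"
        by (rule mult_right_le_imp_le) simp
    qed
    also have "\<dots> = real (card ?B) * (\<delta> * (real p ^ (r - s) + fact Q))" by simp
    also have "\<dots> \<le> real Q ^ (r - s) * (\<delta> * (real p ^ (r - s) + fact Q))"
    proof (rule mult_right_mono)
      have "card (lam ` S) = s" using injS S(2) by (simp add: card_image)
      then have "card ?B \<le> (Q - s) choose (r - s)"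
        using card_nsets_superset_le[of "{..<Q}" "lam ` S" r] finS sr by simp
      also have "\<dots> \<le> (Q - s) ^ (r - s)" using rQ sr by (intro binomial_le_pow) simp
      also have "\<dots> \<le> Q ^ (r - s)" by (rule power_mono) auto
      finally show "real (card ?B) \<le> real Q ^ (r - s)" by (simp flip: of_nat_power)
      have "0 \<le> \<delta> * real (Q choose r)" using uncovered of_nat_0_le_iff order_trans by blast
      moreover have "0 < real (Q choose r)" using rQ by simp
      ultimately have "0 \<le> \<delta>" by (simp add: zero_le_mult_iff)
      then show "0 \<le> \<delta> * (real p ^ (r - s) + fact Q)" by simp
    qed
    finally show ?thesis by (simp only: mult_ac)
  qed
qed

end

section \<open>Random permutations of colours\<close>

text \<open>
  There are at most \<open>d ^ card T\<close> restrictions to \<open>T\<close>, and permutations with the same restriction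
  differ by a permutation of the complement of \<open>T\<close>.
\<close>
lemma card_permutations_in_relation_on:
  assumes "finite X" "T \<subseteq> X" and \<Gamma>: "\<And>x. x \<in> T \<Longrightarrow> finite (\<Gamma> x) \<and> card (\<Gamma> x) \<le> d"
  shows "card {\<beta>. \<beta> permutes X \<and> (\<forall>x\<in>T. \<beta> x \<in> \<Gamma> x)} \<le> d ^ card T * fact (card X - card T)"
proof -
  let ?S = "{\<beta>. \<beta> permutes X \<and> (\<forall>x\<in>T. \<beta> x \<in> \<Gamma> x)}"
  let ?fib = "\<lambda>f. {\<beta> \<in> ?S. restrict \<beta> T = f}"
  have finT: "finite T" using assms finite_subset by blast
  have finS: "finite ?S" using finite_permutations[OF assms(1)] by simp
  have fin: "finite (Pi\<^sub>E T \<Gamma>)" using \<Gamma> by (intro finite_PiE finT) auto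
  have fibre: "card (?fib f) \<le> fact (card X - card T)" for f
  proof (cases "?fib f = {}")
    case False
    then obtain \<beta>0 where b0: "\<beta>0 permutes X" "restrict \<beta>0 T = f" by blast
    have "card (?fib f) \<le> card {\<pi>. \<pi> permutes (X - T)}"
    proof (rule card_inj_on_le[where f = "\<lambda>\<beta>. inv \<beta>0 \<circ> \<beta>"])
      show "inj_on (\<lambda>\<beta>. inv \<beta>0 \<circ> \<beta>) (?fib f)"
      proof (rule inj_onI)
        fix \<beta> \<beta>' :: "'a \<Rightarrow> 'a" assume "inv \<beta>0 \<circ> \<beta> = inv \<beta>0 \<circ> \<beta>'"
        then have "\<beta>0 (inv \<beta>0 (\<beta> x)) = \<beta>0 (inv \<beta>0 (\<beta>' x))" for x by (metis comp_apply)
        then show "\<beta> = \<beta>'" using permutes_inverses(1)[OF b0(1)] by auto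
      qed
      show "(\<lambda>\<beta>. inv \<beta>0 \<circ> \<beta>) ` ?fib f \<subseteq> {\<pi>. \<pi> permutes (X - T)}"
      proof (rule image_subsetI)
        fix \<beta> assume \<beta>: "\<beta> \<in> ?fib f"
        have "(inv \<beta>0 \<circ> \<beta>) permutes X"
          using \<beta> by (intro permutes_compose permutes_inv b0(1)) auto
        moreover have "(inv \<beta>0 \<circ> \<beta>) x = x" if "x \<in> T" for x
        proof -
          have "restrict \<beta> T x = restrict \<beta>0 T x" using \<beta> b0 by simp
          then show ?thesis using that permutes_inverses(2)[OF b0(1)] by simp
        qed
        ultimately show "inv \<beta>0 \<circ> \<beta> \<in> {\<pi>. \<pi> permutes (X - T)}"
          by (auto intro: permutes_superset)
      qed
      show "finite {\<pi>. \<pi> permutes (X - T)}" using assms by (intro finite_permutations) auto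
    qed
    also have "\<dots> = fact (card X - card T)"
      using assms finT by (intro card_permutations) (auto simp: card_Diff_subset)
    finally show ?thesis .
  qed (simp only: card.empty)
  have "card ?S \<le> card (\<Union>f\<in>Pi\<^sub>E T \<Gamma>. ?fib f)"
  proof (rule card_mono)
    show "finite (\<Union>f\<in>Pi\<^sub>E T \<Gamma>. ?fib f)" by (rule finite_subset[OF _ finS]) blast
  qed auto
  also have "\<dots> \<le> (\<Sum>f\<in>Pi\<^sub>E T \<Gamma>. card (?fib f))" by (rule card_UN_le[OF fin])
  also have "\<dots> \<le> (\<Sum>f\<in>Pi\<^sub>E T \<Gamma>. fact (card X - card T))" by (intro sum_mono fibre)
  also have "\<dots> = (\<Prod>x\<in>T. card (\<Gamma> x)) * fact (card X - card T)"
    using finT by (simp add: card_PiE)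
  also have "\<dots> \<le> d ^ card T * fact (card X - card T)"
    using \<Gamma> prod_mono[of T "\<lambda>x. card (\<Gamma> x)" "\<lambda>_. d"] by (intro mult_le_mono1) simp
  finally show ?thesis .
qed

text \<open>
  For a given \<open>j\<close>, the proportion of permutations for which some \<open>t\<close> points land in their sets
  \<open>\<Gamma> j x\<close> is at most \<open>d ^ t / fact t\<close>, by a union bound over the \<open>t\<close>-subsets of \<open>X\<close>.  A second union bound over
  \<open>J\<close> leaves a permutation that is good for all \<open>j\<close>.
\<close>
lemma ex_permutation_avoiding_relations:
  assumes "finite X" "finite J"
    and \<Gamma>: "\<And>j x. j \<in> J \<Longrightarrow> x \<in> X \<Longrightarrow> finite (\<Gamma> j x) \<and> card (\<Gamma> j x) \<le> d"
    and small: "card J * d ^ t < fact t"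
  shows "\<exists>\<beta>. \<beta> permutes X \<and> (\<forall>j\<in>J. card {x \<in> X. \<beta> x \<in> \<Gamma> j x} < t)"
proof -
  let ?P = "{\<beta>. \<beta> permutes X}"
  define bad where "bad j = {\<beta> \<in> ?P. t \<le> card {x \<in> X. \<beta> x \<in> \<Gamma> j x}}" for j
  have finP: "finite ?P" by (rule finite_permutations[OF assms(1)])
  have bad: "card (bad j) * fact t \<le> fact (card X) * d ^ t" if j: "j \<in> J" for j
  proof -
    let ?S = "\<lambda>T. {\<beta>. \<beta> permutes X \<and> (\<forall>x\<in>T. \<beta> x \<in> \<Gamma> j x)}"
    have finN: "finite (nsets X t)" by (rule finite_imp_finite_nsets[OF assms(1)])
    have "bad j \<subseteq> (\<Union>T\<in>nsets X t. ?S T)"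
    proof
      fix \<beta> assume \<beta>: "\<beta> \<in> bad j"
      then have "t \<le> card {x \<in> X. \<beta> x \<in> \<Gamma> j x}" by (simp add: bad_def)
      then obtain T where "T \<subseteq> {x \<in> X. \<beta> x \<in> \<Gamma> j x}" "card T = t" "finite T"
        by (rule obtain_subset_with_card_n)
      then show "\<beta> \<in> (\<Union>T\<in>nsets X t. ?S T)" using \<beta> by (auto simp: bad_def nsets_def)
    qed
    moreover have "finite (\<Union>T\<in>nsets X t. ?S T)" by (rule finite_subset[OF _ finP]) blast
    ultimately have "card (bad j) \<le> card (\<Union>T\<in>nsets X t. ?S T)" by (intro card_mono)
    also have "\<dots> \<le> (\<Sum>T\<in>nsets X t. card (?S T))" by (rule card_UN_le[OF finN])
    also have "\<dots> \<le> (\<Sum>T\<in>nsets X t. d ^ t * fact (card X - t))"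
    proof (rule sum_mono)
      fix T assume "T \<in> nsets X t"
      then show "card (?S T) \<le> d ^ t * fact (card X - t)"
        using card_permutations_in_relation_on[OF assms(1), of T "\<Gamma> j" d] \<Gamma>[OF j]
        by (auto simp: nsets_def)
    qed
    also have "\<dots> = (card X choose t) * (d ^ t * fact (card X - t))"
      using assms(1) by (simp add: card_nsets)
    finally have "card (bad j) * fact t \<le> (card X choose t) * (d ^ t * fact (card X - t)) * fact t"
      by (rule mult_le_mono1)
    also have "\<dots> \<le> fact (card X) * d ^ t"
    proof (cases "t \<le> card X")
      case True
      have "fact t * fact (card X - t) * (card X choose t) = (fact (card X) :: nat)"
        by (rule binomial_fact_lemma[OF True])
      then have "fact (card X) * d ^ t = fact t * fact (card X - t) * (card X choose t) * d ^ t"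
        by (simp only:)
      then show ?thesis by (simp only: mult_ac)
    qed (simp add: binomial_eq_0)
    finally show ?thesis .
  qed
  have "card (\<Union>j\<in>J. bad j) * fact t \<le> (\<Sum>j\<in>J. card (bad j)) * fact t"
    using card_UN_le[OF assms(2)] by (rule mult_le_mono1)
  also have "\<dots> = (\<Sum>j\<in>J. card (bad j) * fact t)" by (rule sum_distrib_right)
  also have "\<dots> \<le> (\<Sum>j\<in>J. fact (card X) * d ^ t)" by (intro sum_mono bad)
  also have "\<dots> = fact (card X) * (card J * d ^ t)" by simp
  also have "\<dots> < fact (card X) * fact t" using small by (intro mult_strict_left_mono) auto
  finally have "card (\<Union>j\<in>J. bad j) < card ?P"
    using card_permutations[OF refl assms(1)] by simp
  moreover have "finite (\<Union>j\<in>J. bad j)" by (rule finite_subset[OF _ finP]) (auto simp: bad_def)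
  ultimately have "\<not> ?P \<subseteq> (\<Union>j\<in>J. bad j)" using card_mono leD by blast
  then show ?thesis by (auto simp: bad_def not_le)
qed

text \<open>
  By the exponential series, \<open>(4 * D) ^ t / fact t \<le> exp (4 * D)\<close>.  With \<open>t = 8 * D\<close> this leaves room
  for a factor exponential in \<open>D\<close>.
\<close>
lemma power_less_fact:
  fixes J D :: nat
  assumes "0 < D" "J \<le> 2 ^ D"
  shows "J * D ^ (8 * D) < fact (8 * D)"
proof -
  let ?t = "8 * D"
  have "(4 * real D) ^ ?t / fact ?t \<le> exp (4 * real D)"
  proof -
    have "(\<Sum>n\<in>{?t}. (4 * real D) ^ n /\<^sub>R fact n) \<le> (\<Sum>n. (4 * real D) ^ n /\<^sub>R fact n)"
      by (intro sum_le_suminf summable_exp_generic) auto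
    then show ?thesis by (simp add: exp_def divide_inverse mult.commute)
  qed
  also have "exp (4 * real D) = (exp 1 ^ 4) ^ D"
    by (simp add: exp_of_nat_mult[symmetric] mult.commute flip: power_mult)
  also have "\<dots> \<le> (3 ^ 4) ^ D" using exp_le by (intro power_mono) auto
  finally have 1: "(4 * real D) ^ ?t \<le> 81 ^ D * fact ?t" by (simp add: divide_le_eq)
  have "(4 * real D) ^ ?t = 65536 ^ D * real D ^ ?t"
  proof -
    have "(4 :: real) ^ ?t = (4 ^ 8) ^ D" by (rule power_mult)
    then show ?thesis unfolding power_mult_distrib by simp
  qed
  then have "65536 ^ D * (J * real D ^ ?t) = J * (4 * real D) ^ ?t"
    by (simp only: mult.left_commute)
  also have "\<dots> \<le> 2 ^ D * (81 ^ D * fact ?t)"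
  proof (rule mult_mono[OF _ 1])
    show "real J \<le> 2 ^ D" using of_nat_mono[OF assms(2), where 'a = real] by simp
  qed auto
  also have "\<dots> = 162 ^ D * fact ?t"
    unfolding mult.assoc[symmetric] power_mult_distrib[symmetric] by simp
  also have "\<dots> < 65536 ^ D * fact ?t"
    using assms(1) by (intro mult_strict_right_mono power_strict_mono) auto
  finally have "J * real D ^ ?t < fact ?t" by simp
  then have "real (J * D ^ ?t) < real (fact ?t)" by simp
  then show ?thesis by (simp only: of_nat_less_iff)
qed

text \<open>
  Here \<open>mem j\<close> describes the vertices that belong to a test set \<open>j\<close>.  A colour \<open>x\<close> is dangerous
  for \<open>j\<close> if it is moved to the colour of a neighbour of one of the at most \<open>b\<close> vertices of colour \<open>x\<close> in
  \<open>j\<close>.  There are at most \<open>b * d\<close> such neighbours.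
\<close>
lemma ex_recolouring_with_few_conflicts:
  assumes fin: "finite X" "finite J" "finite V1" "finite V2"
    and c: "c1 \<in> V1 \<rightarrow> X"
    and mult: "\<And>j x. j \<in> J \<Longrightarrow> card {v \<in> V1. mem j v \<and> c1 v = x} \<le> b"
    and deg: "\<And>v. v \<in> V1 \<Longrightarrow> card {w \<in> V2. adj v w} \<le> d"
    and small: "card J * (b * d) ^ t < fact t"
  shows "\<exists>\<beta>. \<beta> permutes X \<and>
    (\<forall>j\<in>J. card {v \<in> V1. mem j v \<and> (\<exists>w\<in>V2. adj v w \<and> \<beta> (c1 v) = c2 w)} \<le> b * t)"
proof -
  define \<Gamma> where "\<Gamma> j x = (\<Union>v\<in>{v \<in> V1. mem j v \<and> c1 v = x}. c2 ` {w \<in> V2. adj v w})" for j x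
  have "finite (\<Gamma> j x) \<and> card (\<Gamma> j x) \<le> b * d" if j: "j \<in> J" for j x
  proof
    let ?W = "{v \<in> V1. mem j v \<and> c1 v = x}"
    show "finite (\<Gamma> j x)" using fin by (simp add: \<Gamma>_def)
    have "card (\<Gamma> j x) \<le> (\<Sum>v\<in>?W. card (c2 ` {w \<in> V2. adj v w}))"
      unfolding \<Gamma>_def by (rule card_UN_le) (use fin in simp)
    also have "\<dots> \<le> (\<Sum>v\<in>?W. d)"
      using fin deg by (intro sum_mono order_trans[OF card_image_le]) auto
    also have "\<dots> \<le> b * d" using mult[OF j] by simp
    finally show "card (\<Gamma> j x) \<le> b * d" .
  qed
  then obtain \<beta> where \<beta>: "\<beta> permutes X" "\<And>j. j \<in> J \<Longrightarrow> card {x \<in> X. \<beta> x \<in> \<Gamma> j x} < t"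
    using ex_permutation_avoiding_relations[OF fin(1,2) _ small, of \<Gamma>] by blast
  have "card {v \<in> V1. mem j v \<and> (\<exists>w\<in>V2. adj v w \<and> \<beta> (c1 v) = c2 w)} \<le> b * t" if j: "j \<in> J" for j
  proof -
    let ?Y = "{x \<in> X. \<beta> x \<in> \<Gamma> j x}"
    have "{v \<in> V1. mem j v \<and> (\<exists>w\<in>V2. adj v w \<and> \<beta> (c1 v) = c2 w)}
        \<subseteq> (\<Union>x\<in>?Y. {v \<in> V1. mem j v \<and> c1 v = x})"
    proof
      fix v assume "v \<in> {v \<in> V1. mem j v \<and> (\<exists>w\<in>V2. adj v w \<and> \<beta> (c1 v) = c2 w)}"
      then obtain w where v: "v \<in> V1" "mem j v" and w: "w \<in> V2" "adj v w" "\<beta> (c1 v) = c2 w"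
        by blast
      then have "\<beta> (c1 v) \<in> \<Gamma> j (c1 v)" unfolding \<Gamma>_def by blast
      then show "v \<in> (\<Union>x\<in>?Y. {v \<in> V1. mem j v \<and> c1 v = x})" using v c by blast
    qed
    then have "card {v \<in> V1. mem j v \<and> (\<exists>w\<in>V2. adj v w \<and> \<beta> (c1 v) = c2 w)}
        \<le> card (\<Union>x\<in>?Y. {v \<in> V1. mem j v \<and> c1 v = x})"
      using fin by (intro card_mono) auto
    also have "\<dots> \<le> (\<Sum>x\<in>?Y. card {v \<in> V1. mem j v \<and> c1 v = x})"
      by (rule card_UN_le) (use fin in simp)
    also have "\<dots> \<le> (\<Sum>x\<in>?Y. b)" by (intro sum_mono mult[OF j])
    also have "\<dots> \<le> t * b" using \<beta>(2)[OF j] by simp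
    finally show ?thesis by (simp add: mult.commute)
  qed
  then show ?thesis using \<beta>(1) by blast
qed

lemma greedy_colouring:
  assumes "finite V" and deg: "\<And>v. v \<in> V \<Longrightarrow> card {w \<in> V. adj v w} \<le> \<Delta>"
    and sym: "\<And>v w. adj v w \<Longrightarrow> adj w v" and irrefl: "\<And>v. v \<in> V \<Longrightarrow> \<not> adj v v"
  shows "\<exists>c. c \<in> V \<rightarrow> {..\<Delta>} \<and> (\<forall>v\<in>V. \<forall>w\<in>V. adj v w \<longrightarrow> c v \<noteq> (c w :: nat))"
proof -
  have "\<exists>c :: 'a \<Rightarrow> nat. c \<in> W \<rightarrow> {..\<Delta>} \<and> (\<forall>v\<in>W. \<forall>w\<in>W. adj v w \<longrightarrow> c v \<noteq> c w)" if "W \<subseteq> V" for W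
  proof -
    have "finite W" using that assms(1) finite_subset by blast
    then show ?thesis using that
    proof (induction W rule: finite_induct)
      case (insert x W)
      then obtain c where c: "c \<in> W \<rightarrow> {..\<Delta>}" "\<forall>v\<in>W. \<forall>w\<in>W. adj v w \<longrightarrow> c v \<noteq> c w" by auto
      have "card (c ` {w \<in> W. adj x w}) \<le> card {w \<in> W. adj x w}"
        using insert by (intro card_image_le) simp
      also have "\<dots> \<le> card {w \<in> V. adj x w}" using insert assms(1) by (intro card_mono) auto
      also have "\<dots> < card {..\<Delta>}" using deg[of x] insert by (simp add: less_Suc_eq_le)
      finally have "\<not> {..\<Delta>} \<subseteq> c ` {w \<in> W. adj x w}"
        using card_mono[of "c ` {w \<in> W. adj x w}" "{..\<Delta>}"] insert(1) by auto
      then obtain k where k: "k \<le> \<Delta>" "k \<notin> c ` {w \<in> W. adj x w}" by auto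
      have "\<not> adj x x" using irrefl insert by auto
      have nb: "c u \<noteq> k" if "u \<in> W" "adj x u" for u using k that by blast
      show ?case
      proof (intro exI[of _ "c(x := k)"] conjI ballI impI)
        show "c(x := k) \<in> insert x W \<rightarrow> {..\<Delta>}" using c(1) k(1) by auto
        fix v w assume vw: "v \<in> insert x W" "w \<in> insert x W" "adj v w"
        then consider "v = x" "w = x" | "v = x" "w \<noteq> x" "w \<in> W" | "v \<noteq> x" "v \<in> W" "w = x"
          | "v \<noteq> x" "w \<noteq> x" "v \<in> W" "w \<in> W" by blast
        then show "(c(x := k)) v \<noteq> (c(x := k)) w"
        proof cases
          case 1 then show ?thesis using vw \<open>\<not> adj x x\<close> by simp
        next
          case 2 then show ?thesis using vw nb[of w] by auto
        next
          case 3 then show ?thesis using sym[OF vw(3)] nb[of v] by auto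
        next
          case 4 then show ?thesis using c(2) vw by auto
        qed
      qed
    qed simp
  qed
  then show ?thesis by blast
qed

section \<open>Merging partial colourings\<close>

lemma card_neighbours_le:
  assumes "finite R" "card R = r" "finite \<F>"
    and "\<And>S. S \<subseteq> R \<Longrightarrow> card S = s \<Longrightarrow> card {R' \<in> \<F>. S \<subseteq> R'} \<le> w"
  shows "card {R' \<in> \<F>. card (R \<inter> R') = s} \<le> (r choose s) * w"
proof -
  have "card {R' \<in> \<F>. card (R \<inter> R') = s} \<le> card (\<Union>S\<in>nsets R s. {R' \<in> \<F>. S \<subseteq> R'})"
  proof (rule card_mono)
    show "finite (\<Union>S\<in>nsets R s. {R' \<in> \<F>. S \<subseteq> R'})"
      by (rule finite_subset[OF _ assms(3)]) blast
    show "{R' \<in> \<F>. card (R \<inter> R') = s} \<subseteq> (\<Union>S\<in>nsets R s. {R' \<in> \<F>. S \<subseteq> R'})"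
    proof
      fix R' assume "R' \<in> {R' \<in> \<F>. card (R \<inter> R') = s}"
      moreover from this have "R \<inter> R' \<in> nsets R s" using assms(1) by (simp add: nsets_def)
      ultimately show "R' \<in> (\<Union>S\<in>nsets R s. {R' \<in> \<F>. S \<subseteq> R'})" by blast
    qed
  qed
  also have "\<dots> \<le> (\<Sum>S\<in>nsets R s. card {R' \<in> \<F>. S \<subseteq> R'})"
    by (rule card_UN_le) (rule finite_imp_finite_nsets[OF assms(1)])
  also have "\<dots> \<le> (\<Sum>S\<in>nsets R s. w)"
    by (intro sum_mono assms(4)) (auto simp: nsets_def)
  also have "\<dots> = (r choose s) * w" using assms by (simp add: card_nsets)
  finally show ?thesis .
qed

text \<open>
  The index \<open>i\<close> stands for a labelling, \<open>tr i R\<close> says that it separates the points of \<open>R\<close>, and \<open>C i\<close> with \<open>col i\<close>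
  is the partial colouring that it provides.  In the induction the newest labelling takes
  precedence.  At an \<open>s\<close>-set \<open>S\<close> with \<open>tr i S\<close> all losses are charged to labelling \<open>i\<close>: the \<open>r\<close>-sets left uncoloured by
  \<open>col i\<close> (\<open>u\<close>), those that are not transversal (\<open>w\<close>), and those in conflict (\<open>b * t\<close>).  At an
  \<open>s\<close>-set without \<open>tr i S\<close> nothing changes, because no superset of it is transversal for
  \<open>i\<close>.  This is why the bound does not depend on the number of labellings.
\<close>
lemma merge_partial_colourings:
  fixes V :: "'v set" and tr :: "'i \<Rightarrow> 'v set \<Rightarrow> bool" and X :: "'c set" and u :: real
  assumes fin: "finite V" "finite X" "finite \<Lambda>"
    and C: "\<And>i. i \<in> \<Lambda> \<Longrightarrow> C i \<subseteq> {R \<in> nsets V r. tr i R}"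
    and col: "\<And>i. i \<in> \<Lambda> \<Longrightarrow> col i \<in> C i \<rightarrow> X"
    and proper: "\<And>i R R'. i \<in> \<Lambda> \<Longrightarrow> R \<in> C i \<Longrightarrow> R' \<in> C i \<Longrightarrow> col i R = col i R' \<Longrightarrow> card (R \<inter> R') \<noteq> s"
    and mult: "\<And>i S x. i \<in> \<Lambda> \<Longrightarrow> S \<in> nsets V s \<Longrightarrow> card {R \<in> C i. S \<subseteq> R \<and> col i R = x} \<le> b"
    and uncol: "\<And>i S. i \<in> \<Lambda> \<Longrightarrow> S \<in> nsets V s \<Longrightarrow> tr i S \<Longrightarrow>
      real (card {R \<in> nsets V r. tr i R \<and> S \<subseteq> R \<and> R \<notin> C i}) \<le> u"
    and ntr: "\<And>i S. i \<in> \<Lambda> \<Longrightarrow> S \<in> nsets V s \<Longrightarrow> tr i S \<Longrightarrow>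
      card {R \<in> nsets V r. \<not> tr i R \<and> S \<subseteq> R} \<le> w"
    and tr_mono: "\<And>i R S. i \<in> \<Lambda> \<Longrightarrow> tr i R \<Longrightarrow> S \<subseteq> R \<Longrightarrow> tr i S"
    and small: "card (nsets V s) * (b * ((r choose s) * w)) ^ t < fact t"
  shows "\<exists>C' col'. C' \<subseteq> nsets V r \<and> col' \<in> C' \<rightarrow> X \<and>
    (\<forall>R\<in>C'. \<forall>R'\<in>C'. col' R = col' R' \<longrightarrow> card (R \<inter> R') \<noteq> s) \<and>
    (\<forall>S\<in>nsets V s. (\<exists>i\<in>\<Lambda>. tr i S) \<longrightarrow> real (card {R \<in> nsets V r. S \<subseteq> R \<and> R \<notin> C'}) \<le> u + w + b * t)"
  using fin(3) C col proper mult uncol ntr tr_mono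
proof (induction \<Lambda> rule: finite_induct)
  case empty
  show ?case by (rule exI[of _ "{}"]) auto
next
  case (insert i \<Lambda>)
  note hyps = insert.prems
  have finN: "finite (nsets V j)" for j by (rule finite_imp_finite_nsets[OF fin(1)])
  have "\<exists>C' col'. C' \<subseteq> nsets V r \<and> col' \<in> C' \<rightarrow> X \<and>
    (\<forall>R\<in>C'. \<forall>R'\<in>C'. col' R = col' R' \<longrightarrow> card (R \<inter> R') \<noteq> s) \<and>
    (\<forall>S\<in>nsets V s. (\<exists>i\<in>\<Lambda>. tr i S) \<longrightarrow> real (card {R \<in> nsets V r. S \<subseteq> R \<and> R \<notin> C'}) \<le> u + w + b * t)"
    by (rule insert.IH; rule hyps[OF insertI2]; assumption)
  then obtain C2 col2 where C2: "C2 \<subseteq> nsets V r" "col2 \<in> C2 \<rightarrow> X"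
    and p2: "\<forall>R\<in>C2. \<forall>R'\<in>C2. col2 R = col2 R' \<longrightarrow> card (R \<inter> R') \<noteq> s"
    and l2: "\<forall>S\<in>nsets V s. (\<exists>i\<in>\<Lambda>. tr i S) \<longrightarrow>
      real (card {R \<in> nsets V r. S \<subseteq> R \<and> R \<notin> C2}) \<le> u + w + b * t"
    by (elim exE conjE)
  have proper2: "card (R \<inter> R') \<noteq> s" if "R \<in> C2" "R' \<in> C2" "col2 R = col2 R'" for R R'
    using p2 that by simp
  have left2: "real (card {R \<in> nsets V r. S \<subseteq> R \<and> R \<notin> C2}) \<le> u + w + b * t"
    if "S \<in> nsets V s" "j \<in> \<Lambda>" "tr j S" for S j
    using l2 that by simp blast
  have i: "i \<in> insert i \<Lambda>" by simp
  note C1 = hyps(1)[OF i] and col1 = hyps(2)[OF i] and proper1 = hyps(3)[OF i]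
  define V2 where "V2 = {R \<in> C2. \<not> tr i R}"
  define adj where "adj R R' \<longleftrightarrow> card (R \<inter> R') = s" for R R' :: "'v set"
  have finC: "finite (C i)" "finite V2"
    using C1 C2(1) finN[of r] by (auto simp: V2_def intro: finite_subset)
  have deg: "card {R' \<in> V2. adj R R'} \<le> (r choose s) * w" if R: "R \<in> C i" for R
    unfolding adj_def
  proof (rule card_neighbours_le)
    have R': "R \<in> nsets V r" "tr i R" using R C1 by auto
    then show "finite R" "card R = r" by (auto simp: nsets_def)
    show "finite V2" by (rule finC)
    fix S assume S: "S \<subseteq> R" "card S = s"
    then have "S \<in> nsets V s" using R' by (auto simp: nsets_def intro: finite_subset)
    moreover have "tr i S" using hyps(7)[OF i] R'(2) S(1) by blast
    ultimately have "card {R \<in> nsets V r. \<not> tr i R \<and> S \<subseteq> R} \<le> w" using hyps(6)[OF i] by blast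
    moreover have "card {R' \<in> V2. S \<subseteq> R'} \<le> card {R \<in> nsets V r. \<not> tr i R \<and> S \<subseteq> R}"
      using C2(1) finN[of r] by (intro card_mono) (auto simp: V2_def)
    ultimately show "card {R' \<in> V2. S \<subseteq> R'} \<le> w" by linarith
  qed
  \<comment> \<open>Permuting the colours of \<open>C i\<close> keeps them proper among themselves; only conflicts with \<open>V2\<close> remain.\<close>
  have "\<exists>\<beta>. \<beta> permutes X \<and> (\<forall>S\<in>nsets V s.
      card {R \<in> C i. S \<subseteq> R \<and> (\<exists>R'\<in>V2. adj R R' \<and> \<beta> (col i R) = col2 R')} \<le> b * t)"
    by (rule ex_recolouring_with_few_conflicts[OF fin(2) finN finC col1 _ deg small]) (rule hyps(4)[OF i])
  then obtain \<beta> where \<beta>: "\<beta> permutes X"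
    and confl: "\<And>S. S \<in> nsets V s \<Longrightarrow>
      card {R \<in> C i. S \<subseteq> R \<and> (\<exists>R'\<in>V2. adj R R' \<and> \<beta> (col i R) = col2 R')} \<le> b * t"
    by blast
  define bad where "bad = {R \<in> C i. \<exists>R'\<in>V2. adj R R' \<and> \<beta> (col i R) = col2 R'}"
  define C' where "C' = (C i - bad) \<union> V2"
  define col' where "col' R = (if tr i R then \<beta> (col i R) else col2 R)" for R
  have sub: "C' \<subseteq> nsets V r" using C1 C2(1) by (auto simp: C'_def V2_def)
  have range: "col' \<in> C' \<rightarrow> X"
  proof
    fix R assume "R \<in> C'"
    then consider "R \<in> C i" "tr i R" | "R \<in> C2" "\<not> tr i R" using C1 by (auto simp: C'_def V2_def)
    then show "col' R \<in> X"
    proof cases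
      case 1
      then have "col i R \<in> X" using col1 by blast
      then show ?thesis using 1 permutes_in_image[OF \<beta>] by (simp add: col'_def)
    next
      case 2
      then show ?thesis using C2(2) by (auto simp: col'_def)
    qed
  qed
  have mixed: False
    if "R \<in> C'" "R' \<in> C'" "tr i R" "\<not> tr i R'" "col' R = col' R'" "card (R \<inter> R') = s" for R R'
  proof -
    have "R \<in> C i - bad" "R' \<in> V2" using that C1 by (auto simp: C'_def V2_def)
    then show False using that by (auto simp: bad_def adj_def col'_def)
  qed
  have proper': "card (R \<inter> R') \<noteq> s" if RR: "R \<in> C'" "R' \<in> C'" "col' R = col' R'" for R R'
  proof
    assume s: "card (R \<inter> R') = s"
    consider "tr i R" "tr i R'" | "tr i R" "\<not> tr i R'" | "\<not> tr i R" "tr i R'"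
      | "\<not> tr i R" "\<not> tr i R'" by blast
    then show False
    proof cases
      case 1
      then have "col i R = col i R'"
        using RR(3) permutes_inj[OF \<beta>] by (auto simp: col'_def dest: injD)
      moreover have "R \<in> C i" "R' \<in> C i" using 1 RR by (auto simp: C'_def V2_def)
      ultimately show False using proper1 s by blast
    next
      case 2 then show False using mixed[OF RR(1,2)] RR(3) s by blast
    next
      case 3 then show False using mixed[OF RR(2,1)] RR(3) s by (simp add: Int_commute)
    next
      case 4
      then have "R \<in> C2" "R' \<in> C2" using RR C1 by (auto simp: C'_def V2_def)
      then show False using proper2[of R R'] 4 RR(3) s by (auto simp: col'_def)
    qed
  qed
  have left: "real (card {R \<in> nsets V r. S \<subseteq> R \<and> R \<notin> C'}) \<le> u + w + b * t"
    if S: "S \<in> nsets V s" "j \<in> insert i \<Lambda>" "tr j S" for S j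
  proof (cases "tr i S")
    case True
    let ?A = "{R \<in> nsets V r. tr i R \<and> S \<subseteq> R \<and> R \<notin> C i}"
    let ?B = "{R \<in> nsets V r. \<not> tr i R \<and> S \<subseteq> R}"
    let ?D = "{R \<in> C i. S \<subseteq> R \<and> (\<exists>R'\<in>V2. adj R R' \<and> \<beta> (col i R) = col2 R')}"
    have "card {R \<in> nsets V r. S \<subseteq> R \<and> R \<notin> C'} \<le> card (?A \<union> ?B \<union> ?D)"
      using finN[of r] finC by (intro card_mono) (auto simp: C'_def bad_def)
    also have "\<dots> \<le> card ?A + card ?B + card ?D"
      by (meson add_le_mono1 card_Un_le le_trans)
    finally have "real (card {R \<in> nsets V r. S \<subseteq> R \<and> R \<notin> C'}) \<le> card ?A + card ?B + card ?D"
      by linarith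
    moreover have "real (card ?A) \<le> u" by (rule hyps(5)[OF i S(1) True])
    moreover have "card ?B \<le> w" by (rule hyps(6)[OF i S(1) True])
    moreover have "card ?D \<le> b * t" by (rule confl[OF S(1)])
    ultimately show ?thesis by linarith
  next
    case False
    then have "j \<in> \<Lambda>" using S by auto
    have "\<not> tr i R" if "S \<subseteq> R" for R using hyps(7)[OF i] that False by blast
    then have "{R \<in> nsets V r. S \<subseteq> R \<and> R \<notin> C'} \<subseteq> {R \<in> nsets V r. S \<subseteq> R \<and> R \<notin> C2}"
      by (auto simp: C'_def V2_def)
    then have "card {R \<in> nsets V r. S \<subseteq> R \<and> R \<notin> C'} \<le> card {R \<in> nsets V r. S \<subseteq> R \<and> R \<notin> C2}"
      using finN[of r] by (intro card_mono) auto
    then show ?thesis using left2[OF S(1) \<open>j \<in> \<Lambda>\<close> S(3)] by linarith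
  qed
  show ?case
  proof (intro exI[of _ C'] exI[of _ col'] conjI ballI impI)
    show "C' \<subseteq> nsets V r" by (rule sub)
    show "col' \<in> C' \<rightarrow> X" by (rule range)
    show "card (R \<inter> R') \<noteq> s" if "R \<in> C'" "R' \<in> C'" "col' R = col' R'" for R R'
      by (rule proper'[OF that])
    show "real (card {R \<in> nsets V r. S \<subseteq> R \<and> R \<notin> C'}) \<le> u + w + b * t"
      if "S \<in> nsets V s" "\<exists>j\<in>insert i \<Lambda>. tr j S" for S
      using left[OF that(1)] that(2) by blast
  qed
qed

text \<open>
  Since \<open>S\<close> itself is transversal, some point outside \<open>S\<close> shares its label with another point.  Remove it; there are at
  most \<open>r * p\<close> ways to put it back.
\<close>
lemma card_non_transversal_supersets_le:
  assumes "finite V" "finite S" "card S = s" "s < r" "S \<subseteq> V" "inj_on lam S"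
    and fibre: "\<And>i. card {x \<in> V. lam x = i} \<le> p"
  shows "card {R \<in> nsets V r. \<not> inj_on lam R \<and> S \<subseteq> R} \<le> r * p * card V ^ (r - s - 1)"
proof -
  let ?B = "{R0 \<in> nsets V (r - 1). S \<subseteq> R0}"
  let ?Y = "\<lambda>R0. \<Union>i\<in>lam ` R0. {x \<in> V. lam x = i}"
  have finB: "finite ?B" using finite_imp_finite_nsets[OF assms(1)] by simp
  have finY: "finite (?Y R0)" for R0 by (rule finite_subset[OF _ assms(1)]) blast
  have "{R \<in> nsets V r. \<not> inj_on lam R \<and> S \<subseteq> R} \<subseteq> (\<lambda>(R0, y). insert y R0) ` (SIGMA R0 : ?B. ?Y R0)"
  proof
    fix R assume R: "R \<in> {R \<in> nsets V r. \<not> inj_on lam R \<and> S \<subseteq> R}"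
    then obtain x y where xy: "x \<in> R" "y \<in> R" "x \<noteq> y" "lam x = lam y" by (auto simp: inj_on_def)
    obtain a b where ab: "a \<in> R" "b \<in> R" "a \<noteq> b" "lam a = lam b" "b \<notin> S"
    proof (cases "y \<in> S")
      case True
      then have "x \<notin> S" using xy assms(6) by (auto simp: inj_on_def)
      then show ?thesis using that[of y x] xy by auto
    next
      case False then show ?thesis using that[of x y] xy by auto
    qed
    have fin: "finite R" "card R = r" "R \<subseteq> V" using R by (auto simp: nsets_def)
    have "R - {b} \<in> ?B" using R ab fin by (auto simp: nsets_def)
    moreover have "lam b \<in> lam ` (R - {b})" by (rule image_eqI[of _ _ a]) (use ab in auto)
    then have "b \<in> ?Y (R - {b})" using ab fin by auto
    ultimately have "(R - {b}, b) \<in> (SIGMA R0 : ?B. ?Y R0)" by blast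
    moreover have "R = (\<lambda>(R0, y). insert y R0) (R - {b}, b)" using ab by auto
    ultimately show "R \<in> (\<lambda>(R0, y). insert y R0) ` (SIGMA R0 : ?B. ?Y R0)"
      by (rule image_eqI[rotated])
  qed
  moreover have "finite (SIGMA R0 : ?B. ?Y R0)" using finB finY by auto
  ultimately have "card {R \<in> nsets V r. \<not> inj_on lam R \<and> S \<subseteq> R} \<le> card (SIGMA R0 : ?B. ?Y R0)"
    by (intro surj_card_le)
  also have "\<dots> = (\<Sum>R0\<in>?B. card (?Y R0))" using finB finY by (intro card_SigmaI) auto
  also have "\<dots> \<le> (\<Sum>R0\<in>?B. r * p)"
  proof (rule sum_mono)
    fix R0 assume "R0 \<in> ?B"
    then have R0: "finite R0" "card R0 = r - 1" by (auto simp: nsets_def)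
    have "card (?Y R0) \<le> (\<Sum>i\<in>lam ` R0. card {x \<in> V. lam x = i})"
      by (rule card_UN_le) (use R0 in simp)
    also have "\<dots> \<le> card (lam ` R0) * p" using sum_bounded_above[of "lam ` R0", OF fibre] by simp
    also have "\<dots> \<le> r * p" using card_image_le[OF R0(1), of lam] R0(2) by (intro mult_le_mono1) simp
    finally show "card (?Y R0) \<le> r * p" .
  qed
  also have "\<dots> = card ?B * (r * p)" by simp
  also have "card ?B \<le> card V ^ (r - s - 1)"
  proof -
    have "card ?B \<le> (card V - s) choose (r - 1 - s)"
      using card_nsets_superset_le[OF assms(1,2), of "r - 1"] assms(3,4) by simp
    also have "\<dots> \<le> (card V - s) ^ (r - 1 - s)"
      by (cases "r - 1 - s \<le> card V - s") (auto simp: binomial_eq_0 intro: binomial_le_pow)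
    also have "\<dots> \<le> card V ^ (r - 1 - s)" by (rule power_mono) auto
    finally show ?thesis by (simp add: diff_commute)
  qed
  finally show ?thesis by (simp add: mult_ac)
qed

section \<open>The chromatic number for given parameters\<close>

lemma chromatic_number_le:
  assumes "finite Y" "f \<in> pverts G \<rightarrow> Y" "parcs G \<subseteq> pverts G \<times> pverts G"
    and "\<And>u v. (u, v) \<in> parcs G \<Longrightarrow> f u \<noteq> f v"
  shows "chromatic_number G \<le> card Y"
proof -
  obtain e where e: "bij_betw e Y {0..<card Y}" using ex_bij_betw_finite_nat[OF assms(1)] by blast
  have "proper_colouring G (card Y) (e \<circ> f)"
    unfolding proper_colouring_def
  proof (intro conjI ballI)
    show "(e \<circ> f) x < card Y" if "x \<in> pverts G" for x
      using bij_betwE[OF e] assms(2) that by (auto simp: Pi_iff)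
    fix a assume a: "a \<in> parcs G"
    obtain u v where uv: "a = (u, v)" by (cases a)
    then have "f u \<in> Y" "f v \<in> Y" "f u \<noteq> f v" using assms(2,3,4) a by auto
    then have "e (f u) \<noteq> e (f v)" using bij_betw_imp_inj_on[OF e] by (auto dest: inj_onD)
    then show "case a of (u, v) \<Rightarrow> (e \<circ> f) u \<noteq> (e \<circ> f) v" by (simp add: uv)
  qed
  then show ?thesis unfolding chromatic_number_def by (intro Least_le) blast
qed

text \<open>
  Enumerate the points with those of \<open>S\<close> first, and take remainder and quotient modulo \<open>Q\<close>.
\<close>
lemma ex_separating_labelling:
  assumes "S \<subseteq> {1..n}" "card S \<le> Q" "n \<le> Q * p" "0 < Q"
  shows "\<exists>lam v :: nat \<Rightarrow> nat. (\<forall>x\<in>{1..n}. lam x < Q \<and> v x < p) \<and>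
    (\<forall>x\<in>{1..n}. \<forall>y\<in>{1..n}. lam x = lam y \<longrightarrow> v x = v y \<longrightarrow> x = y) \<and> inj_on lam S"
proof -
  have "card S \<le> card {1..n}" using assms(1) by (intro card_mono) auto
  then have "{1..card S} \<subseteq> {1..n}" by auto
  then obtain \<tau> where \<tau>: "\<tau> permutes {1..n}" "\<tau> ` S = {1..card S}"
    using ex_permutes_image[of "{1..n}" S "{1..card S}"] assms(1) by auto
  define lam v where "lam x = (\<tau> x - 1) mod Q" and "v x = (\<tau> x - 1) div Q" for x
  have range: "1 \<le> \<tau> x \<and> \<tau> x \<le> n" if "x \<in> {1..n}" for x
    using permutes_in_image[OF \<tau>(1), of x] that by simp
  have "lam x < Q \<and> v x < p" if "x \<in> {1..n}" for x
  proof -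
    have "\<tau> x - 1 < Q * p" using range[OF that] assms(3) by linarith
    then show ?thesis using assms(4) by (simp add: lam_def v_def less_mult_imp_div_less mult.commute)
  qed
  moreover have "x = y" if "x \<in> {1..n}" "y \<in> {1..n}" "lam x = lam y" "v x = v y" for x y
  proof -
    have "\<tau> x - 1 = \<tau> y - 1" using that(3,4) unfolding lam_def v_def by (metis div_mult_mod_eq)
    then have "\<tau> x = \<tau> y" using range[OF that(1)] range[OF that(2)] by linarith
    then show "x = y" using permutes_inj[OF \<tau>(1)] by (auto dest: injD)
  qed
  moreover have "inj_on lam S"
  proof (rule inj_onI)
    fix x y assume xy: "x \<in> S" "y \<in> S" "lam x = lam y"
    have z: "1 \<le> \<tau> z \<and> lam z = \<tau> z - 1" if "z \<in> S" for z
    proof -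
      have "\<tau> z \<in> {1..card S}" using \<tau>(2) that by blast
      then have "1 \<le> \<tau> z" "\<tau> z - 1 < Q" using assms(2) by auto
      then show ?thesis by (simp add: lam_def)
    qed
    have "\<tau> x - 1 = \<tau> y - 1" using z[OF xy(1)] z[OF xy(2)] xy(3) by simp
    moreover have "1 \<le> \<tau> x" "1 \<le> \<tau> y" using z xy(1,2) by auto
    ultimately have "\<tau> x = \<tau> y" by linarith
    then show "x = y" using permutes_inj[OF \<tau>(1)] by (auto dest: injD)
  qed
  ultimately show ?thesis by blast
qed

text \<open>
  The hypothesis \<open>large\<close> is what the union bound over all \<open>s\<close>-sets asks for when colourings are merged; it holds
  for large \<open>n\<close> because \<open>w\<close> is at least linear in \<open>n\<close>.
\<close>
lemma chromatic_number_le_of_packings: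
  fixes r s Q p N n :: nat and F :: "(nat set \<times> nat) set" and \<delta> :: real
  assumes sr: "s < r" and rQ: "r \<le> Q" and n: "0 < n" "n \<le> Q * p"
    and coprime_p: "\<And>d. 0 < d \<Longrightarrow> d < Q \<Longrightarrow> coprime d p"
    and F: "F \<subseteq> nsets {..<Q} (2 * r - s - 1) \<times> {..<N}"
    and packing: "\<And>M M' c. (M, c) \<in> F \<Longrightarrow> (M', c) \<in> F \<Longrightarrow> s \<le> card (M \<inter> M') \<Longrightarrow> M = M'"
    and uncovered: "real (card {R \<in> nsets {..<Q} r. \<not> (\<exists>(M, c)\<in>F. R \<subseteq> M)}) \<le> \<delta> * real (Q choose r)"
  defines "b \<equiv> 2 ^ (2 * r - s - 1)" and "w \<equiv> r * p * n ^ (r - s - 1)"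
  assumes large: "n ^ s \<le> 2 ^ (b * ((r choose s) * w))"
  shows "real (chromatic_number (intersection_graph n r s)) \<le> real N * real p ^ (r - s) +
    real (r choose s) * (\<delta> * real Q ^ (r - s) * (real p ^ (r - s) + fact Q)
      + real w + real b * real (8 * (b * ((r choose s) * w)))) + 1"
proof -
  define V where "V = {1..n}"
  define A where "A = ({s..<r} \<rightarrow>\<^sub>E {0..<int p})"
  have p: "0 < p" using n by (cases p) auto
  have Q: "0 < Q" using sr rQ by simp
  have finV: "finite V" "card V = n" by (simp_all add: V_def)
  have finA: "finite A" and cardA: "card A = p ^ (r - s)"
    by (auto simp: A_def card_PiE intro: finite_PiE)
  let ?P = "{\<pi>. \<pi> permutes {..<Q}}"
  have "finite ?P" "?P \<noteq> {}" by (auto intro: finite_permutations permutes_id)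
  from ex_equidistributed_map[OF finA this] obtain \<sigma> where \<sigma>: "\<sigma> \<in> A \<rightarrow> ?P"
    "\<forall>\<pi>\<in>?P. card {a \<in> A. \<sigma> a = \<pi>} * card ?P \<le> card A + card ?P"
    by (elim exE conjE)
  have cardP: "card ?P = fact Q" by (rule card_permutations) auto
  define u where "u = \<delta> * real Q ^ (r - s) * (real p ^ (r - s) + fact Q)"
  define t where "t = 8 * (b * ((r choose s) * w))"
  define X where "X = {..<N} \<times> A"
  have finX: "finite X" and cardX: "card X = N * p ^ (r - s)"
    using finA cardA by (auto simp: X_def card_cartesian_product)
  have finNs: "finite (nsets V j)" for j by (rule finite_imp_finite_nsets[OF finV(1)])
  define good where "good lam C col \<longleftrightarrow> C \<subseteq> {R \<in> nsets V r. inj_on lam R} \<and> col \<in> C \<rightarrow> X \<and>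
      (\<forall>R\<in>C. \<forall>R'\<in>C. col R = col R' \<longrightarrow> card (R \<inter> R') \<noteq> s) \<and>
      (\<forall>S\<in>nsets V s. \<forall>x. card {R \<in> C. S \<subseteq> R \<and> col R = x} \<le> b) \<and>
      (\<forall>S\<in>nsets V s. real (card {R \<in> nsets V r. inj_on lam R \<and> S \<subseteq> R \<and> R \<notin> C}) \<le> u) \<and>
      (\<forall>S\<in>nsets V s. inj_on lam S \<longrightarrow> card {R \<in> nsets V r. \<not> inj_on lam R \<and> S \<subseteq> R} \<le> w)"
    for lam :: "nat \<Rightarrow> nat" and C :: "nat set set" and col :: "nat set \<Rightarrow> nat \<times> (nat \<Rightarrow> int)"
  have "\<exists>lam C col. inj_on lam S \<and> good lam C col" if S: "S \<in> nsets V s" for S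
  proof -
    have S': "S \<subseteq> {1..n}" "card S \<le> Q" using S sr rQ by (auto simp: nsets_def V_def)
    from ex_separating_labelling[OF this n(2) Q]
    obtain lam v where lv: "\<forall>x\<in>{1..n}. lam x < Q \<and> v x < p"
      "\<forall>x\<in>{1..n}. \<forall>y\<in>{1..n}. lam x = lam y \<longrightarrow> v x = v y \<longrightarrow> x = y" "inj_on lam S" by blast
    interpret L: transversal_code V lam v r s "2 * r - s - 1" Q p N F \<delta> \<sigma>
    proof
      show "\<sigma> a permutes {..<Q}" if "a \<in> {s..<r} \<rightarrow>\<^sub>E {0..<int p}" for a
        using \<sigma>(1) that by (auto simp: A_def)
      show "card {a \<in> {s..<r} \<rightarrow>\<^sub>E {0..<int p}. \<sigma> a = \<pi>} * fact Q \<le> p ^ (r - s) + fact Q"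
        if "\<pi> permutes {..<Q}" for \<pi>
        using bspec[OF \<sigma>(2), of \<pi>] that cardP cardA unfolding A_def by simp
      show "lam x < Q" "v x < p" if "x \<in> V" for x using lv(1) that by (simp_all add: V_def)
      show "x = y" if "x \<in> V" "y \<in> V" "lam x = lam y" "v x = v y" for x y
        by (rule lv(2)[rule_format]) (use that in \<open>simp_all only: V_def\<close>)
      show "M = M'" if "(M, c) \<in> F" "(M', c) \<in> F" "s \<le> card (M \<inter> M')" for M M' c
        using packing[OF that] .
      show "coprime d p" if "0 < d" "d < Q" for d using coprime_p[OF that] .
    qed (rule finV(1) sr rQ p F uncovered refl)+
    have fibre: "card {x \<in> V. lam x = i} \<le> p" for i
    proof -
      have "inj_on v {x \<in> V. lam x = i}" by (rule inj_onI) (auto intro: L.inj_lam_v)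
      moreover have "v ` {x \<in> V. lam x = i} \<subseteq> {..<p}" using L.v by auto
      ultimately have "card {x \<in> V. lam x = i} \<le> card {..<p}" by (rule card_inj_on_le) simp
      then show ?thesis by simp
    qed
    have "card {R \<in> nsets V r. \<not> inj_on lam R \<and> S' \<subseteq> R} \<le> w"
      if h: "S' \<in> nsets V s" "inj_on lam S'" for S'
    proof -
      have "finite S'" "card S' = s" "S' \<subseteq> V" using h(1) by (auto simp: nsets_def)
      from card_non_transversal_supersets_le[OF finV(1) this(1,2) sr this(3) h(2) fibre]
      show ?thesis by (simp add: w_def finV(2))
    qed
    moreover have "real (card {R \<in> nsets V r. inj_on lam R \<and> S' \<subseteq> R \<and> R \<notin> L.C}) \<le> u"
      if "S' \<in> nsets V s" for S'
      using L.uncoloured[of S'] that by (simp add: u_def L.T_def nsets_def[of V s])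
    moreover have "L.col \<in> L.C \<rightarrow> X" using L.col_range by (simp add: X_def A_def L.A_def)
    moreover have "L.C \<subseteq> {R \<in> nsets V r. inj_on lam R}" using L.C_subset by (simp add: L.T_def)
    moreover have "card {R \<in> L.C. S' \<subseteq> R \<and> L.col R = x} \<le> b" if "S' \<in> nsets V s" for S' x
      using L.multiplicity[of S' x] that by (simp add: b_def nsets_def)
    ultimately have "good lam L.C L.col" using L.proper unfolding good_def by blast
    then show ?thesis using lv(3) by blast
  qed
  then have "\<forall>S. \<exists>z. S \<in> nsets V s \<longrightarrow> inj_on (fst z) S \<and> good (fst z) (fst (snd z)) (snd (snd z))"
    by fastforce
  from choice[OF this] obtain z where z: "\<And>S. S \<in> nsets V s \<Longrightarrow>
    inj_on (fst (z S)) S \<and> good (fst (z S)) (fst (snd (z S))) (snd (snd (z S)))" by blast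
  define lam C col where "lam S = fst (z S)" and "C S = fst (snd (z S))" and "col S = snd (snd (z S))" for S
  have sch: "inj_on (lam S) S" "good (lam S) (C S) (col S)" if "S \<in> nsets V s" for S
    using z[OF that] by (simp_all add: lam_def C_def col_def)
  have "0 < b * ((r choose s) * w)"
    using sr n p by (simp add: b_def w_def)
  moreover have "card (nsets V s) \<le> 2 ^ (b * ((r choose s) * w))"
  proof -
    have "card (nsets V s) \<le> n ^ s"
      using finV binomial_le_pow[of s n] by (cases "s \<le> n") (auto simp: card_nsets binomial_eq_0)
    then show ?thesis using large by (rule le_trans)
  qed
  ultimately have small: "card (nsets V s) * (b * ((r choose s) * w)) ^ t < fact t"
    unfolding t_def by (rule power_less_fact)
  have "\<exists>C' col'. C' \<subseteq> nsets V r \<and> col' \<in> C' \<rightarrow> X \<and>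
    (\<forall>R\<in>C'. \<forall>R'\<in>C'. col' R = col' R' \<longrightarrow> card (R \<inter> R') \<noteq> s) \<and>
    (\<forall>S\<in>nsets V s. (\<exists>i\<in>nsets V s. inj_on (lam i) S) \<longrightarrow>
      real (card {R \<in> nsets V r. S \<subseteq> R \<and> R \<notin> C'}) \<le> u + w + b * t)"
  proof (rule merge_partial_colourings[OF finV(1) finX finNs, where C = C and col = col])
    show "card (nsets V s) * (b * ((r choose s) * w)) ^ t < fact t" by (rule small)
    show "inj_on (lam i) S" if "inj_on (lam i) R" "S \<subseteq> R" for i S R
      using that by (rule inj_on_subset)
  next
    fix i assume "i \<in> nsets V s"
    then have g: "good (lam i) (C i) (col i)" by (rule sch(2))
    note g = g[unfolded good_def]
    show "C i \<subseteq> {R \<in> nsets V r. inj_on (lam i) R}" "col i \<in> C i \<rightarrow> X" using g by blast+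
    show "card (R \<inter> R') \<noteq> s" if "R \<in> C i" "R' \<in> C i" "col i R = col i R'" for R R'
      using g that by simp
    show "card {R \<in> C i. S \<subseteq> R \<and> col i R = x} \<le> b" if "S \<in> nsets V s" for S x
      using g that by blast
    show "real (card {R \<in> nsets V r. inj_on (lam i) R \<and> S \<subseteq> R \<and> R \<notin> C i}) \<le> u"
      if "S \<in> nsets V s" for S using g that by blast
    show "card {R \<in> nsets V r. \<not> inj_on (lam i) R \<and> S \<subseteq> R} \<le> w"
      if "S \<in> nsets V s" "inj_on (lam i) S" for S using g that by blast
  qed
  then obtain C' col' where C': "C' \<subseteq> nsets V r" "col' \<in> C' \<rightarrow> X"
    and proper: "\<forall>R\<in>C'. \<forall>R'\<in>C'. col' R = col' R' \<longrightarrow> card (R \<inter> R') \<noteq> s"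
    and left: "\<forall>S\<in>nsets V s. (\<exists>i\<in>nsets V s. inj_on (lam i) S) \<longrightarrow>
      real (card {R \<in> nsets V r. S \<subseteq> R \<and> R \<notin> C'}) \<le> u + w + b * t"
    by (elim exE conjE)
  define L where "L = nsets V r - C'"
  define B where "B = nat \<lfloor>u + w + b * t\<rfloor>"
  define \<Delta> where "\<Delta> = (r choose s) * B"
  have finL: "finite L" using finNs by (simp add: L_def)
  have L: "R \<subseteq> V \<and> finite R \<and> card R = r" if "R \<in> L" for R
    using that by (auto simp: L_def nsets_def)
  have leftL: "card {R \<in> L. S \<subseteq> R} \<le> B" if S: "S \<in> nsets V s" for S
  proof -
    have "{R \<in> L. S \<subseteq> R} = {R \<in> nsets V r. S \<subseteq> R \<and> R \<notin> C'}" by (auto simp: L_def)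
    moreover have "real (card {R \<in> nsets V r. S \<subseteq> R \<and> R \<notin> C'}) \<le> u + w + b * t"
      using left S sch(1)[OF S] by blast
    ultimately show ?thesis unfolding B_def by (simp only: le_nat_floor)
  qed
  \<comment> \<open>The leftover \<open>r\<close>-sets get new colours.\<close>
  have "\<exists>g. g \<in> L \<rightarrow> {..\<Delta>} \<and> (\<forall>R\<in>L. \<forall>R'\<in>L. card (R \<inter> R') = s \<longrightarrow> g R \<noteq> (g R' :: nat))"
  proof (rule greedy_colouring[OF finL])
    fix R assume R: "R \<in> L"
    show "card {R' \<in> L. card (R \<inter> R') = s} \<le> \<Delta>"
      unfolding \<Delta>_def
    proof (rule card_neighbours_le)
      show "card {R' \<in> L. S \<subseteq> R'} \<le> B" if "S \<subseteq> R" "card S = s" for S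
        using that L[OF R] by (intro leftL) (auto simp: nsets_def intro: finite_subset)
    qed (use L[OF R] finL in auto)
    show "card (R \<inter> R) \<noteq> s" using L[OF R] sr by simp
  qed (simp add: Int_commute)
  then obtain g where g: "g \<in> L \<rightarrow> {..\<Delta>}"
    "\<And>R R'. R \<in> L \<Longrightarrow> R' \<in> L \<Longrightarrow> card (R \<inter> R') = s \<Longrightarrow> g R \<noteq> g R'" by blast
  define f where "f R = (if R \<in> C' then Inl (col' R) else Inr (g R))" for R
  have G: "pverts (intersection_graph n r s) = nsets V r"
    "(R, R') \<in> parcs (intersection_graph n r s) \<longleftrightarrow> R \<in> nsets V r \<and> R' \<in> nsets V r \<and> card (R \<inter> R') = s" for R R'
    by (auto simp: intersection_graph_def Let_def nsets_def V_def intro: finite_subset)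
  have "chromatic_number (intersection_graph n r s) \<le> card (X <+> {..\<Delta>})"
  proof (rule chromatic_number_le)
    show "finite (X <+> {..\<Delta>})" using finX by simp
    show "f \<in> pverts (intersection_graph n r s) \<rightarrow> X <+> {..\<Delta>}"
      using C'(2) g(1) by (auto simp: f_def G L_def)
    show "parcs (intersection_graph n r s)
        \<subseteq> pverts (intersection_graph n r s) \<times> pverts (intersection_graph n r s)"
      using G by auto
    show "f R \<noteq> f R'" if "(R, R') \<in> parcs (intersection_graph n r s)" for R R'
      using that proper g(2)[of R R'] by (auto simp: f_def G L_def)
  qed
  also have "\<dots> = card X + (\<Delta> + 1)" using finX by (simp add: card_Plus)
  finally have "real (chromatic_number (intersection_graph n r s)) \<le> real (card X) + real \<Delta> + 1" by simp
  moreover have "real \<Delta> \<le> real (r choose s) * (u + w + b * t)"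
  proof -
    have "0 \<le> u + w + b * t"
    proof -
      have "0 \<le> \<delta> * real (Q choose r)" using uncovered of_nat_0_le_iff order_trans by blast
      moreover have "0 < real (Q choose r)" using rQ by simp
      ultimately have "0 \<le> \<delta>" by (simp add: zero_le_mult_iff)
      then show ?thesis by (simp add: u_def)
    qed
    then have "real B \<le> u + w + b * t" unfolding B_def by (rule of_nat_floor)
    then show ?thesis unfolding \<Delta>_def of_nat_mult by (intro mult_left_mono) auto
  qed
  ultimately show ?thesis by (simp add: cardX u_def t_def)
qed

section \<open>Asymptotics\<close>

lemma eventually_power_le_exponential:
  fixes Q s :: nat
  assumes "0 < Q"
  shows "eventually (\<lambda>n. real n ^ s \<le> 2 powr (real n / real Q)) at_top"
  using assms by real_asymp

text \<open>
  Divided by \<open>n ^ k\<close>, the bound of \<open>chromatic_number_le_of_packings\<close> tends to \<open>N / Q ^ k\<close>, which exceeds \<open>c0\<close> by at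
  most \<open>1 / Q\<close>, plus an error of order \<open>\<delta> + 1 / Q\<close>.  So \<open>\<delta>\<close> is fixed first, then \<open>Q\<close>, and then \<open>n\<close>
  is large.
\<close>
lemma chromatic_number_intersection_graph_asymptotic:
  fixes r s :: nat and e :: real
  assumes sr: "s < r" and e: "0 < e"
  shows "eventually (\<lambda>n. real (chromatic_number (intersection_graph n r s)) \<le>
    (fact (r - s - 1) / fact (2 * r - 2 * s - 1) + e) * real n ^ (r - s)) at_top"
proof -
  define k where "k = r - s"
  define c0 :: real where "c0 = fact (r - s - 1) / fact (2 * r - 2 * s - 1)"
  define c where "c = r choose s"
  define b :: nat where "b = 2 ^ (2 * r - s - 1)"
  have k: "0 < k" using sr by (simp add: k_def)
  have c: "0 < c" using sr by (simp add: c_def)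
  define \<delta> where "\<delta> = e / (4 * real c)"
  define G where "G = real c * (1 + real b * 8 * real b * real c) * real r"
  have delta: "0 < \<delta>" using e c by (simp add: \<delta>_def)
  have G: "0 \<le> G" by (simp add: G_def)
  obtain Q0 where Q0: "\<And>Q. Q0 \<le> Q \<Longrightarrow> \<exists>(F :: (nat set \<times> nat) set) N.
    F \<subseteq> nsets {..<Q} (2 * r - s - 1) \<times> {..<N} \<and>
    real N \<le> c0 * real Q ^ (r - s) + 1 \<and>
    (\<forall>M M' c. (M, c) \<in> F \<longrightarrow> (M', c) \<in> F \<longrightarrow> s \<le> card (M \<inter> M') \<longrightarrow> M = M') \<and>
    real (card {R \<in> nsets {..<Q} r. \<not> (\<exists>(M, c)\<in>F. R \<subseteq> M)}) \<le> \<delta> * real (Q choose r)"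
    using near_decomposition_into_packings[OF sr delta] unfolding c0_def by blast
  define Q where "Q = Q0 + r + 1 + nat \<lceil>4 * (1 + G) / e\<rceil>"
  have rQ: "r \<le> Q" and Qpos: "0 < Q" by (simp_all add: Q_def)
  have Qbig: "(1 + G) / real Q \<le> e / 4"
  proof -
    have "4 * (1 + G) / e \<le> real (nat \<lceil>4 * (1 + G) / e\<rceil>)" by linarith
    also have "\<dots> \<le> real Q" by (simp add: Q_def)
    finally show ?thesis using e Qpos by (simp add: field_simps)
  qed
  obtain F N where F: "F \<subseteq> nsets {..<Q} (2 * r - s - 1) \<times> {..<N}"
    and N: "real N \<le> c0 * real Q ^ k + 1"
    and packing: "\<And>M M' c. (M, c) \<in> F \<Longrightarrow> (M', c) \<in> F \<Longrightarrow> s \<le> card (M \<inter> M') \<Longrightarrow> M = M'"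
    and uncovered: "real (card {R \<in> nsets {..<Q} r. \<not> (\<exists>(M, c)\<in>F. R \<subseteq> M)}) \<le> \<delta> * real (Q choose r)"
    using Q0[of Q] unfolding k_def by (auto simp: Q_def)
  \<comment> \<open>congruent to 1 modulo every positive number below \<open>Q\<close>, and within a constant of \<open>n / Q\<close>\<close>
  define p where "p n = fact Q * (n div (Q * fact Q) + 1) + 1" for n :: nat
  have coprime_p: "coprime d (p n)" if "0 < d" "d < Q" for d n
  proof -
    have "d dvd fact Q" using that by (intro dvd_fact) auto
    then have "d dvd fact Q * (n div (Q * fact Q) + 1)" by simp
    then show ?thesis unfolding p_def
      by (metis coprime_Suc_right_nat coprime_divisors dvd_refl Suc_eq_plus1)
  qed
  have n_le: "n \<le> Q * p n" for n
  proof -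
    have "n < Q * fact Q * (n div (Q * fact Q) + 1)"
      using Qpos dividend_less_times_div[of "Q * fact Q" n] by (simp add: algebra_simps)
    also have "\<dots> \<le> Q * p n" by (simp add: p_def algebra_simps)
    finally show ?thesis by simp
  qed
  define x where "x n = real (p n) / real n" for n
  have x_lim: "x \<longlonglongrightarrow> 1 / real Q"
  proof (rule tendsto_sandwich)
    show "eventually (\<lambda>n. 1 / real Q \<le> x n) at_top"
      using eventually_gt_at_top[of 0]
    proof eventually_elim
      case (elim n)
      have "real n \<le> real Q * real (p n)" using n_le[of n] by (simp flip: of_nat_mult)
      then show ?case using elim Qpos by (simp add: x_def field_simps)
    qed
    show "eventually (\<lambda>n. x n \<le> 1 / real Q + (fact Q + 1) / real n) at_top"
      using eventually_gt_at_top[of 0]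
    proof eventually_elim
      case (elim n)
      have "real (n div (Q * fact Q)) \<le> real n / (real Q * fact Q)"
        using of_nat_div_le_of_nat[of n "Q * fact Q"] by simp
      then have "fact Q * real (n div (Q * fact Q)) \<le> fact Q * (real n / (real Q * fact Q))"
        by (intro mult_left_mono) auto
      then have "real (p n) \<le> real n / real Q + (fact Q + 1)"
        by (simp add: p_def algebra_simps)
      then show ?case using elim Qpos by (simp add: x_def field_simps)
    qed
    show "(\<lambda>n. 1 / real Q) \<longlonglongrightarrow> 1 / real Q" by simp
    have "(\<lambda>n. (fact Q + 1) / real n) \<longlonglongrightarrow> 0" by (rule lim_const_over_n)
    from tendsto_add[OF tendsto_const this]
    show "(\<lambda>n. 1 / real Q + (fact Q + 1) / real n) \<longlonglongrightarrow> 1 / real Q" by simp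
  qed
  define h where "h n = real N * x n ^ k + real c * \<delta> * real Q ^ k * (x n ^ k + fact Q * (1 / real n) ^ k)
    + G * x n + (1 / real n) ^ k" for n
  have "h \<longlonglongrightarrow> real N * (1 / real Q) ^ k + real c * \<delta> * real Q ^ k * ((1 / real Q) ^ k + fact Q * 0 ^ k)
    + G * (1 / real Q) + 0 ^ k"
    unfolding h_def by (intro tendsto_intros x_lim lim_1_over_n)
  moreover have "real N * (1 / real Q) ^ k + real c * \<delta> * real Q ^ k * ((1 / real Q) ^ k + fact Q * 0 ^ k)
    + G * (1 / real Q) + 0 ^ k < c0 + e"
  proof -
    have "real N * (1 / real Q) ^ k \<le> (c0 * real Q ^ k + 1) * (1 / real Q) ^ k"
      using N by (intro mult_right_mono) auto
    also have "\<dots> = c0 + (1 / real Q) ^ k" using Qpos by (simp add: field_simps)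
    also have "(1 / real Q) ^ k \<le> (1 / real Q) ^ 1"
      using k Qpos by (intro power_decreasing) auto
    finally have 1: "real N * (1 / real Q) ^ k \<le> c0 + 1 / real Q" by simp
    have 2: "real c * \<delta> * real Q ^ k * ((1 / real Q) ^ k + fact Q * 0 ^ k) = e / 4"
      using k c Qpos by (simp add: \<delta>_def field_simps)
    have 3: "1 / real Q + G * (1 / real Q) = (1 + G) / real Q" by (simp add: add_divide_distrib)
    have 4: "(0 :: real) ^ k = 0" using k by (rule zero_power)
    show ?thesis using 1 2 3 4 Qbig e by linarith
  qed
  ultimately have "eventually (\<lambda>n. h n < c0 + e) at_top" by (rule order_tendstoD(2))
  then show ?thesis
    using eventually_power_le_exponential[OF Qpos, of s] eventually_gt_at_top[of 0]
  proof eventually_elim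
    case (elim n)
    let ?w = "r * p n * n ^ (r - s - 1)"
    have large: "n ^ s \<le> 2 ^ (b * ((r choose s) * ?w))"
    proof -
      have "real n \<le> real Q * real (p n)" using n_le[of n] by (simp flip: of_nat_mult)
      then have "real n / real Q \<le> real (p n)" using Qpos by (simp add: field_simps)
      then have "2 powr (real n / real Q) \<le> 2 powr real (p n)" by (intro powr_mono) auto
      then have "real n ^ s \<le> 2 ^ p n" using elim(2) by (simp add: powr_realpow)
      then have "real (n ^ s) \<le> real (2 ^ p n)" by simp
      then have "n ^ s \<le> 2 ^ p n" by (simp only: of_nat_le_iff)
      also have "(2::nat) ^ p n \<le> 2 ^ (b * ((r choose s) * ?w))"
      proof (rule power_increasing)
        have "1 \<le> b * (r choose s) * r * n ^ (r - s - 1)"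
          using sr c elim(3) by (simp add: b_def c_def Suc_le_eq)
        then have "p n * 1 \<le> p n * (b * (r choose s) * r * n ^ (r - s - 1))" by (rule mult_le_mono2)
        then show "p n \<le> b * ((r choose s) * ?w)" by (simp add: mult_ac)
      qed simp
      finally show ?thesis .
    qed
    have "real (chromatic_number (intersection_graph n r s)) \<le> real N * real (p n) ^ (r - s) +
      real (r choose s) * (\<delta> * real Q ^ (r - s) * (real (p n) ^ (r - s) + fact Q)
      + real ?w + real b * real (8 * (b * ((r choose s) * ?w)))) + 1"
      unfolding b_def
      by (rule chromatic_number_le_of_packings[OF sr rQ elim(3) n_le coprime_p F packing uncovered])
         (use large in \<open>auto simp: b_def\<close>)
    also have "\<dots> = real N * real (p n) ^ k + real c * \<delta> * real Q ^ k * (real (p n) ^ k + fact Q)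
      + G * (real (p n) * real n ^ (k - 1)) + 1"
      by (simp add: k_def c_def G_def algebra_simps)
    also have "\<dots> = h n * real n ^ k"
    proof -
      have nk: "real n ^ k = real n * real n ^ (k - 1)" using k by (cases k) auto
      have xk: "x n ^ k * real n ^ k = real (p n) ^ k"
        using elim(3) by (simp add: x_def flip: power_mult_distrib)
      have xn: "x n * real n ^ k = real (p n) * real n ^ (k - 1)"
        unfolding nk using elim(3) by (simp add: x_def)
      have on: "(1 / real n) ^ k * real n ^ k = 1"
        using elim(3) by (simp flip: power_mult_distrib)
      have "h n * real n ^ k = real N * (x n ^ k * real n ^ k)
          + real c * \<delta> * real Q ^ k * (x n ^ k * real n ^ k + fact Q * ((1 / real n) ^ k * real n ^ k))
          + G * (x n * real n ^ k) + (1 / real n) ^ k * real n ^ k"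
        unfolding h_def by (simp only: algebra_simps)
      then show ?thesis unfolding xk xn on by simp
    qed
    also have "\<dots> \<le> (c0 + e) * real n ^ k" using elim(1) by (intro mult_right_mono) auto
    finally show ?case by (simp add: c0_def k_def)
  qed
qed

theorem theorem1p1:
  fixes r s :: nat
  assumes "s < r"
  shows "\<exists>\<epsilon> :: nat \<Rightarrow> real. \<epsilon> \<in> o(\<lambda>_. 1) \<and>
    (\<forall>n. real (chromatic_number (intersection_graph n r s))
       \<le> (1 + \<epsilon> n) * real n ^ (r - s) * (fact (r - s - 1) / fact (2 * r - 2 * s - 1)))"
proof -
  define c0 :: real where "c0 = fact (r - s - 1) / fact (2 * r - 2 * s - 1)"
  define \<chi> where "\<chi> n = real (chromatic_number (intersection_graph n r s))" for n
  define \<epsilon> where "\<epsilon> n = max 0 (\<chi> n / (real n ^ (r - s) * c0) - 1)" for n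
  have c0: "0 < c0" by (simp add: c0_def)
  have "\<epsilon> \<longlonglongrightarrow> 0"
  proof (rule tendstoI)
    fix e :: real assume e: "0 < e"
    have "0 < c0 * (e / 2)" using c0 e by simp
    from chromatic_number_intersection_graph_asymptotic[OF assms this, folded c0_def]
    show "eventually (\<lambda>n. dist (\<epsilon> n) 0 < e) at_top"
      using eventually_gt_at_top[of 0]
    proof eventually_elim
      case (elim n)
      have pos: "0 < real n ^ (r - s) * c0" using elim(2) c0 by simp
      have "\<chi> n \<le> (1 + e / 2) * (real n ^ (r - s) * c0)"
        using elim(1) by (simp add: \<chi>_def algebra_simps)
      then have "\<chi> n / (real n ^ (r - s) * c0) \<le> 1 + e / 2" using pos by (simp only: pos_divide_le_eq)
      then show ?case using e by (simp add: \<epsilon>_def dist_real_def)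
    qed
  qed
  then have "\<epsilon> \<in> o(\<lambda>_. 1)" by (intro smalloI_tendsto) auto
  moreover have "\<chi> n \<le> (1 + \<epsilon> n) * real n ^ (r - s) * c0" for n
  proof (cases "n = 0")
    case True
    have "chromatic_number (intersection_graph n r s) \<le> card ({} :: nat set)"
      using assms True
      by (intro chromatic_number_le[where f = "\<lambda>_. 0"]) (auto simp: intersection_graph_def Let_def)
    then show ?thesis using assms True by (simp add: \<chi>_def power_0_left)
  next
    case False
    then have pos: "0 < real n ^ (r - s) * c0" using c0 by simp
    have "\<chi> n / (real n ^ (r - s) * c0) \<le> 1 + \<epsilon> n" by (simp add: \<epsilon>_def)
    then show ?thesis using pos by (simp add: pos_divide_le_eq mult.assoc)
  qed
  ultimately show ?thesis unfolding \<chi>_def c0_def by blast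
qed

end
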